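(* There are terms $i,o$ of Gödel's $T$ such that $\textsf{E-PRA}^{\omega*}$ proves: for all $\mu^2$ and all $\Theta$, \[ [\textsf{MU}(\mu)\wedge\textsf{SFF}(\Theta)]\rightarrow(\forall X^1)\Big[(\forall g\in i(X,\mu,\Theta))\,\textsf{WO}(g,X)\rightarrow(\exists Y^1\in o(X,\mu,\Theta))\,H_{\theta_0}(X,Y)\Big], \] where $\theta_0(n,Z)$ expresses that $n^0$ is a member of the Turing jump of $Z^1$.
   Context: Types: $0$ is the type of natural numbers, $1=0\to0$, $2=1\to0$, and $\tau^*$ is the type of finite sequences of objects of type $\tau$; for $w$ of type $\tau^*$, $g\in w$ means $g$ equals one of the entries of $w$. $\textsf{E-PRA}^{\omega}$ is Kohlenbach's extensional primitive recursive arithmetic in all finite types (classical logic, extensionality, combinators, the type-$0$ primitive recursor, quantifier-free induction); $\textsf{E-PRA}^{\omega*}$ is its definitional extension with types $\tau^*$. The outputs $i(X,\mu,\Theta)$ and $o(X,\mu,\Theta)$ are of type $1^*$. $\textsf{MU}(\mu)$, for $\mu^2$ (Feferman's search operator): $(\forall f^1)\big((\exists n^0)(f(n)=0)\to f(\mu(f))=0\big)$. $\textsf{SFF}(\Theta)$, for $\Theta$ of type $2\to1^*$ (special fan functional): $(\forall G^2)(\forall f^1\leq_11)(\exists g\in\Theta(G))\big(f\in[\overline{g}G(g)]\big)$, where $f\leq_11$ means $f(n)\le1$ for all $n$, $\overline{g}N=\langle g(0),\dots,g(N-1)\rangle$, and $f\in[\sigma]$ means that $f$ extends $\sigma$. $\textsf{WO}(g,X)$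 is the arithmetical formula expressing that ($X$ codes a countable linear ordering and) $g^1$ is not an infinite descending sequence through $X$; thus $(\forall g^1)\textsf{WO}(g,X)$ says that $X$ is a countable well-ordering. For arithmetical $\theta$, $H_\theta(X,Y)$ says that $Y$ results from iterating $\theta$ along $X$, i.e. $Y=\{(n,j):j\in\text{field}(X)\wedge\theta(n,Y^j)\}$ with $Y^j=\{(m,i)\in Y:i<_Xj\}$ (sets coded by characteristic functions). *)

theory Defs
  imports Main
begin

section \<open>Finite types, terms and formulas\<close>

datatype ty = N | Arr ty ty (infixr "\<Rrightarrow>" 65) | Star ty

abbreviation one :: ty where "one \<equiv> N \<Rrightarrow> N"
abbreviation two :: ty where "two \<equiv> one \<Rrightarrow> N"

text \<open>
  The constants of Goedel's T with sequence types.  A sequence of type \<open>Star \<sigma>\<close> is presented, as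
  in the usual definitional extension, by its length and a function listing its entries:
  \<open>Tab \<sigma> n f\<close> is \<open>\<langle>f 0, \<dots>, f (n - 1)\<rangle>\<close>, and \<open>At \<sigma> s i\<close> is the entry number \<open>i\<close> of \<open>s\<close>.
\<close>

datatype cn =
    Zero
  | Succ
  | Pi ty ty
  | Sigma ty ty ty
  | Rec ty
  | Len ty
  | At ty
  | Tab ty

fun cn_ty :: "cn \<Rightarrow> ty" where
  "cn_ty Zero = N"
| "cn_ty Succ = N \<Rrightarrow> N"
| "cn_ty (Pi \<sigma> \<tau>) = \<sigma> \<Rrightarrow> \<tau> \<Rrightarrow> \<sigma>"
| "cn_ty (Sigma \<rho> \<sigma> \<tau>) = (\<rho> \<Rrightarrow> \<sigma> \<Rrightarrow> \<tau>) \<Rrightarrow> (\<rho> \<Rrightarrow> \<sigma>) \<Rrightarrow> \<rho> \<Rrightarrow> \<tau>"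
| "cn_ty (Rec \<rho>) = N \<Rrightarrow> \<rho> \<Rrightarrow> (\<rho> \<Rrightarrow> N \<Rrightarrow> \<rho>) \<Rrightarrow> \<rho>"
| "cn_ty (Len \<sigma>) = Star \<sigma> \<Rrightarrow> N"
| "cn_ty (At \<sigma>) = Star \<sigma> \<Rrightarrow> N \<Rrightarrow> \<sigma>"
| "cn_ty (Tab \<sigma>) = N \<Rrightarrow> (N \<Rrightarrow> \<sigma>) \<Rrightarrow> Star \<sigma>"

text \<open>
  Variables are de Bruijn indices counted separately for each type: \<open>(\<sigma>, k)\<close> is the variable
  number \<open>k\<close> of type \<open>\<sigma>\<close>, and \<open>All \<sigma>\<close> binds number 0 of type \<open>\<sigma>\<close> and moves only the other
  variables of type \<open>\<sigma>\<close>.  Hence every variable has its type independently of any context.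
\<close>

type_synonym var = "ty \<times> nat"

datatype tm = V var | C cn | App tm tm (infixl "\<cdot>" 90)

fun tyof :: "tm \<Rightarrow> ty option" where
  "tyof (V v) = Some (fst v)"
| "tyof (C c) = Some (cn_ty c)"
| "tyof (s \<cdot> t) = (case (tyof s, tyof t) of
      (Some (\<sigma> \<Rrightarrow> \<tau>), Some \<sigma>') \<Rightarrow> if \<sigma> = \<sigma>' then Some \<tau> else None
    | _ \<Rightarrow> None)"

fun tvars :: "tm \<Rightarrow> var set" where
  "tvars (V v) = {v}"
| "tvars (C c) = {}"
| "tvars (s \<cdot> t) = tvars s \<union> tvars t"

text \<open>Closed terms of Goedel's T (recursors for all types).\<close>

definition godel_T_term :: "tm \<Rightarrow> ty \<Rightarrow> bool" where
  "godel_T_term t \<tau> \<longleftrightarrow> tvars t = {} \<and> tyof t = Some \<tau>"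

fun only_R0 :: "tm \<Rightarrow> bool" where
  "only_R0 (V v) = True"
| "only_R0 (C c) = (case c of Rec \<rho> \<Rightarrow> \<rho> = N | _ \<Rightarrow> True)"
| "only_R0 (s \<cdot> t) = (only_R0 s \<and> only_R0 t)"

text \<open>
  Terms, possibly open, of the language of E-PRA.  Only these occur in derivations, so a term of
  Goedel's T about which E-PRA proves something uses no recursor beyond type \<open>N\<close>.
\<close>

definition pra_term :: "tm \<Rightarrow> ty \<Rightarrow> bool" where
  "pra_term t \<tau> \<longleftrightarrow> tyof t = Some \<tau> \<and> only_R0 t"

text \<open>The only primitive predicate is equality of type \<open>N\<close>.\<close>

datatype fm =
    Eq tm tm (infix "\<^bold>=" 60)
  | Fls
  | Imp fm fm (infixr "\<^bold>\<longrightarrow>" 54)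
  | All ty fm

definition Neg ("\<^bold>\<not> _" [58] 58) where "\<^bold>\<not> \<phi> = (\<phi> \<^bold>\<longrightarrow> Fls)"
definition Conj (infixr "\<^bold>\<and>" 57) where "\<phi> \<^bold>\<and> \<psi> = \<^bold>\<not> (\<phi> \<^bold>\<longrightarrow> \<^bold>\<not> \<psi>)"
definition Disj (infixr "\<^bold>\<or>" 56) where "\<phi> \<^bold>\<or> \<psi> = (\<^bold>\<not> \<phi> \<^bold>\<longrightarrow> \<psi>)"
definition Iff (infix "\<^bold>\<longleftrightarrow>" 53) where "\<phi> \<^bold>\<longleftrightarrow> \<psi> = ((\<phi> \<^bold>\<longrightarrow> \<psi>) \<^bold>\<and> (\<psi> \<^bold>\<longrightarrow> \<phi>))"
definition Ex :: "ty \<Rightarrow> fm \<Rightarrow> fm" where "Ex \<sigma> \<phi> = \<^bold>\<not> All \<sigma> (\<^bold>\<not> \<phi>)"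

fun wff :: "fm \<Rightarrow> bool" where
  "wff (s \<^bold>= t) \<longleftrightarrow> pra_term s N \<and> pra_term t N"
| "wff Fls \<longleftrightarrow> True"
| "wff (\<phi> \<^bold>\<longrightarrow> \<psi>) \<longleftrightarrow> wff \<phi> \<and> wff \<psi>"
| "wff (All \<sigma> \<phi>) \<longleftrightarrow> wff \<phi>"

fun qf :: "fm \<Rightarrow> bool" where
  "qf (s \<^bold>= t) \<longleftrightarrow> True"
| "qf Fls \<longleftrightarrow> True"
| "qf (\<phi> \<^bold>\<longrightarrow> \<psi>) \<longleftrightarrow> qf \<phi> \<and> qf \<psi>"
| "qf (All \<sigma> \<phi>) \<longleftrightarrow> False"


section \<open>Substitution\<close>

fun tsubst :: "(var \<Rightarrow> tm) \<Rightarrow> tm \<Rightarrow> tm" where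
  "tsubst \<theta> (V v) = \<theta> v"
| "tsubst \<theta> (C c) = C c"
| "tsubst \<theta> (s \<cdot> t) = tsubst \<theta> s \<cdot> tsubst \<theta> t"

definition shift :: "ty \<Rightarrow> var \<Rightarrow> tm" where
  "shift \<sigma> = (\<lambda>(\<tau>, k). V (\<tau>, if \<tau> = \<sigma> then Suc k else k))"

definition lift :: "ty \<Rightarrow> tm \<Rightarrow> tm" where
  "lift \<sigma> = tsubst (shift \<sigma>)"

definition under :: "ty \<Rightarrow> (var \<Rightarrow> tm) \<Rightarrow> var \<Rightarrow> tm" where
  "under \<sigma> \<theta> = (\<lambda>(\<tau>, k).
     if \<tau> = \<sigma> then (case k of 0 \<Rightarrow> V (\<sigma>, 0) | Suc m \<Rightarrow> lift \<sigma> (\<theta> (\<sigma>, m)))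
     else lift \<sigma> (\<theta> (\<tau>, k)))"

fun subst :: "(var \<Rightarrow> tm) \<Rightarrow> fm \<Rightarrow> fm" where
  "subst \<theta> (s \<^bold>= t) = (tsubst \<theta> s \<^bold>= tsubst \<theta> t)"
| "subst \<theta> Fls = Fls"
| "subst \<theta> (\<phi> \<^bold>\<longrightarrow> \<psi>) = (subst \<theta> \<phi> \<^bold>\<longrightarrow> subst \<theta> \<psi>)"
| "subst \<theta> (All \<sigma> \<phi>) = All \<sigma> (subst (under \<sigma> \<theta>) \<phi>)"

text \<open>\<open>inst \<sigma> t \<phi>\<close> is the instance of \<open>All \<sigma> \<phi>\<close> at \<open>t\<close>.\<close>

definition inst :: "ty \<Rightarrow> tm \<Rightarrow> fm \<Rightarrow> fm" where
  "inst \<sigma> t = subst (\<lambda>(\<tau>, k).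
     if \<tau> = \<sigma> then (case k of 0 \<Rightarrow> t | Suc m \<Rightarrow> V (\<sigma>, m)) else V (\<tau>, k))"

text \<open>
  Quantification over a freely chosen variable: \<open>bind v\<close> renumbers \<open>v\<close> to 0 and every other
  variable of the same type to its successor.  In formulas written with \<open>all_v\<close> and \<open>ex_v\<close> the
  variables can therefore be read as names.
\<close>

definition bind :: "var \<Rightarrow> fm \<Rightarrow> fm" where
  "bind v = subst (\<lambda>w. if w = v then V (fst v, 0) else shift (fst v) w)"

definition all_v ("(\<^bold>\<forall>_./ _)" [100, 52] 52) where "\<^bold>\<forall>v. \<phi> = All (fst v) (bind v \<phi>)"
definition ex_v ("(\<^bold>\<exists>_./ _)" [100, 52] 52) where "\<^bold>\<exists>v. \<phi> = Ex (fst v) (bind v \<phi>)"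


section \<open>Lambda abstraction and some primitive recursive terms\<close>

text \<open>Bracket abstraction; intended for well-typed terms only.\<close>

fun lam :: "var \<Rightarrow> tm \<Rightarrow> tm" ("(\<^bold>\<lambda>_./ _)" [100, 61] 61) where
  "lam v (V w) = (if v = w
     then C (Sigma (fst v) (fst v \<Rrightarrow> fst v) (fst v)) \<cdot> C (Pi (fst v) (fst v \<Rrightarrow> fst v))
            \<cdot> C (Pi (fst v) (fst v))
     else C (Pi (fst w) (fst v)) \<cdot> V w)"
| "lam v (C c) = C (Pi (cn_ty c) (fst v)) \<cdot> C c"
| "lam v (s \<cdot> t) = (if v \<notin> tvars (s \<cdot> t)
     then C (Pi (the (tyof (s \<cdot> t))) (fst v)) \<cdot> (s \<cdot> t)
     else C (Sigma (fst v) (the (tyof t)) (the (tyof (s \<cdot> t)))) \<cdot> lam v s \<cdot> lam v t)"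

text \<open>
  Bound variables of the closed terms below.  Each function symbol is introduced as a closed
  term, so that applying it to arbitrary arguments cannot capture variables.
\<close>

abbreviation (input) v_a :: var where "v_a \<equiv> (N, 0)"
abbreviation (input) v_b :: var where "v_b \<equiv> (N, 1)"
abbreviation (input) v_c :: var where "v_c \<equiv> (N, 2)"
abbreviation (input) v_d :: var where "v_d \<equiv> (N, 3)"
abbreviation (input) v_e :: var where "v_e \<equiv> (N, 4)"
abbreviation (input) v_h :: var where "v_h \<equiv> (one, 0)"
abbreviation (input) v_p :: var where "v_p \<equiv> (one, 1)"

definition zero :: tm where "zero = C Zero"
definition suc :: "tm \<Rightarrow> tm" where "suc t = C Succ \<cdot> t"
definition unit :: tm where "unit = suc zero"
definition R0 :: "tm \<Rightarrow> tm \<Rightarrow> tm \<Rightarrow> tm" where "R0 n y z = C (Rec N) \<cdot> n \<cdot> y \<cdot> z"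

definition pred_c :: tm where
  "pred_c = (\<^bold>\<lambda>v_a. R0 (V v_a) zero (\<^bold>\<lambda>v_b. \<^bold>\<lambda>v_c. V v_c))"
definition pred :: "tm \<Rightarrow> tm" where "pred t = pred_c \<cdot> t"

definition add_c :: tm where
  "add_c = (\<^bold>\<lambda>v_a. \<^bold>\<lambda>v_b. R0 (V v_b) (V v_a) (\<^bold>\<lambda>v_c. \<^bold>\<lambda>v_d. suc (V v_c)))"
definition add :: "tm \<Rightarrow> tm \<Rightarrow> tm" where "add s t = add_c \<cdot> s \<cdot> t"

text \<open>Truncated subtraction.\<close>

definition sub_c :: tm where
  "sub_c = (\<^bold>\<lambda>v_a. \<^bold>\<lambda>v_b. R0 (V v_b) (V v_a) (\<^bold>\<lambda>v_c. \<^bold>\<lambda>v_d. pred (V v_c)))"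
definition sub :: "tm \<Rightarrow> tm \<Rightarrow> tm" where "sub s t = sub_c \<cdot> s \<cdot> t"

definition le :: "tm \<Rightarrow> tm \<Rightarrow> fm" where "le s t = (sub s t \<^bold>= zero)"
definition lt :: "tm \<Rightarrow> tm \<Rightarrow> fm" where "lt s t = le (suc s) t"

text \<open>\<open>diff s t\<close> is the distance of \<open>s\<close> and \<open>t\<close>, which is 0 iff they are equal.\<close>

definition diff :: "tm \<Rightarrow> tm \<Rightarrow> tm" where "diff s t = add (sub s t) (sub t s)"

text \<open>\<open>ifz c s t\<close> is \<open>s\<close> if \<open>c = 0\<close>, and \<open>t\<close> otherwise.\<close>

definition ifz_c :: tm where
  "ifz_c = (\<^bold>\<lambda>v_a. \<^bold>\<lambda>v_b. \<^bold>\<lambda>v_c. R0 (V v_a) (V v_b) (\<^bold>\<lambda>v_d. \<^bold>\<lambda>v_e. V v_c))"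
definition ifz :: "tm \<Rightarrow> tm \<Rightarrow> tm \<Rightarrow> tm" where "ifz c s t = ifz_c \<cdot> c \<cdot> s \<cdot> t"

text \<open>\<open>least n h\<close> is the least \<open>i < n\<close> with \<open>h i = 0\<close>, and \<open>n\<close> if there is none.\<close>

definition least_c :: tm where
  "least_c = (\<^bold>\<lambda>v_a. \<^bold>\<lambda>v_h. R0 (V v_a) zero
     (\<^bold>\<lambda>v_c. \<^bold>\<lambda>v_d. ifz (V v_h \<cdot> V v_c) (V v_c) (suc (V v_d))))"
definition least :: "tm \<Rightarrow> tm \<Rightarrow> tm" where "least n h = least_c \<cdot> n \<cdot> h"

text \<open>The Cantor pairing \<open>(a + b)(a + b + 1)/2 + a\<close>, a bijection, and its projections.\<close>

definition triangle_c :: tm where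
  "triangle_c = (\<^bold>\<lambda>v_a. R0 (V v_a) zero (\<^bold>\<lambda>v_c. \<^bold>\<lambda>v_d. add (V v_c) (suc (V v_d))))"

definition pair_c :: tm where
  "pair_c = (\<^bold>\<lambda>v_a. \<^bold>\<lambda>v_b. add (triangle_c \<cdot> add (V v_a) (V v_b)) (V v_a))"
definition pair :: "tm \<Rightarrow> tm \<Rightarrow> tm" where "pair s t = pair_c \<cdot> s \<cdot> t"

definition fst_c :: tm where
  "fst_c = (\<^bold>\<lambda>v_c. least (suc (V v_c)) (\<^bold>\<lambda>v_a. diff (V v_c)
     (pair (V v_a) (least (suc (V v_c)) (\<^bold>\<lambda>v_b. diff (V v_c) (pair (V v_a) (V v_b)))))))"
definition tfst :: "tm \<Rightarrow> tm" where "tfst t = fst_c \<cdot> t"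

definition snd_c :: tm where
  "snd_c = (\<^bold>\<lambda>v_c. least (suc (V v_c)) (\<^bold>\<lambda>v_b. diff (V v_c) (pair (tfst (V v_c)) (V v_b))))"
definition tsnd :: "tm \<Rightarrow> tm" where "tsnd t = snd_c \<cdot> t"


section \<open>Equality of higher type, sequences\<close>

abbreviation len :: "ty \<Rightarrow> tm \<Rightarrow> tm" where "len \<sigma> s \<equiv> C (Len \<sigma>) \<cdot> s"
abbreviation entry :: "ty \<Rightarrow> tm \<Rightarrow> tm \<Rightarrow> tm" where "entry \<sigma> s i \<equiv> C (At \<sigma>) \<cdot> s \<cdot> i"

fun eq :: "ty \<Rightarrow> tm \<Rightarrow> tm \<Rightarrow> fm" where
  "eq N s t = (s \<^bold>= t)"
| "eq (\<sigma> \<Rrightarrow> \<tau>) s t = All \<sigma> (eq \<tau> (lift \<sigma> s \<cdot> V (\<sigma>, 0)) (lift \<sigma> t \<cdot> V (\<sigma>, 0)))"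
| "eq (Star \<sigma>) s t = (len \<sigma> s \<^bold>= len \<sigma> t) \<^bold>\<and>
     All N (lt (V (N, 0)) (len \<sigma> (lift N s)) \<^bold>\<longrightarrow>
       eq \<sigma> (entry \<sigma> (lift N s) (V (N, 0))) (entry \<sigma> (lift N t) (V (N, 0))))"

text \<open>\<open>x \<in> w\<close> for \<open>w\<close> of type \<open>Star \<sigma>\<close>: some entry of \<open>w\<close> equals \<open>x\<close>.\<close>

definition mem_seq :: "ty \<Rightarrow> tm \<Rightarrow> tm \<Rightarrow> fm" where
  "mem_seq \<sigma> x w = Ex N (lt (V (N, 0)) (len \<sigma> (lift N w)) \<^bold>\<and>
     eq \<sigma> (lift N x) (entry \<sigma> (lift N w) (V (N, 0))))"

text \<open>The zero object of each type, the value of \<open>At\<close> beyond the length of a sequence.\<close>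

fun zero_of :: "ty \<Rightarrow> tm" where
  "zero_of N = zero"
| "zero_of (\<sigma> \<Rrightarrow> \<tau>) = C (Pi \<tau> \<sigma>) \<cdot> zero_of \<tau>"
| "zero_of (Star \<sigma>) = C (Tab \<sigma>) \<cdot> zero \<cdot> (C (Pi \<sigma> N) \<cdot> zero_of \<sigma>)"


section \<open>The system E-PRA with finite sequences\<close>

text \<open>Derivability in many-sorted classical first-order logic, from a set of axioms.\<close>

inductive proves :: "fm set \<Rightarrow> fm \<Rightarrow> bool" (infix "\<turnstile>" 50) for A :: "fm set" where
  axiom: "\<phi> \<in> A \<Longrightarrow> A \<turnstile> \<phi>"
| imp_k: "wff \<phi> \<Longrightarrow> wff \<psi> \<Longrightarrow> A \<turnstile> (\<phi> \<^bold>\<longrightarrow> \<psi> \<^bold>\<longrightarrow> \<phi>)"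
| imp_s: "wff \<phi> \<Longrightarrow> wff \<psi> \<Longrightarrow> wff \<chi> \<Longrightarrow>
    A \<turnstile> ((\<phi> \<^bold>\<longrightarrow> \<psi> \<^bold>\<longrightarrow> \<chi>) \<^bold>\<longrightarrow> (\<phi> \<^bold>\<longrightarrow> \<psi>) \<^bold>\<longrightarrow> \<phi> \<^bold>\<longrightarrow> \<chi>)"
| double_neg: "wff \<phi> \<Longrightarrow> A \<turnstile> (((\<phi> \<^bold>\<longrightarrow> Fls) \<^bold>\<longrightarrow> Fls) \<^bold>\<longrightarrow> \<phi>)"
| all_inst: "wff \<phi> \<Longrightarrow> pra_term t \<sigma> \<Longrightarrow> A \<turnstile> (All \<sigma> \<phi> \<^bold>\<longrightarrow> inst \<sigma> t \<phi>)"
| all_imp: "wff \<phi> \<Longrightarrow> wff \<psi> \<Longrightarrow>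
    A \<turnstile> (All \<sigma> (subst (shift \<sigma>) \<phi> \<^bold>\<longrightarrow> \<psi>) \<^bold>\<longrightarrow> \<phi> \<^bold>\<longrightarrow> All \<sigma> \<psi>)"
| mp: "A \<turnstile> (\<phi> \<^bold>\<longrightarrow> \<psi>) \<Longrightarrow> A \<turnstile> \<phi> \<Longrightarrow> A \<turnstile> \<psi>"
| gen: "A \<turnstile> \<phi> \<Longrightarrow> A \<turnstile> All \<sigma> \<phi>"

text \<open>In \<open>qf_induction\<close> the induction variable is number 0 of type \<open>N\<close>.\<close>

inductive_set E_PRA :: "fm set" where
  eq_refl: "pra_term x N \<Longrightarrow> (x \<^bold>= x) \<in> E_PRA"
| eq_sym: "pra_term x N \<Longrightarrow> pra_term y N \<Longrightarrow> (x \<^bold>= y \<^bold>\<longrightarrow> y \<^bold>= x) \<in> E_PRA"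
| eq_trans: "pra_term x N \<Longrightarrow> pra_term y N \<Longrightarrow> pra_term z N \<Longrightarrow>
    (x \<^bold>= y \<^bold>\<longrightarrow> y \<^bold>= z \<^bold>\<longrightarrow> x \<^bold>= z) \<in> E_PRA"
| suc_not_zero: "pra_term x N \<Longrightarrow> (\<^bold>\<not> (suc x \<^bold>= zero)) \<in> E_PRA"
| suc_inject: "pra_term x N \<Longrightarrow> pra_term y N \<Longrightarrow> (suc x \<^bold>= suc y \<^bold>\<longrightarrow> x \<^bold>= y) \<in> E_PRA"
| qf_induction: "wff \<phi> \<Longrightarrow> qf \<phi> \<Longrightarrow>
    (inst N zero \<phi> \<^bold>\<and>
     All N (\<phi> \<^bold>\<longrightarrow> subst (\<lambda>v. if v = (N, 0) then suc (V v) else V v) \<phi>)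
       \<^bold>\<longrightarrow> All N \<phi>) \<in> E_PRA"
| extensionality: "pra_term z (\<sigma> \<Rrightarrow> \<tau>) \<Longrightarrow> pra_term x \<sigma> \<Longrightarrow> pra_term y \<sigma> \<Longrightarrow>
    (eq \<sigma> x y \<^bold>\<longrightarrow> eq \<tau> (z \<cdot> x) (z \<cdot> y)) \<in> E_PRA"
| Pi: "pra_term x \<sigma> \<Longrightarrow> pra_term y \<tau> \<Longrightarrow> eq \<sigma> (C (Pi \<sigma> \<tau>) \<cdot> x \<cdot> y) x \<in> E_PRA"
| Sigma: "pra_term x (\<rho> \<Rrightarrow> \<sigma> \<Rrightarrow> \<tau>) \<Longrightarrow> pra_term y (\<rho> \<Rrightarrow> \<sigma>) \<Longrightarrow> pra_term z \<rho> \<Longrightarrow>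
    eq \<tau> (C (Sigma \<rho> \<sigma> \<tau>) \<cdot> x \<cdot> y \<cdot> z) (x \<cdot> z \<cdot> (y \<cdot> z)) \<in> E_PRA"
| R0_zero: "pra_term y N \<Longrightarrow> pra_term z (N \<Rrightarrow> N \<Rrightarrow> N) \<Longrightarrow>
    (R0 zero y z \<^bold>= y) \<in> E_PRA"
| R0_suc: "pra_term x N \<Longrightarrow> pra_term y N \<Longrightarrow> pra_term z (N \<Rrightarrow> N \<Rrightarrow> N) \<Longrightarrow>
    (R0 (suc x) y z \<^bold>= z \<cdot> R0 x y z \<cdot> x) \<in> E_PRA"
| Len_Tab: "pra_term n N \<Longrightarrow> pra_term f (N \<Rrightarrow> \<sigma>) \<Longrightarrow>
    (len \<sigma> (C (Tab \<sigma>) \<cdot> n \<cdot> f) \<^bold>= n) \<in> E_PRA"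
| At_Tab: "pra_term n N \<Longrightarrow> pra_term f (N \<Rrightarrow> \<sigma>) \<Longrightarrow> pra_term i N \<Longrightarrow>
    (lt i n \<^bold>\<longrightarrow> eq \<sigma> (entry \<sigma> (C (Tab \<sigma>) \<cdot> n \<cdot> f) i) (f \<cdot> i)) \<in> E_PRA"
| At_beyond: "pra_term s (Star \<sigma>) \<Longrightarrow> pra_term i N \<Longrightarrow>
    (\<^bold>\<not> lt i (len \<sigma> s) \<^bold>\<longrightarrow> eq \<sigma> (entry \<sigma> s i) (zero_of \<sigma>)) \<in> E_PRA"


section \<open>The functionals\<close>

abbreviation SFF_ty :: ty where "SFF_ty \<equiv> two \<Rrightarrow> Star one"

abbreviation (input) v_n :: var where "v_n \<equiv> (N, 0)"
abbreviation (input) v_i :: var where "v_i \<equiv> (N, 1)"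
abbreviation (input) v_j :: var where "v_j \<equiv> (N, 2)"
abbreviation (input) v_k :: var where "v_k \<equiv> (N, 3)"
abbreviation v_X :: var where "v_X \<equiv> (one, 0)"
abbreviation v_Y :: var where "v_Y \<equiv> (one, 1)"
abbreviation v_g :: var where "v_g \<equiv> (one, 2)"
abbreviation v_f :: var where "v_f \<equiv> (one, 3)"
abbreviation v_mu :: var where "v_mu \<equiv> (two, 0)"
abbreviation v_G :: var where "v_G \<equiv> (two, 1)"
abbreviation v_Theta :: var where "v_Theta \<equiv> (SFF_ty, 0)"

text \<open>
  In the definitions of this and the next section the arguments must not contain the variables
  bound by \<open>all_v\<close> and \<open>ex_v\<close> in the body; they are only used with the variables above.
\<close>

definition MU :: "tm \<Rightarrow> fm" where
  "MU mu = (\<^bold>\<forall>v_f. (\<^bold>\<exists>v_n. V v_f \<cdot> V v_n \<^bold>= zero) \<^bold>\<longrightarrow> V v_f \<cdot> (mu \<cdot> V v_f) \<^bold>= zero)"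

definition binary :: "tm \<Rightarrow> fm" where
  "binary f = All N (le (lift N f \<cdot> V (N, 0)) unit)"

definition initseg :: "tm \<Rightarrow> tm \<Rightarrow> tm" where
  "initseg g n = C (Tab N) \<cdot> n \<cdot> g"

definition extends :: "tm \<Rightarrow> tm \<Rightarrow> fm" where
  "extends f s = All N (lt (V (N, 0)) (len N (lift N s)) \<^bold>\<longrightarrow>
     lift N f \<cdot> V (N, 0) \<^bold>= entry N (lift N s) (V (N, 0)))"

definition SFF :: "tm \<Rightarrow> fm" where
  "SFF Theta = (\<^bold>\<forall>v_G. \<^bold>\<forall>v_f. binary (V v_f) \<^bold>\<longrightarrow>
     (\<^bold>\<exists>v_g. mem_seq one (V v_g) (Theta \<cdot> V v_G) \<^bold>\<and>
        extends (V v_f) (initseg (V v_g) (V v_G \<cdot> V v_g))))"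


section \<open>Sets, countable linear orderings and iteration along them\<close>

definition mem :: "tm \<Rightarrow> tm \<Rightarrow> fm" where "mem n Z = (Z \<cdot> n \<^bold>= unit)"

definition le_in :: "tm \<Rightarrow> tm \<Rightarrow> tm \<Rightarrow> fm" where "le_in X i j = mem (pair i j) X"
definition less_in :: "tm \<Rightarrow> tm \<Rightarrow> tm \<Rightarrow> fm" where
  "less_in X i j = le_in X i j \<^bold>\<and> \<^bold>\<not> le_in X j i"
definition field_in :: "tm \<Rightarrow> tm \<Rightarrow> fm" where "field_in X j = le_in X j j"

definition LO :: "tm \<Rightarrow> fm" where
  "LO X =
     (\<^bold>\<forall>v_i. \<^bold>\<forall>v_j. le_in X (V v_i) (V v_j) \<^bold>\<longrightarrow> field_in X (V v_i) \<^bold>\<and> field_in X (V v_j)) \<^bold>\<and>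
     (\<^bold>\<forall>v_i. \<^bold>\<forall>v_j. \<^bold>\<forall>v_k. le_in X (V v_i) (V v_j) \<^bold>\<and> le_in X (V v_j) (V v_k) \<^bold>\<longrightarrow>
        le_in X (V v_i) (V v_k)) \<^bold>\<and>
     (\<^bold>\<forall>v_i. \<^bold>\<forall>v_j. le_in X (V v_i) (V v_j) \<^bold>\<and> le_in X (V v_j) (V v_i) \<^bold>\<longrightarrow>
        V v_i \<^bold>= V v_j) \<^bold>\<and>
     (\<^bold>\<forall>v_i. \<^bold>\<forall>v_j. field_in X (V v_i) \<^bold>\<and> field_in X (V v_j) \<^bold>\<longrightarrow>
        le_in X (V v_i) (V v_j) \<^bold>\<or> le_in X (V v_j) (V v_i))"

definition WO :: "tm \<Rightarrow> tm \<Rightarrow> fm" where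
  "WO g X = LO X \<^bold>\<and> \<^bold>\<not> (\<^bold>\<forall>v_n. less_in X (g \<cdot> suc (V v_n)) (g \<cdot> V v_n))"

text \<open>
  \<open>below X Y j\<close> is the characteristic function of \<open>Y\<^sup>j = {(m, i) \<in> Y. i <\<^sub>X j}\<close>.  Sums of
  distances vanish iff all of them do.
\<close>

definition below_c :: tm where
  "below_c = (\<^bold>\<lambda>v_h. \<^bold>\<lambda>v_p. \<^bold>\<lambda>v_b. \<^bold>\<lambda>v_a.
     ifz (add (diff (V v_p \<cdot> V v_a) unit) (diff (V v_h \<cdot> pair (tsnd (V v_a)) (V v_b)) unit))
       (ifz (diff (V v_h \<cdot> pair (V v_b) (tsnd (V v_a))) unit) zero unit)
       zero)"
definition below :: "tm \<Rightarrow> tm \<Rightarrow> tm \<Rightarrow> tm" where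
  "below X Y j = below_c \<cdot> X \<cdot> Y \<cdot> j"

definition H :: "(tm \<Rightarrow> tm \<Rightarrow> fm) \<Rightarrow> tm \<Rightarrow> tm \<Rightarrow> fm" where
  "H \<theta> X Y = binary Y \<^bold>\<and>
     (\<^bold>\<forall>v_n. \<^bold>\<forall>v_j. mem (pair (V v_n) (V v_j)) Y \<^bold>\<longleftrightarrow>
        field_in X (V v_j) \<^bold>\<and> \<theta> (V v_n) (below X Y (V v_j)))"


section \<open>The Turing jump\<close>

text \<open>
  Oracle register machines.  Every number \<open>c\<close> codes an eventually vanishing stream, whose entry
  number \<open>k\<close> is \<open>fst (snd\<^sup>k c)\<close>.  A program is a stream of instructions \<open>(op, k, l)\<close>, paired as
  \<open>pair op (pair k l)\<close>; a configuration is a pair of a program counter \<open>p\<close> and a stream \<open>r\<close> of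
  register contents.  The instructions are: halt (\<open>op = 0\<close>); increment register \<open>k\<close>
  (\<open>op = 1\<close>); if register \<open>k\<close> is 0 then jump to \<open>l\<close>, else decrement it (\<open>op = 2\<close>); if the content
  of register \<open>k\<close> belongs to the oracle then jump to \<open>l\<close> (\<open>op \<ge> 3\<close>).
\<close>

definition drop_c :: tm where
  "drop_c = (\<^bold>\<lambda>v_a. \<^bold>\<lambda>v_b. R0 (V v_b) (V v_a) (\<^bold>\<lambda>v_c. \<^bold>\<lambda>v_d. tsnd (V v_c)))"

definition nth_c :: tm where
  "nth_c = (\<^bold>\<lambda>v_a. \<^bold>\<lambda>v_b. tfst (drop_c \<cdot> V v_a \<cdot> V v_b))"
definition tnth :: "tm \<Rightarrow> tm \<Rightarrow> tm" where "tnth r k = nth_c \<cdot> r \<cdot> k"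

text \<open>\<open>upd r k x\<close> replaces entry number \<open>k\<close> of \<open>r\<close> by \<open>x\<close>: the entries \<open>k - 1, \<dots>, 0\<close> of \<open>r\<close> are
  put in front of \<open>pair x (snd\<^sup>k\<^sup>+\<^sup>1 r)\<close>.\<close>

definition upd_c :: tm where
  "upd_c = (\<^bold>\<lambda>v_a. \<^bold>\<lambda>v_b. \<^bold>\<lambda>v_e. R0 (V v_b) (pair (V v_e) (drop_c \<cdot> V v_a \<cdot> suc (V v_b)))
     (\<^bold>\<lambda>v_c. \<^bold>\<lambda>v_d. pair (tnth (V v_a) (sub (V v_b) (suc (V v_d)))) (V v_c)))"
definition upd :: "tm \<Rightarrow> tm \<Rightarrow> tm \<Rightarrow> tm" where "upd r k x = upd_c \<cdot> r \<cdot> k \<cdot> x"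

text \<open>\<open>exec_c\<close> executes the instruction \<open>w\<close> in the configuration \<open>c\<close>, with oracle \<open>Z\<close>.\<close>

definition exec_c :: tm where
  "exec_c = (\<^bold>\<lambda>v_h. \<^bold>\<lambda>v_a. \<^bold>\<lambda>v_b.
     (let Z = V v_h; w = V v_a; c = V v_b;
          op = tfst w; k = tfst (tsnd w); l = tsnd (tsnd w);
          p = tfst c; r = tsnd c; x = tnth r k
      in ifz op c
        (ifz (diff op unit) (pair (suc p) (upd r k (suc x)))
          (ifz (diff op (suc unit))
            (ifz x (pair l r) (pair (suc p) (upd r k (pred x))))
            (ifz (diff (Z \<cdot> x) unit) (pair l r) (pair (suc p) r))))))"

text \<open>The current instruction of program \<open>e\<close> in configuration \<open>c\<close>.\<close>

definition instr :: "tm \<Rightarrow> tm \<Rightarrow> tm" where "instr e c = tnth e (tfst c)"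

text \<open>The configuration after \<open>t\<close> steps on input \<open>x\<close>, which is initially in register 0.\<close>

definition run_c :: tm where
  "run_c = (\<^bold>\<lambda>v_h. \<^bold>\<lambda>v_a. \<^bold>\<lambda>v_b. \<^bold>\<lambda>v_e. R0 (V v_e) (pair zero (pair (V v_b) zero))
     (\<^bold>\<lambda>v_c. \<^bold>\<lambda>v_d. exec_c \<cdot> V v_h \<cdot> instr (V v_a) (V v_c) \<cdot> V v_c))"
definition run :: "tm \<Rightarrow> tm \<Rightarrow> tm \<Rightarrow> tm \<Rightarrow> tm" where
  "run Z e x t = run_c \<cdot> Z \<cdot> e \<cdot> x \<cdot> t"

text \<open>\<open>n\<close> belongs to the jump of \<open>Z\<close> iff machine \<open>n\<close> with oracle \<open>Z\<close> halts on input \<open>n\<close>.\<close>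

definition theta0 :: "tm \<Rightarrow> tm \<Rightarrow> fm" where
  "theta0 n Z = Ex N
     (tfst (instr (lift N n) (run (lift N Z) (lift N n) (lift N n) (V (N, 0)))) \<^bold>= zero)"

end

theory Submission
  imports Defs "HOL-Library.Countable"
begin

text \<open>
  By completeness of the calculus it suffices to argue in an arbitrary extensional model of E-PRA.

  Call a number \<open>p\<close> bad for \<open>f\<close> if \<open>f p\<close> differs from the value that the equation \<open>H\<^sub>\<theta>(X, f)\<close>
  demands at \<open>p\<close>; then \<open>f\<close> is the hierarchy along \<open>X\<close> iff it has no bad numbers.  With \<open>\<mu>\<close> let
  \<open>G f = p + 1\<close>, where \<open>p\<close> is bad for \<open>f\<close> and minimal with respect to the \<open>X\<close>-order of second
  components.  If every entry \<open>g\<close> of \<open>\<Theta>(G)\<close> had a bad number, the neighbourhoods given by \<open>G\<close> would not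
  cover Cantor space: the value demanded at a minimal bad number \<open>p\<close> depends on \<open>g\<close> only below \<open>p\<close>,
  where \<open>g\<close> solves the equation, and is hence the same for all entries with minimal bad number \<open>p\<close>;
  the function \<open>diag\<close> that takes these values differs from every entry \<open>g\<close> at \<open>G g - 1\<close>.

  Well-foundedness of \<open>X\<close> enters only through minimal elements of the sets of bad numbers of the
  entries and of the sets where two entries differ.  Hence one descending sequence suffices as input.
\<close>

section \<open>Substitution and typing\<close>

text \<open>A model may contain nonstandard numbers, and what it regards as a well-ordering need not
  be well-founded from outside. Induction is therefore available only for quantifier-free formulas,
  and along \<open>X\<close> only through the sequence in the input. \<open>\<mu>\<close> makes this
  enough: it turns arithmetical conditions into equations between numbers, so the choice of a
  minimal bad number, the descent through a set and the test whether a descent is infinite are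
  values of terms whose recursions have type \<open>N\<close>.

  A number codes a pair \<open>(n, j)\<close>, and the value demanded there depends on all pairs of
  stages below \<open>j\<close>; this is why only second components are compared. Pairs of the same
  stage tie, so minimal bad numbers are not unique and \<open>G\<close> has to select one. That two
  entries with the same selected \<open>p\<close> agree below it is uniqueness of the hierarchy up
  to a stage, which is itself a use of the well-ordering; hence the sets of differences.

  The computations of the oracle machines are never analysed. Extensionality makes pointwise equal
  oracles identical objects, and identical oracles give identical jumps.\<close>

definition ext :: "ty \<Rightarrow> 'a \<Rightarrow> (var \<Rightarrow> 'a) \<Rightarrow> var \<Rightarrow> 'a" where
  "ext \<sigma> x \<rho> = (\<lambda>(\<tau>, k).
     if \<tau> = \<sigma> then (case k of 0 \<Rightarrow> x | Suc m \<Rightarrow> \<rho> (\<sigma>, m)) else \<rho> (\<tau>, k))"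

lemma ext_simps [simp]:
  "ext \<sigma> x \<rho> (\<sigma>, 0) = x"
  "ext \<sigma> x \<rho> (\<sigma>, Suc m) = \<rho> (\<sigma>, m)"
  "\<tau> \<noteq> \<sigma> \<Longrightarrow> ext \<sigma> x \<rho> (\<tau>, k) = \<rho> (\<tau>, k)"
  by (auto simp: ext_def)

text \<open>\<open>ext\<close> is polymorphic: with terms as values it describes \<open>inst\<close>
  and \<open>under\<close>, with objects of a model as values it is the environment for a bound
  variable. The same simplification rules serve both.\<close>

lemma inst_ext: "inst \<sigma> t = subst (ext \<sigma> t V)"
  unfolding inst_def ext_def ..

lemma under_ext: "under \<sigma> \<theta> = ext \<sigma> (V (\<sigma>, 0)) (\<lambda>v. lift \<sigma> (\<theta> v))"
  unfolding under_def ext_def by auto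

lemma ext_shift: "ext \<sigma> (V (\<sigma>, 0)) (shift \<sigma>) = V"
  by (auto simp: ext_def shift_def fun_eq_iff split: nat.splits)

lemma tsubst_V [simp]: "tsubst V t = t"
  by (induction t) auto

lemma tsubst_tsubst [simp]: "tsubst \<theta> (tsubst \<eta> t) = tsubst (\<lambda>v. tsubst \<theta> (\<eta> v)) t"
  by (induction t) auto

lemma tsubst_cong: "(\<And>v. v \<in> tvars t \<Longrightarrow> \<theta> v = \<eta> v) \<Longrightarrow> tsubst \<theta> t = tsubst \<eta> t"
  by (induction t) auto

lemma tsubst_closed: "tvars t = {} \<Longrightarrow> tsubst \<theta> t = t"
  using tsubst_cong[of t \<theta> V] by simp

lemma tsubst_ext_shift [simp]: "tsubst (ext \<sigma> t \<theta>) (shift \<sigma> v) = \<theta> v"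
  by (cases v) (auto simp: shift_def)

lemma tsubst_ext_lift [simp]: "tsubst (ext \<sigma> t \<theta>) (lift \<sigma> s) = tsubst \<theta> s"
  by (simp add: lift_def)

lemma tsubst_ext: "tsubst \<theta> (ext \<sigma> t \<eta> v) = ext \<sigma> (tsubst \<theta> t) (\<lambda>v. tsubst \<theta> (\<eta> v)) v"
  by (cases v) (auto simp: ext_def split: nat.splits)

lemma tsubst_under_lift: "tsubst (under \<sigma> \<theta>) (lift \<sigma> t) = lift \<sigma> (tsubst \<theta> t)"
  by (simp add: under_ext) (simp add: lift_def)

lemma subst_V [simp]: "subst V \<phi> = \<phi>"
proof (induction \<phi>)
  case (All \<sigma> \<phi>)
  have "under \<sigma> V = V"
    using ext_shift[of \<sigma>] by (simp add: under_ext lift_def)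
  then show ?case using All by simp
qed auto

lemma subst_subst [simp]: "subst \<theta> (subst \<eta> \<phi>) = subst (\<lambda>v. tsubst \<theta> (\<eta> v)) \<phi>"
proof (induction \<phi> arbitrary: \<theta> \<eta>)
  case (All \<sigma> \<phi>)
  have "(\<lambda>v. tsubst (under \<sigma> \<theta>) (under \<sigma> \<eta> v)) = under \<sigma> (\<lambda>v. tsubst \<theta> (\<eta> v))"
    by (rule ext) (simp add: under_ext[of \<sigma> \<eta>] tsubst_ext tsubst_under_lift,
        simp add: under_ext)
  then show ?case using All by simp
qed auto

lemma inst_subst_under [simp]: "inst \<sigma> t (subst (under \<sigma> \<theta>) \<phi>) = subst (ext \<sigma> t \<theta>) \<phi>"
  by (simp add: inst_ext under_ext tsubst_ext)

lemma inst_subst: "subst \<theta> (inst \<sigma> t \<phi>) = inst \<sigma> (tsubst \<theta> t) (subst (under \<sigma> \<theta>) \<phi>)"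
  by (simp add: inst_ext[of \<sigma> t] tsubst_ext)

text \<open>The condition covers all variables, occurring or not; so it survives
  \<open>under\<close> without any account of free variables.\<close>

definition wt_subst :: "(var \<Rightarrow> tm) \<Rightarrow> bool" where
  "wt_subst \<theta> \<longleftrightarrow> (\<forall>v. pra_term (\<theta> v) (fst v))"

lemma tyof_tsubst: "wt_subst \<theta> \<Longrightarrow> tyof (tsubst \<theta> t) = tyof t"
  by (induction t) (auto simp: wt_subst_def pra_term_def)

lemma only_R0_tsubst: "wt_subst \<theta> \<Longrightarrow> only_R0 t \<Longrightarrow> only_R0 (tsubst \<theta> t)"
  by (induction t) (auto simp: wt_subst_def pra_term_def)

lemma pra_term_tsubst: "wt_subst \<theta> \<Longrightarrow> pra_term t \<sigma> \<Longrightarrow> pra_term (tsubst \<theta> t) \<sigma>"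
  by (simp add: pra_term_def tyof_tsubst only_R0_tsubst)

lemma wt_subst_V [simp]: "wt_subst V"
  by (simp add: wt_subst_def pra_term_def)

lemma wt_subst_shift [simp]: "wt_subst (shift \<sigma>)"
  by (simp add: wt_subst_def pra_term_def shift_def split: prod.splits)

lemma wt_subst_ext [simp]: "pra_term t \<sigma> \<Longrightarrow> wt_subst \<theta> \<Longrightarrow> wt_subst (ext \<sigma> t \<theta>)"
  by (force simp: wt_subst_def ext_def split: nat.splits)

lemma pra_term_lift: "pra_term t \<tau> \<Longrightarrow> pra_term (lift \<sigma> t) \<tau>"
  by (simp add: lift_def pra_term_tsubst)

lemma pra_term_V [simp]: "pra_term (V v) \<tau> \<longleftrightarrow> fst v = \<tau>"
  by (auto simp: pra_term_def)

lemma wt_subst_under [simp]: "wt_subst \<theta> \<Longrightarrow> wt_subst (under \<sigma> \<theta>)"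
  unfolding under_ext by (rule wt_subst_ext) (simp_all add: wt_subst_def pra_term_lift)

lemma wff_subst: "wt_subst \<theta> \<Longrightarrow> wff \<phi> \<Longrightarrow> wff (subst \<theta> \<phi>)"
  by (induction \<phi> arbitrary: \<theta>) (auto simp: pra_term_tsubst)

lemma qf_subst: "qf \<phi> \<Longrightarrow> qf (subst \<theta> \<phi>)"
  by (induction \<phi>) auto

lemma wff_inst: "pra_term t \<sigma> \<Longrightarrow> wff \<phi> \<Longrightarrow> wff (inst \<sigma> t \<phi>)"
  by (simp add: inst_ext wff_subst)

lemma wff_connectives [simp]:
  "wff (\<^bold>\<not> \<phi>) \<longleftrightarrow> wff \<phi>"
  "wff (\<phi> \<^bold>\<and> \<psi>) \<longleftrightarrow> wff \<phi> \<and> wff \<psi>"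
  "wff (\<phi> \<^bold>\<or> \<psi>) \<longleftrightarrow> wff \<phi> \<and> wff \<psi>"
  "wff (\<phi> \<^bold>\<longleftrightarrow> \<psi>) \<longleftrightarrow> wff \<phi> \<and> wff \<psi>"
  "wff (Ex \<sigma> \<phi>) \<longleftrightarrow> wff \<phi>"
  by (auto simp: Neg_def Conj_def Disj_def Iff_def Ex_def)

lemma wff_bind: "wff \<phi> \<Longrightarrow> wff (bind v \<phi>)"
  unfolding bind_def
  by (rule wff_subst) (auto simp: wt_subst_def shift_def)

lemma wff_all_v [simp]: "wff \<phi> \<Longrightarrow> wff (\<^bold>\<forall>v. \<phi>)"
  and wff_ex_v [simp]: "wff \<phi> \<Longrightarrow> wff (\<^bold>\<exists>v. \<phi>)"
  by (simp_all add: all_v_def ex_v_def wff_bind)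

lemma subst_connectives [simp]:
  "subst \<theta> (\<^bold>\<not> \<phi>) = \<^bold>\<not> subst \<theta> \<phi>"
  "subst \<theta> (\<phi> \<^bold>\<and> \<psi>) = subst \<theta> \<phi> \<^bold>\<and> subst \<theta> \<psi>"
  by (simp_all add: Neg_def Conj_def)


section \<open>Closed terms\<close>

text \<open>The equation includes terms without a type, so no typing premise arises. With the two
  rules after it, the closed terms are checked by simplification and abstractions are never expanded
  into combinators.\<close>

lemma tyof_lam [simp]: "tyof (lam v t) = map_option (Arr (fst v)) (tyof t)"
  by (induction t) (auto split: option.splits ty.splits)

lemma only_R0_lam [simp]: "only_R0 (lam v t) \<longleftrightarrow> only_R0 t"
  by (induction t) auto

lemma tvars_lam [simp]: "tvars (lam v t) = tvars t - {v}"
  by (induction t) auto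

declare lam.simps [simp del]

lemma pred_c_term [simp]:
  "tyof pred_c = Some (N \<Rrightarrow> N)" "only_R0 pred_c" "tvars pred_c = {}"
  by (auto simp: pred_c_def R0_def zero_def)

lemma add_c_term [simp]:
  "tyof add_c = Some (N \<Rrightarrow> N \<Rrightarrow> N)" "only_R0 add_c" "tvars add_c = {}"
  by (auto simp: add_c_def R0_def suc_def)

lemma sub_c_term [simp]:
  "tyof sub_c = Some (N \<Rrightarrow> N \<Rrightarrow> N)" "only_R0 sub_c" "tvars sub_c = {}"
  by (auto simp: sub_c_def R0_def pred_def)

lemma ifz_c_term [simp]:
  "tyof ifz_c = Some (N \<Rrightarrow> N \<Rrightarrow> N \<Rrightarrow> N)" "only_R0 ifz_c" "tvars ifz_c = {}"
  by (auto simp: ifz_c_def R0_def)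

lemma least_c_term [simp]:
  "tyof least_c = Some (N \<Rrightarrow> one \<Rrightarrow> N)" "only_R0 least_c" "tvars least_c = {}"
  by (auto simp: least_c_def R0_def zero_def suc_def ifz_def)

lemma triangle_c_term [simp]:
  "tyof triangle_c = Some (N \<Rrightarrow> N)" "only_R0 triangle_c" "tvars triangle_c = {}"
  by (auto simp: triangle_c_def R0_def zero_def suc_def add_def)

lemma pair_c_term [simp]:
  "tyof pair_c = Some (N \<Rrightarrow> N \<Rrightarrow> N)" "only_R0 pair_c" "tvars pair_c = {}"
  by (auto simp: pair_c_def add_def)

lemma fst_c_term [simp]:
  "tyof fst_c = Some (N \<Rrightarrow> N)" "only_R0 fst_c" "tvars fst_c = {}"
  by (auto simp: fst_c_def least_def suc_def diff_def add_def sub_def pair_def)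

lemma snd_c_term [simp]:
  "tyof snd_c = Some (N \<Rrightarrow> N)" "only_R0 snd_c" "tvars snd_c = {}"
  by (auto simp: snd_c_def least_def suc_def diff_def add_def sub_def pair_def tfst_def)

lemma below_c_term [simp]:
  "tyof below_c = Some (one \<Rrightarrow> one \<Rrightarrow> N \<Rrightarrow> one)" "only_R0 below_c" "tvars below_c = {}"
  by (auto simp: below_c_def ifz_def add_def diff_def sub_def pair_def tsnd_def zero_def
      unit_def suc_def)

lemma drop_c_term [simp]:
  "tyof drop_c = Some (N \<Rrightarrow> N \<Rrightarrow> N)" "only_R0 drop_c" "tvars drop_c = {}"
  by (auto simp: drop_c_def R0_def tsnd_def)

lemma nth_c_term [simp]:
  "tyof nth_c = Some (N \<Rrightarrow> N \<Rrightarrow> N)" "only_R0 nth_c" "tvars nth_c = {}"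
  by (auto simp: nth_c_def tfst_def)

lemma upd_c_term [simp]:
  "tyof upd_c = Some (N \<Rrightarrow> N \<Rrightarrow> N \<Rrightarrow> N)" "only_R0 upd_c" "tvars upd_c = {}"
  by (auto simp: upd_c_def R0_def pair_def suc_def tnth_def sub_def)

lemma exec_c_term [simp]:
  "tyof exec_c = Some (one \<Rrightarrow> N \<Rrightarrow> N \<Rrightarrow> N)" "only_R0 exec_c" "tvars exec_c = {}"
  by (auto simp: exec_c_def Let_def ifz_def diff_def add_def sub_def pair_def suc_def unit_def
      zero_def tnth_def upd_def tfst_def tsnd_def pred_def)

lemma run_c_term [simp]:
  "tyof run_c = Some (one \<Rrightarrow> N \<Rrightarrow> N \<Rrightarrow> N \<Rrightarrow> N)" "only_R0 run_c" "tvars run_c = {}"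
  by (auto simp: run_c_def R0_def pair_def zero_def instr_def tnth_def tfst_def)

lemma tyof_zero_of [simp]: "tyof (zero_of \<sigma>) = Some \<sigma>"
  by (induction \<sigma>) (auto simp: zero_def)

lemma only_R0_zero_of [simp]: "only_R0 (zero_of \<sigma>)"
  by (induction \<sigma>) (auto simp: zero_def)

lemma tvars_zero_of [simp]: "tvars (zero_of \<sigma>) = {}"
  by (induction \<sigma>) (auto simp: zero_def)

lemmas fun_defs = zero_def suc_def unit_def R0_def pred_def add_def sub_def diff_def ifz_def
  least_def pair_def tfst_def tsnd_def below_def tnth_def upd_def instr_def run_def initseg_def

lemmas tsubst_closed_c [simp] =
  pred_c_term(3)[THEN tsubst_closed] add_c_term(3)[THEN tsubst_closed]
  sub_c_term(3)[THEN tsubst_closed] tvars_zero_of[THEN tsubst_closed]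

lemma subst_lt [simp]: "subst \<theta> (lt s t) = lt (tsubst \<theta> s) (tsubst \<theta> t)"
  by (simp add: lt_def le_def fun_defs)

lemma subst_eq [simp]: "subst \<theta> (eq \<sigma> s t) = eq \<sigma> (tsubst \<theta> s) (tsubst \<theta> t)"
proof (induction \<sigma> arbitrary: \<theta> s t)
  case (Arr \<sigma> \<tau>)
  then show ?case by (simp add: tsubst_under_lift) (simp add: under_ext)
next
  case (Star \<sigma>)
  then show ?case by (simp add: tsubst_under_lift) (simp add: under_ext)
qed simp

lemma wff_lt: "pra_term s N \<Longrightarrow> pra_term t N \<Longrightarrow> wff (lt s t)"
  by (simp add: lt_def le_def fun_defs pra_term_def)

lemma wff_eq: "pra_term s \<sigma> \<Longrightarrow> pra_term t \<sigma> \<Longrightarrow> wff (eq \<sigma> s t)"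
proof (induction \<sigma> arbitrary: s t)
  case (Arr \<sigma> \<tau>)
  have "wff (eq \<tau> (lift \<sigma> s \<cdot> V (\<sigma>, 0)) (lift \<sigma> t \<cdot> V (\<sigma>, 0)))"
    using Arr.prems[THEN pra_term_lift, of \<sigma>] by (intro Arr.IH) (simp_all add: pra_term_def)
  then show ?case by simp
next
  case (Star \<sigma>)
  note prems = Star.prems[THEN pra_term_lift, of N]
  have "wff (eq \<sigma> (entry \<sigma> (lift N s) (V (N, 0))) (entry \<sigma> (lift N t) (V (N, 0))))"
    using prems by (intro Star.IH) (simp_all add: pra_term_def)
  moreover have "wff (lt (V (N, 0)) (len \<sigma> (lift N s)))"
    using prems by (intro wff_lt) (simp_all add: pra_term_def)
  ultimately show ?case using Star.prems by (simp add: pra_term_def)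
qed simp


section \<open>Derivations\<close>

lemma tsubst_terms [simp]:
  "tsubst \<theta> zero = zero"
  "tsubst \<theta> (suc t) = suc (tsubst \<theta> t)"
  "tsubst \<theta> (R0 n y z) = R0 (tsubst \<theta> n) (tsubst \<theta> y) (tsubst \<theta> z)"
  by (simp_all add: fun_defs)

lemma E_PRA_subst:
  assumes "wt_subst \<theta>" "\<phi> \<in> E_PRA"
  shows "subst \<theta> \<phi> \<in> E_PRA"
  using assms(2)
proof cases
  case (qf_induction \<psi>)
  \<comment> \<open>The successor substitution of the induction step commutes with
    \<open>under N \<theta>\<close>: the latter fixes number 0 of type \<open>N\<close>, and the
    lifted terms that it puts elsewhere do not contain that variable.\<close>
  have "(\<lambda>v. tsubst (under N \<theta>) (if v = (N, 0) then suc (V v) else V v)) =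
    (\<lambda>v. tsubst (\<lambda>v. if v = (N, 0) then suc (V v) else V v) (under N \<theta> v))"
  proof
    fix v
    show "tsubst (under N \<theta>) (if v = (N, 0) then suc (V v) else V v) =
      tsubst (\<lambda>v. if v = (N, 0) then suc (V v) else V v) (under N \<theta> v)"
    proof (cases "v = (N, 0)")
      case False
      then obtain w where "under N \<theta> v = lift N w"
        using False by (cases v; cases "snd v"; cases "fst v = N") (auto simp: under_ext ext_def)
      moreover have "tsubst (\<lambda>v. if v = (N, 0) then suc (V v) else V v) (lift N w) = lift N w"
        unfolding lift_def tsubst_tsubst by (rule tsubst_cong) (auto simp: shift_def)
      ultimately show ?thesis using False by simp
    qed (simp add: under_ext)
  qed
  then show ?thesis
    using qf_induction assms(1) E_PRA.qf_induction[of "subst (under N \<theta>) \<psi>"]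
    by (simp add: inst_subst wff_subst qf_subst if_distrib del: inst_subst_under cong: if_cong)
next
  case eq_refl
  then show ?thesis using assms(1) by (simp add: E_PRA.eq_refl pra_term_tsubst)
next
  case eq_sym
  then show ?thesis using assms(1) by (simp add: E_PRA.eq_sym pra_term_tsubst)
next
  case eq_trans
  then show ?thesis using assms(1) by (simp add: E_PRA.eq_trans pra_term_tsubst)
next
  case suc_not_zero
  then show ?thesis using assms(1) by (simp add: E_PRA.suc_not_zero pra_term_tsubst)
next
  case suc_inject
  then show ?thesis using assms(1) by (simp add: E_PRA.suc_inject pra_term_tsubst)
next
  case extensionality
  then show ?thesis using assms(1) by (simp add: E_PRA.extensionality pra_term_tsubst)
next
  case Pi
  then show ?thesis using assms(1) by (simp add: E_PRA.Pi pra_term_tsubst)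
next
  case Sigma
  then show ?thesis using assms(1) by (simp add: E_PRA.Sigma pra_term_tsubst)
next
  case R0_zero
  then show ?thesis using assms(1) by (simp add: E_PRA.R0_zero pra_term_tsubst)
next
  case R0_suc
  then show ?thesis using assms(1) by (simp add: E_PRA.R0_suc pra_term_tsubst)
next
  case Len_Tab
  then show ?thesis using assms(1) by (simp add: E_PRA.Len_Tab pra_term_tsubst)
next
  case At_Tab
  then show ?thesis using assms(1) by (simp add: E_PRA.At_Tab pra_term_tsubst)
next
  case At_beyond
  then show ?thesis using assms(1) by (simp add: E_PRA.At_beyond pra_term_tsubst)
qed

text \<open>Renaming a free variable in a derivation is what lets variables play the part of Henkin
  constants below.\<close>

lemma proves_subst:
  assumes "E_PRA \<turnstile> \<phi>" "wt_subst \<theta>"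
  shows "E_PRA \<turnstile> subst \<theta> \<phi>"
  using assms
proof (induction arbitrary: \<theta> rule: proves.induct)
  case (axiom \<phi>)
  then show ?case by (simp add: E_PRA_subst proves.axiom)
next
  case (all_inst \<phi> t \<sigma>)
  then show ?case
    using proves.all_inst[of "subst (under \<sigma> \<theta>) \<phi>" "tsubst \<theta> t" \<sigma> E_PRA]
    by (simp add: inst_subst wff_subst pra_term_tsubst del: inst_subst_under)
next
  case (all_imp \<phi> \<psi> \<sigma>)
  have "(\<lambda>v. tsubst (under \<sigma> \<theta>) (shift \<sigma> v)) = (\<lambda>v. tsubst (shift \<sigma>) (\<theta> v))"
    by (simp add: under_ext lift_def)
  then show ?case
    using all_imp proves.all_imp[of "subst \<theta> \<phi>" "subst (under \<sigma> \<theta>) \<psi>" E_PRA \<sigma>]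
    by (simp add: wff_subst)
next
  case (mp \<phi> \<psi>)
  then show ?case using proves.mp by fastforce
qed (simp_all add: proves.intros wff_subst)

lemma E_PRA_wff: "\<phi> \<in> E_PRA \<Longrightarrow> wff \<phi>"
proof (induction rule: E_PRA.induct)
  case (qf_induction \<phi>)
  then show ?case
    by (auto intro!: wff_inst wff_subst simp: fun_defs pra_term_def wt_subst_def)
qed (auto simp: fun_defs pra_term_def intro!: wff_lt wff_eq)

lemma proves_wff: "E_PRA \<turnstile> \<phi> \<Longrightarrow> wff \<phi>"
proof (induction rule: proves.induct)
  case (all_imp \<phi> \<psi> \<sigma>)
  then show ?case by (simp add: wff_subst)
qed (auto simp: E_PRA_wff wff_inst)

text \<open>Hypotheses are carried as antecedents. Generalization applies to everything derivable,
  so adding an open hypothesis to the axioms would amount to adding its universal closure.\<close>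

definition imps :: "fm list \<Rightarrow> fm \<Rightarrow> fm" where
  "imps \<Gamma> \<phi> = foldr Imp \<Gamma> \<phi>"

lemma imps_simps [simp]:
  "imps [] \<phi> = \<phi>"
  "imps (\<psi> # \<Gamma>) \<phi> = (\<psi> \<^bold>\<longrightarrow> imps \<Gamma> \<phi>)"
  "imps (\<Gamma> @ \<Delta>) \<phi> = imps \<Gamma> (imps \<Delta> \<phi>)"
  by (simp_all add: imps_def)

lemma wff_imps [simp]: "wff (imps \<Gamma> \<phi>) \<longleftrightarrow> (\<forall>\<psi> \<in> set \<Gamma>. wff \<psi>) \<and> wff \<phi>"
  by (induction \<Gamma>) auto

lemma subst_imps [simp]: "subst \<theta> (imps \<Gamma> \<phi>) = imps (map (subst \<theta>) \<Gamma>) (subst \<theta> \<phi>)"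
  by (induction \<Gamma>) auto

lemma proves_imp_refl: "wff \<phi> \<Longrightarrow> A \<turnstile> (\<phi> \<^bold>\<longrightarrow> \<phi>)"
  using imp_s[of \<phi> "\<phi> \<^bold>\<longrightarrow> \<phi>" \<phi>] imp_k[of \<phi> "\<phi> \<^bold>\<longrightarrow> \<phi>"] imp_k[of \<phi> \<phi>]
  by (metis mp wff.simps(3))

lemma imps_weaken: "A \<turnstile> \<phi> \<Longrightarrow> \<forall>\<psi> \<in> set \<Gamma>. wff \<psi> \<Longrightarrow> wff \<phi> \<Longrightarrow> A \<turnstile> imps \<Gamma> \<phi>"
proof (induction \<Gamma>)
  case (Cons \<psi> \<Gamma>)
  then have "A \<turnstile> (imps \<Gamma> \<phi> \<^bold>\<longrightarrow> \<psi> \<^bold>\<longrightarrow> imps \<Gamma> \<phi>)"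
    by (intro imp_k) auto
  then show ?case using Cons by (auto intro: mp)
qed simp

lemma imps_mp_thm:
  assumes "\<forall>\<psi> \<in> set \<Gamma>. wff \<psi>" "wff \<phi>" "wff \<psi>"
  shows "A \<turnstile> (imps \<Gamma> (\<phi> \<^bold>\<longrightarrow> \<psi>) \<^bold>\<longrightarrow> imps \<Gamma> \<phi> \<^bold>\<longrightarrow> imps \<Gamma> \<psi>)"
  using assms(1)
proof (induction \<Gamma>)
  case Nil
  then show ?case using assms by (simp add: proves_imp_refl)
next
  case (Cons \<gamma> \<Gamma>)
  let ?a = "imps \<Gamma> (\<phi> \<^bold>\<longrightarrow> \<psi>)" and ?b = "imps \<Gamma> \<phi>" and ?c = "imps \<Gamma> \<psi>"
  have wf: "wff \<gamma>" "wff ?a" "wff ?b" "wff ?c" using Cons.prems assms by auto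
  have ab: "A \<turnstile> (\<gamma> \<^bold>\<longrightarrow> ?a \<^bold>\<longrightarrow> ?b \<^bold>\<longrightarrow> ?c)"
    using Cons wf by (auto intro: imps_weaken[of A _ "[\<gamma>]", simplified])
  have 1: "A \<turnstile> ((\<gamma> \<^bold>\<longrightarrow> ?a) \<^bold>\<longrightarrow> \<gamma> \<^bold>\<longrightarrow> ?b \<^bold>\<longrightarrow> ?c)"
    using ab wf by (auto intro!: mp[OF imp_s])
  have 2: "A \<turnstile> ((\<gamma> \<^bold>\<longrightarrow> ?a) \<^bold>\<longrightarrow> (\<gamma> \<^bold>\<longrightarrow> ?b \<^bold>\<longrightarrow> ?c) \<^bold>\<longrightarrow> (\<gamma> \<^bold>\<longrightarrow> ?b) \<^bold>\<longrightarrow> \<gamma> \<^bold>\<longrightarrow> ?c)"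
    using wf by (auto intro!: imps_weaken[of A _ "[\<gamma> \<^bold>\<longrightarrow> ?a]", simplified] imp_s)
  from wf have "wff (\<gamma> \<^bold>\<longrightarrow> ?a)" "wff (\<gamma> \<^bold>\<longrightarrow> ?b \<^bold>\<longrightarrow> ?c)" "wff ((\<gamma> \<^bold>\<longrightarrow> ?b) \<^bold>\<longrightarrow> \<gamma> \<^bold>\<longrightarrow> ?c)"
    by simp_all
  from mp[OF mp[OF imp_s[OF this] 2] 1] show ?case by simp
qed

lemma imps_mp:
  assumes "A \<turnstile> imps \<Gamma> (\<phi> \<^bold>\<longrightarrow> \<psi>)" "A \<turnstile> imps \<Gamma> \<phi>"
    and "\<forall>\<psi> \<in> set \<Gamma>. wff \<psi>" "wff \<phi>" "wff \<psi>"
  shows "A \<turnstile> imps \<Gamma> \<psi>"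
  using imps_mp_thm[OF assms(3-5)] assms(1,2) by (blast intro: mp)

lemma imps_mono:
  assumes "A \<turnstile> imps \<Gamma> \<phi>" "\<forall>\<psi> \<in> set (\<Gamma> @ \<Delta>). wff \<psi>" "wff \<phi>"
  shows "A \<turnstile> imps (\<Gamma> @ \<Delta>) \<phi>"
proof -
  have "A \<turnstile> (\<phi> \<^bold>\<longrightarrow> imps \<Delta> \<phi>)"
    using assms(2)
  proof (induction \<Delta>)
    case Nil
    then show ?case using assms by (simp add: proves_imp_refl)
  next
    case (Cons \<delta> \<Delta>)
    have "A \<turnstile> imps [\<phi>] (imps \<Delta> \<phi> \<^bold>\<longrightarrow> \<delta> \<^bold>\<longrightarrow> imps \<Delta> \<phi>)"
      using Cons.prems assms(3) by (intro imps_weaken imp_k) auto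
    then have "A \<turnstile> imps [\<phi>] (\<delta> \<^bold>\<longrightarrow> imps \<Delta> \<phi>)"
      by (rule imps_mp) (use Cons assms(3) in auto)
    then show ?case by simp
  qed
  then have "A \<turnstile> imps \<Gamma> (\<phi> \<^bold>\<longrightarrow> imps \<Delta> \<phi>)"
    using assms by (intro imps_weaken) auto
  then show ?thesis
    using imps_mp[OF _ assms(1)] assms by simp
qed

text \<open>\<open>all_imp\<close> moves the quantifier past one hypothesis at a time;
  \<open>\<Delta>\<close> collects those already passed, which stand outside the quantifier and are
  not shifted.\<close>

lemma imps_all:
  assumes "A \<turnstile> imps \<Delta> (All \<sigma> (imps (map (subst (shift \<sigma>)) \<Gamma>) \<chi>))"
    and "\<forall>\<psi> \<in> set (\<Delta> @ \<Gamma>). wff \<psi>" "wff \<chi>"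
  shows "A \<turnstile> imps (\<Delta> @ \<Gamma>) (All \<sigma> \<chi>)"
  using assms(1,2)
proof (induction \<Gamma> arbitrary: \<Delta>)
  case (Cons \<gamma> \<Gamma>)
  let ?\<chi> = "imps (map (subst (shift \<sigma>)) \<Gamma>) \<chi>"
  have wf: "wff ?\<chi>" using Cons.prems assms(3) by (auto intro: wff_subst)
  have "A \<turnstile> imps \<Delta> (All \<sigma> (subst (shift \<sigma>) \<gamma> \<^bold>\<longrightarrow> ?\<chi>) \<^bold>\<longrightarrow> \<gamma> \<^bold>\<longrightarrow> All \<sigma> ?\<chi>)"
    using Cons.prems wf by (intro imps_weaken all_imp) (auto simp del: wff_imps simp: wff_subst)
  then have "A \<turnstile> imps \<Delta> (\<gamma> \<^bold>\<longrightarrow> All \<sigma> ?\<chi>)"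
    by (rule imps_mp) (use Cons.prems wf in \<open>auto simp del: wff_imps simp: wff_subst\<close>)
  then show ?case using Cons.IH[of "\<Delta> @ [\<gamma>]"] Cons.prems by simp
qed simp

text \<open>A bound for all indices in a formula, those of bound variables included, so that no
  bookkeeping under binders is needed.\<close>

fun tbd :: "tm \<Rightarrow> nat" where
  "tbd (V v) = Suc (snd v)"
| "tbd (C c) = 0"
| "tbd (s \<cdot> t) = max (tbd s) (tbd t)"

fun bd :: "fm \<Rightarrow> nat" where
  "bd (s \<^bold>= t) = max (tbd s) (tbd t)"
| "bd Fls = 0"
| "bd (\<phi> \<^bold>\<longrightarrow> \<psi>) = max (bd \<phi>) (bd \<psi>)"
| "bd (All \<sigma> \<phi>) = bd \<phi>"

lemma tsubst_bd: "(\<And>v. snd v < tbd t \<Longrightarrow> \<theta> v = \<eta> v) \<Longrightarrow> tsubst \<theta> t = tsubst \<eta> t"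
  by (induction t) auto

lemma subst_bd: "(\<And>v. snd v < bd \<phi> \<Longrightarrow> \<theta> v = \<eta> v) \<Longrightarrow> subst \<theta> \<phi> = subst \<eta> \<phi>"
proof (induction \<phi> arbitrary: \<theta> \<eta>)
  case (Eq s t)
  then have "tsubst \<theta> s = tsubst \<eta> s" "tsubst \<theta> t = tsubst \<eta> t"
    by (auto intro!: tsubst_bd)
  then show ?case by simp
next
  case (Imp \<phi> \<psi>)
  have "subst \<theta> \<phi> = subst \<eta> \<phi>" "subst \<theta> \<psi> = subst \<eta> \<psi>"
    using Imp.prems by (auto intro!: Imp.IH)
  then show ?case by simp
next
  case (All \<sigma> \<phi>)
  have "under \<sigma> \<theta> v = under \<sigma> \<eta> v" if "snd v < bd \<phi>" for v
    using All.prems that by (cases v) (auto simp: under_ext ext_def split: nat.splits)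
  then have "subst (under \<sigma> \<theta>) \<phi> = subst (under \<sigma> \<eta>) \<phi>"
    by (rule All.IH)
  then show ?case by simp
qed simp

text \<open>All indices in play are below \<open>K\<close>, so variable number \<open>K\<close> does
  not occur and a renaming may take it to number 0 while shifting the rest. This turns the instance
  back into \<open>\<chi>\<close> and the hypotheses into their shifted forms, as \<open>gen\<close>
  and \<open>imps_all\<close> require.\<close>

lemma imps_gen_fresh:
  assumes "E_PRA \<turnstile> imps \<Gamma> (inst \<sigma> (V (\<sigma>, K)) \<chi>)" "\<And>\<psi>. \<psi> \<in> set (\<chi> # \<Gamma>) \<Longrightarrow> bd \<psi> \<le> K \<and> wff \<psi>"
  shows "E_PRA \<turnstile> imps \<Gamma> (All \<sigma> \<chi>)"
proof -
  define \<theta> where "\<theta> = (\<lambda>v. if v = (\<sigma>, K) then V (\<sigma>, 0) else shift \<sigma> v)"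
  have wt: "wt_subst \<theta>"
    using wt_subst_shift[of \<sigma>] by (simp add: \<theta>_def wt_subst_def)
  have \<Gamma>: "map (subst \<theta>) \<Gamma> = map (subst (shift \<sigma>)) \<Gamma>"
    unfolding map_eq_conv \<theta>_def using assms(2) by (fastforce intro: subst_bd)
  have "subst \<theta> (inst \<sigma> (V (\<sigma>, K)) \<chi>) = subst (ext \<sigma> (V (\<sigma>, 0)) (shift \<sigma>)) \<chi>"
    unfolding inst_ext subst_subst
  proof (rule subst_bd)
    fix v :: var assume "snd v < bd \<chi>"
    moreover have "bd \<chi> \<le> K" using assms(2) by simp
    ultimately show "tsubst \<theta> (ext \<sigma> (V (\<sigma>, K)) V v) = ext \<sigma> (V (\<sigma>, 0)) (shift \<sigma>) v"
      by (cases v) (auto simp: ext_def \<theta>_def split: nat.splits)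
  qed
  then have "E_PRA \<turnstile> imps (map (subst (shift \<sigma>)) \<Gamma>) \<chi>"
    using proves_subst[OF assms(1) wt] by (simp add: \<Gamma> ext_shift)
  then have "E_PRA \<turnstile> imps [] (All \<sigma> (imps (map (subst (shift \<sigma>)) \<Gamma>) \<chi>))"
    by (simp add: gen)
  from imps_all[OF this] show ?thesis
    using assms(2) by fastforce
qed


section \<open>Completeness\<close>

instance ty :: countable by countable_datatype
instance cn :: countable by countable_datatype
instance tm :: countable by countable_datatype
instance fm :: countable by countable_datatype

definition consistent :: "fm list \<Rightarrow> bool" where
  "consistent \<Gamma> \<longleftrightarrow> (\<forall>\<psi> \<in> set \<Gamma>. wff \<psi>) \<and> \<not> E_PRA \<turnstile> imps \<Gamma> Fls"

definition fresh :: "fm list \<Rightarrow> nat" where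
  "fresh \<Gamma> = Max (bd ` set \<Gamma>)"

text \<open>One step decides \<open>\<psi>\<close> and provides witnesses: a rejected universal
  formula receives a false instance. No new constants are necessary, because the list is finite and
  every type has infinitely many variables.\<close>

definition henkin_step :: "fm \<Rightarrow> fm list \<Rightarrow> fm list" where
  "henkin_step \<psi> \<Gamma> = \<Gamma> @
     (if consistent (\<Gamma> @ [\<psi>]) then [\<psi>]
      else if wff \<psi> then (case \<psi> of
        All \<sigma> \<chi> \<Rightarrow> [\<^bold>\<not> inst \<sigma> (V (\<sigma>, fresh (\<psi> # \<Gamma>))) \<chi>]
      | _ \<Rightarrow> [])
      else [])"

lemma bd_fresh: "\<psi> \<in> set \<Gamma> \<Longrightarrow> bd \<psi> \<le> fresh \<Gamma>"
  unfolding fresh_def by simp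

text \<open>If the negated instance were inconsistent, double negation would give the instance, and
  generalizing its fresh variable the universal formula, against the rejection of that
  formula.\<close>

lemma consistent_henkin_step:
  assumes "consistent \<Gamma>"
  shows "consistent (henkin_step \<psi> \<Gamma>)"
proof (cases "\<not> consistent (\<Gamma> @ [\<psi>]) \<and> wff \<psi> \<and> (\<exists>\<sigma> \<chi>. \<psi> = All \<sigma> \<chi>)")
  case True
  then obtain \<sigma> \<chi> where \<psi>: "\<psi> = All \<sigma> \<chi>" by blast
  define K where "K = fresh (\<psi> # \<Gamma>)"
  define \<xi> where "\<xi> = inst \<sigma> (V (\<sigma>, K)) \<chi>"
  have wf: "\<forall>\<psi> \<in> set \<Gamma>. wff \<psi>" "wff \<chi>" using assms True by (auto simp: consistent_def \<psi>)
  then have wf': "wff \<xi>" by (simp add: \<xi>_def wff_inst)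
  have step: "henkin_step \<psi> \<Gamma> = \<Gamma> @ [\<^bold>\<not> \<xi>]"
    using True by (simp add: henkin_step_def \<psi> K_def \<xi>_def)
  show ?thesis
  proof (rule ccontr)
    assume "\<not> consistent (henkin_step \<psi> \<Gamma>)"
    then have "E_PRA \<turnstile> imps \<Gamma> ((\<xi> \<^bold>\<longrightarrow> Fls) \<^bold>\<longrightarrow> Fls)"
      using wf wf' by (auto simp: step consistent_def Neg_def)
    moreover have "E_PRA \<turnstile> imps \<Gamma> (((\<xi> \<^bold>\<longrightarrow> Fls) \<^bold>\<longrightarrow> Fls) \<^bold>\<longrightarrow> \<xi>)"
      using wf wf' by (intro imps_weaken double_neg) auto
    ultimately have "E_PRA \<turnstile> imps \<Gamma> \<xi>"
      using imps_mp wf wf' by (metis wff.simps(2,3))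
    then have "E_PRA \<turnstile> imps \<Gamma> \<psi>"
      unfolding \<xi>_def \<psi>
    proof (rule imps_gen_fresh)
      fix \<psi>' assume "\<psi>' \<in> set (\<chi> # \<Gamma>)"
      then show "bd \<psi>' \<le> K \<and> wff \<psi>'"
        using wf bd_fresh[of \<psi> "\<psi> # \<Gamma>"] bd_fresh[of \<psi>' "\<psi> # \<Gamma>"] by (auto simp: K_def \<psi>)
    qed
    moreover have "E_PRA \<turnstile> imps \<Gamma> (\<psi> \<^bold>\<longrightarrow> Fls)"
      using True wf by (auto simp: consistent_def \<psi>)
    ultimately have "E_PRA \<turnstile> imps \<Gamma> Fls"
      using imps_mp wf True by (metis wff.simps(2))
    then show False using assms by (simp add: consistent_def)
  qed
next
  case False
  then have "henkin_step \<psi> \<Gamma> = \<Gamma> @ [\<psi>] \<and> consistent (\<Gamma> @ [\<psi>]) \<or> henkin_step \<psi> \<Gamma> = \<Gamma>"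
    by (auto simp: henkin_step_def split: fm.splits)
  then show ?thesis using assms by auto
qed

primrec henkin_chain :: "fm list \<Rightarrow> nat \<Rightarrow> fm list" where
  "henkin_chain \<Gamma> 0 = \<Gamma>"
| "henkin_chain \<Gamma> (Suc n) = henkin_step (from_nat n) (henkin_chain \<Gamma> n)"

text \<open>Derivability from a stage instead of membership in one: theorems belong to the set at
  once, and modus ponens only has to pass to the later of two stages.\<close>

definition henkin_set :: "fm list \<Rightarrow> fm \<Rightarrow> bool" where
  "henkin_set \<Gamma> \<phi> \<longleftrightarrow> wff \<phi> \<and> (\<exists>n. E_PRA \<turnstile> imps (henkin_chain \<Gamma> n) \<phi>)"

lemma consistent_henkin_chain: "consistent \<Gamma> \<Longrightarrow> consistent (henkin_chain \<Gamma> n)"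
  by (induction n) (simp_all add: consistent_henkin_step)

lemma henkin_chain_mono: "m \<le> n \<Longrightarrow> \<exists>\<Delta>. henkin_chain \<Gamma> n = henkin_chain \<Gamma> m @ \<Delta>"
proof (induction n rule: dec_induct)
  case (step n)
  then show ?case by (auto simp: henkin_step_def)
qed simp

text \<open>This is all that the term model needs from a maximal consistent theory with witnesses.
  Quantifiers range over open terms too, since the witnesses are variables.\<close>

locale truth =
  fixes T :: "fm \<Rightarrow> bool"
  assumes T_proves: "E_PRA \<turnstile> \<phi> \<Longrightarrow> T \<phi>"
    and T_Fls [simp]: "\<not> T Fls"
    and T_Imp [simp]: "wff \<phi> \<Longrightarrow> wff \<psi> \<Longrightarrow> T (\<phi> \<^bold>\<longrightarrow> \<psi>) \<longleftrightarrow> (T \<phi> \<longrightarrow> T \<psi>)"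
    and T_All: "wff \<phi> \<Longrightarrow> T (All \<sigma> \<phi>) \<longleftrightarrow> (\<forall>t. pra_term t \<sigma> \<longrightarrow> T (inst \<sigma> t \<phi>))"

lemma truth_henkin_set:
  assumes "consistent \<Gamma>"
  shows "truth (henkin_set \<Gamma>)"
proof -
  let ?T = "henkin_set \<Gamma>" and ?c = "henkin_chain \<Gamma>"
  note con = consistent_henkin_chain[OF assms]
  have wf: "\<forall>\<psi> \<in> set (?c n). wff \<psi>" for n using con by (simp add: consistent_def)
  have mono: "E_PRA \<turnstile> imps (?c n) \<phi>" if "m \<le> n" "E_PRA \<turnstile> imps (?c m) \<phi>" "wff \<phi>" for m n \<phi>
    using henkin_chain_mono[OF that(1), of \<Gamma>] imps_mono that(2,3) wf[of n] by metis
  have prv: "?T \<phi>" if "E_PRA \<turnstile> \<phi>" for \<phi>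
    using imps_weaken[OF that wf[of 0] proves_wff[OF that]] proves_wff[OF that]
    unfolding henkin_set_def by blast
  have fls: "\<not> ?T Fls"
    using con by (simp add: henkin_set_def consistent_def)
  have mp: "?T \<psi>" if imp: "?T (\<phi> \<^bold>\<longrightarrow> \<psi>)" "?T \<phi>" for \<phi> \<psi>
  proof -
    obtain m n where "E_PRA \<turnstile> imps (?c m) (\<phi> \<^bold>\<longrightarrow> \<psi>)" "E_PRA \<turnstile> imps (?c n) \<phi>"
      using imp unfolding henkin_set_def by blast
    then have "E_PRA \<turnstile> imps (?c (max m n)) (\<phi> \<^bold>\<longrightarrow> \<psi>)" "E_PRA \<turnstile> imps (?c (max m n)) \<phi>"
      using mono[of m "max m n"] mono[of n "max m n"] that by (simp_all add: henkin_set_def)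
    then show ?thesis using that imps_mp wf by (fastforce simp: henkin_set_def)
  qed
  have stage: "?c (Suc (to_nat \<psi>)) = henkin_step \<psi> (?c (to_nat \<psi>))" for \<psi> by simp
  have hyp: "?T \<psi>" if mem: "\<psi> \<in> set (?c n)" for \<psi> n
  proof -
    obtain \<Delta> \<Delta>' where split: "?c n = (\<Delta> @ [\<psi>]) @ \<Delta>'"
      using split_list[OF mem] by auto
    have "E_PRA \<turnstile> imps (\<Delta> @ [\<psi>]) \<psi>"
      using imps_weaken[of E_PRA "\<psi> \<^bold>\<longrightarrow> \<psi>" \<Delta>] proves_imp_refl[of \<psi>] wf[of n] that
      by (simp add: split)
    then have "E_PRA \<turnstile> imps (?c n) \<psi>"
      unfolding split by (rule imps_mono) (use wf[of n] that in \<open>auto simp: split\<close>)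
    then show ?thesis using wf that by (auto simp: henkin_set_def)
  qed
  have incons: "?T (\<psi> \<^bold>\<longrightarrow> Fls)" if "wff \<psi>" "\<not> consistent (?c n @ [\<psi>])" for \<psi> n
    using that wf[of n] by (auto simp: henkin_set_def consistent_def)
  have compl: "?T \<psi> \<or> ?T (\<psi> \<^bold>\<longrightarrow> Fls)" if "wff \<psi>" for \<psi>
  proof (cases "consistent (?c (to_nat \<psi>) @ [\<psi>])")
    case True
    then have "\<psi> \<in> set (?c (Suc (to_nat \<psi>)))"
      unfolding stage by (simp add: henkin_step_def)
    then show ?thesis using hyp by blast
  next
    case False
    then show ?thesis using incons that by blast
  qed
  have exfalso: "?T \<psi>" if "?T \<phi>" "?T (\<phi> \<^bold>\<longrightarrow> Fls)" for \<phi> \<psi>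
    using mp that fls by blast
  have imp: "?T (\<phi> \<^bold>\<longrightarrow> \<psi>) \<longleftrightarrow> (?T \<phi> \<longrightarrow> ?T \<psi>)" if w: "wff \<phi>" "wff \<psi>" for \<phi> \<psi>
  proof
    assume r: "?T \<phi> \<longrightarrow> ?T \<psi>"
    show "?T (\<phi> \<^bold>\<longrightarrow> \<psi>)"
    proof (cases "?T \<psi>")
      case True
      then show ?thesis using prv[OF imp_k[OF w(2,1)]] mp by blast
    next
      case False
      then have n: "?T (\<phi> \<^bold>\<longrightarrow> Fls)" using r compl w by blast
      \<comment> \<open>Ex falso: \<open>imp_k\<close> takes \<open>Fls\<close> to the double
        negation of \<open>\<psi>\<close>.\<close>
      have "E_PRA \<turnstile> imps [Fls] \<psi>"
      proof (rule imps_mp)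
        show "E_PRA \<turnstile> imps [Fls] (((\<psi> \<^bold>\<longrightarrow> Fls) \<^bold>\<longrightarrow> Fls) \<^bold>\<longrightarrow> \<psi>)"
          using w by (intro imps_weaken double_neg) auto
        show "E_PRA \<turnstile> imps [Fls] ((\<psi> \<^bold>\<longrightarrow> Fls) \<^bold>\<longrightarrow> Fls)"
          using w imp_k[of Fls "\<psi> \<^bold>\<longrightarrow> Fls"] by simp
      qed (use w in auto)
      then have "E_PRA \<turnstile> imps [\<phi>] (Fls \<^bold>\<longrightarrow> \<psi>)"
        using w by (intro imps_weaken) auto
      then show ?thesis
        using prv imp_s[of \<phi> Fls \<psi> E_PRA] n mp w by (metis imps_simps(1,2) wff.simps(2))
    qed
  qed (use mp in blast)
  have all: "?T (All \<sigma> \<phi>) \<longleftrightarrow> (\<forall>t. pra_term t \<sigma> \<longrightarrow> ?T (inst \<sigma> t \<phi>))" if w: "wff \<phi>" for \<sigma> \<phi>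
  proof
    assume r: "\<forall>t. pra_term t \<sigma> \<longrightarrow> ?T (inst \<sigma> t \<phi>)"
    let ?\<psi> = "All \<sigma> \<phi>"
    show "?T ?\<psi>"
    proof (cases "consistent (?c (to_nat ?\<psi>) @ [?\<psi>])")
      case True
      then have "?\<psi> \<in> set (?c (Suc (to_nat ?\<psi>)))"
        unfolding stage by (simp add: henkin_step_def)
      then show ?thesis using hyp by blast
    next
      case False
      \<comment> \<open>The number that \<open>henkin_step\<close> chose at the stage where
        \<open>?\<psi>\<close> was rejected.\<close>
      define k where "k = fresh (?\<psi> # ?c (to_nat ?\<psi>))"
      have "(\<^bold>\<not> inst \<sigma> (V (\<sigma>, k)) \<phi>) \<in> set (?c (Suc (to_nat ?\<psi>)))"
        unfolding stage using False w by (simp add: henkin_step_def k_def)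
      then have "?T (inst \<sigma> (V (\<sigma>, k)) \<phi> \<^bold>\<longrightarrow> Fls)"
        using hyp unfolding Neg_def by blast
      moreover have "?T (inst \<sigma> (V (\<sigma>, k)) \<phi>)" using r by simp
      ultimately show ?thesis using exfalso by blast
    qed
  next
    assume "?T (All \<sigma> \<phi>)"
    then show "\<forall>t. pra_term t \<sigma> \<longrightarrow> ?T (inst \<sigma> t \<phi>)"
      using prv[OF all_inst[OF w]] mp by blast
  qed
  show ?thesis
    by unfold_locales (use prv fls imp all in auto)
qed

lemma truth_refuting:
  assumes "wff \<phi>" "\<not> E_PRA \<turnstile> \<phi>"
  obtains T where "truth T" "\<not> T \<phi>"
proof -
  have "consistent [\<phi> \<^bold>\<longrightarrow> Fls]"
    using assms double_neg[of \<phi> E_PRA] by (auto simp: consistent_def intro: mp)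
  then interpret truth "henkin_set [\<phi> \<^bold>\<longrightarrow> Fls]" by (rule truth_henkin_set)
  have "henkin_set [\<phi> \<^bold>\<longrightarrow> Fls] (\<phi> \<^bold>\<longrightarrow> Fls)"
    unfolding henkin_set_def
    using assms proves_imp_refl[of "\<phi> \<^bold>\<longrightarrow> Fls"] by (auto intro!: exI[of _ 0])
  then have "\<not> henkin_set [\<phi> \<^bold>\<longrightarrow> Fls] \<phi>"
    using assms by simp
  then show thesis using that truth_axioms by blast
qed


section \<open>Models\<close>

locale interp =
  fixes D :: "ty \<Rightarrow> 'a set"
    and ap :: "'a \<Rightarrow> 'a \<Rightarrow> 'a" (infixl "\<bullet>" 90)
    and cv :: "cn \<Rightarrow> 'a"
begin

fun ev :: "(var \<Rightarrow> 'a) \<Rightarrow> tm \<Rightarrow> 'a" where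
  "ev \<rho> (V v) = \<rho> v"
| "ev \<rho> (C c) = cv c"
| "ev \<rho> (s \<cdot> t) = ev \<rho> s \<bullet> ev \<rho> t"

fun sat :: "(var \<Rightarrow> 'a) \<Rightarrow> fm \<Rightarrow> bool" where
  "sat \<rho> (s \<^bold>= t) \<longleftrightarrow> ev \<rho> s = ev \<rho> t"
| "sat \<rho> Fls \<longleftrightarrow> False"
| "sat \<rho> (\<phi> \<^bold>\<longrightarrow> \<psi>) \<longleftrightarrow> (sat \<rho> \<phi> \<longrightarrow> sat \<rho> \<psi>)"
| "sat \<rho> (All \<sigma> \<phi>) \<longleftrightarrow> (\<forall>x \<in> D \<sigma>. sat (ext \<sigma> x \<rho>) \<phi>)"

definition wt :: "(var \<Rightarrow> 'a) \<Rightarrow> bool" where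
  "wt \<rho> \<longleftrightarrow> (\<forall>v. \<rho> v \<in> D (fst v))"

end

text \<open>\<open>sat_eq\<close> makes extensionally equal objects identical, so equations in a
  model are rewritten as equations of HOL. \<open>cv_D\<close> speaks of the constants of the
  language only: E-PRA has no axioms for recursors of higher type.\<close>

locale epra_model = interp +
  assumes ap_D: "f \<in> D (\<sigma> \<Rrightarrow> \<tau>) \<Longrightarrow> x \<in> D \<sigma> \<Longrightarrow> f \<bullet> x \<in> D \<tau>"
    and cv_D: "only_R0 (C c) \<Longrightarrow> cv c \<in> D (cn_ty c)"
    and sat_eq: "pra_term s \<sigma> \<Longrightarrow> pra_term t \<sigma> \<Longrightarrow> wt \<rho> \<Longrightarrow>
      sat \<rho> (eq \<sigma> s t) \<longleftrightarrow> ev \<rho> s = ev \<rho> t"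
    and sat_axiom: "\<phi> \<in> E_PRA \<Longrightarrow> wt \<rho> \<Longrightarrow> sat \<rho> \<phi>"

lemma pra_App: "pra_term s (\<sigma> \<Rrightarrow> \<tau>) \<Longrightarrow> pra_term t \<sigma> \<Longrightarrow> pra_term (s \<cdot> t) \<tau>"
  by (simp add: pra_term_def)

lemma pra_AppE:
  assumes "pra_term (s \<cdot> t) \<tau>"
  obtains \<sigma> where "pra_term s (\<sigma> \<Rrightarrow> \<tau>)" "pra_term t \<sigma>"
  using assms by (auto simp: pra_term_def split: option.splits ty.splits if_splits)

declare eq.simps(2,3) [simp del]

section \<open>The term model of a truth valuation\<close>

context truth
begin

lemma T_Conj: "wff \<phi> \<Longrightarrow> wff \<psi> \<Longrightarrow> T (\<phi> \<^bold>\<and> \<psi>) \<longleftrightarrow> T \<phi> \<and> T \<psi>"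
  by (simp add: Conj_def Neg_def)

lemma T_axiom: "\<phi> \<in> E_PRA \<Longrightarrow> T \<phi>"
  by (simp add: T_proves proves.axiom)

lemma T_cong:
  assumes "pra_term z (\<sigma> \<Rrightarrow> \<tau>)" "pra_term x \<sigma>" "pra_term y \<sigma>" "T (eq \<sigma> x y)"
  shows "T (eq \<tau> (z \<cdot> x) (z \<cdot> y))"
  using T_axiom[OF extensionality[OF assms(1-3)]] assms
  by (simp add: wff_eq pra_App[of z \<sigma> \<tau>])

lemma T_eq_Arr:
  assumes "pra_term s (\<sigma> \<Rrightarrow> \<tau>)" "pra_term t (\<sigma> \<Rrightarrow> \<tau>)"
  shows "T (eq (\<sigma> \<Rrightarrow> \<tau>) s t) \<longleftrightarrow> (\<forall>u. pra_term u \<sigma> \<longrightarrow> T (eq \<tau> (s \<cdot> u) (t \<cdot> u)))"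
proof -
  have "wff (eq (\<sigma> \<Rrightarrow> \<tau>) s t)" using assms by (rule wff_eq)
  then show ?thesis by (simp add: T_All inst_ext eq.simps(2))
qed

lemma T_eq_Star:
  assumes "pra_term s (Star \<sigma>)" "pra_term t (Star \<sigma>)"
  shows "T (eq (Star \<sigma>) s t) \<longleftrightarrow> T (len \<sigma> s \<^bold>= len \<sigma> t) \<and>
    (\<forall>u. pra_term u N \<longrightarrow> T (lt u (len \<sigma> s)) \<longrightarrow> T (eq \<sigma> (entry \<sigma> s u) (entry \<sigma> t u)))"
proof -
  have "wff (eq (Star \<sigma>) s t)" using assms by (rule wff_eq)
  moreover have "wff (lt u (len \<sigma> s))" "wff (eq \<sigma> (entry \<sigma> s u) (entry \<sigma> t u))"
    if "pra_term u N" for u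
    using assms that by (auto intro!: wff_lt wff_eq simp: pra_term_def)
  ultimately show ?thesis by (simp add: T_All T_Conj inst_ext eq.simps(3))
qed

lemma T_eq_refl: "pra_term t \<sigma> \<Longrightarrow> T (eq \<sigma> t t)"
proof (induction \<sigma> arbitrary: t)
  case (Arr \<sigma> \<tau>)
  then show ?case by (auto simp: T_eq_Arr intro: pra_App)
next
  case (Star \<sigma>)
  then have "pra_term (len \<sigma> t) N" "pra_term u N \<Longrightarrow> pra_term (entry \<sigma> t u) \<sigma>" for u
    by (simp_all add: pra_term_def)
  then show ?case using Star T_axiom[OF eq_refl] by (simp add: T_eq_Star)
qed (simp add: T_axiom eq_refl)

lemma T_N_sym: "pra_term s N \<Longrightarrow> pra_term t N \<Longrightarrow> T (s \<^bold>= t) \<Longrightarrow> T (t \<^bold>= s)"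
  using T_axiom[OF eq_sym[of s t]] by simp

lemma T_N_trans:
  "pra_term s N \<Longrightarrow> pra_term t N \<Longrightarrow> pra_term u N \<Longrightarrow> T (s \<^bold>= t) \<Longrightarrow> T (t \<^bold>= u) \<Longrightarrow> T (s \<^bold>= u)"
  using T_axiom[OF eq_trans[of s t u]] by simp

text \<open>Equality of sequences bounds the index by the length of the left sequence; symmetry and
  transitivity have to move this bound to an equal length. Congruence for the function
  \<open>?z\<close>, which sends a length to its truncated distance from \<open>suc u\<close>, does
  so.\<close>

lemma T_lt_cong:
  assumes "pra_term u N" "pra_term x N" "pra_term y N" "T (x \<^bold>= y)" "T (lt u y)"
  shows "T (lt u x)"
proof -
  let ?z = "sub_c \<cdot> suc u"
  have z: "pra_term ?z (N \<Rrightarrow> N)" "pra_term zero N"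
    using assms(1) by (simp_all add: pra_term_def fun_defs)
  then have "T (?z \<cdot> x \<^bold>= ?z \<cdot> y)"
    using T_cong[of ?z N N x y] assms by simp
  moreover have "T (?z \<cdot> y \<^bold>= zero)"
    using assms(5) by (simp add: lt_def le_def sub_def)
  ultimately show ?thesis
    using T_N_trans[of "?z \<cdot> x" "?z \<cdot> y" zero] z assms(2,3)
    by (simp add: lt_def le_def sub_def pra_App[of _ N])
qed

lemma T_eq_sym_trans:
  "pra_term s \<sigma> \<Longrightarrow> pra_term t \<sigma> \<Longrightarrow> T (eq \<sigma> s t) \<Longrightarrow> T (eq \<sigma> t s) \<and>
    (\<forall>u. pra_term u \<sigma> \<longrightarrow> T (eq \<sigma> t u) \<longrightarrow> T (eq \<sigma> s u))"
proof (induction \<sigma> arbitrary: s t)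
  case (Arr \<sigma> \<tau>)
  have IH: "T (eq \<tau> (t \<cdot> x) (s \<cdot> x)) \<and>
    (\<forall>u. pra_term u \<tau> \<longrightarrow> T (eq \<tau> (t \<cdot> x) u) \<longrightarrow> T (eq \<tau> (s \<cdot> x) u))" if "pra_term x \<sigma>" for x
    using Arr.prems that by (intro Arr.IH(2)) (auto simp: T_eq_Arr intro: pra_App)
  then show ?case using Arr.prems by (auto simp: T_eq_Arr intro: pra_App)
next
  case (Star \<sigma>)
  have len: "pra_term (len \<sigma> r) N" if "pra_term r (Star \<sigma>)" for r
    using that by (simp add: pra_term_def)
  have entry: "pra_term (entry \<sigma> r x) \<sigma>" if "pra_term r (Star \<sigma>)" "pra_term x N" for r x
    using that by (simp add: pra_term_def)
  have eqs: "T (len \<sigma> s \<^bold>= len \<sigma> t)"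
    "\<And>x. pra_term x N \<Longrightarrow> T (lt x (len \<sigma> s)) \<Longrightarrow> T (eq \<sigma> (entry \<sigma> s x) (entry \<sigma> t x))"
    using Star.prems by (simp_all add: T_eq_Star)
  have len': "T (len \<sigma> t \<^bold>= len \<sigma> s)"
    by (rule T_N_sym[OF len[OF Star.prems(1)] len[OF Star.prems(2)] eqs(1)])
  have lts: "T (lt x (len \<sigma> t)) \<longleftrightarrow> T (lt x (len \<sigma> s))" if "pra_term x N" for x
    using T_lt_cong[OF that len[OF Star.prems(1)] len[OF Star.prems(2)] eqs(1)]
      T_lt_cong[OF that len[OF Star.prems(2)] len[OF Star.prems(1)] len'] by argo
  have IH: "T (eq \<sigma> (entry \<sigma> t x) (entry \<sigma> s x)) \<and>
    (\<forall>u. pra_term u \<sigma> \<longrightarrow> T (eq \<sigma> (entry \<sigma> t x) u) \<longrightarrow> T (eq \<sigma> (entry \<sigma> s x) u))"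
    if "pra_term x N" "T (lt x (len \<sigma> s))" for x
    by (rule Star.IH[OF entry[OF Star.prems(1) that(1)] entry[OF Star.prems(2) that(1)] eqs(2)[OF that]])
  have "T (eq (Star \<sigma>) t s)"
    using Star.prems len' IH lts by (simp add: T_eq_Star)
  moreover have "T (eq (Star \<sigma>) s u)" if u: "pra_term u (Star \<sigma>)" and tu: "T (eq (Star \<sigma>) t u)" for u
  proof -
    have "T (len \<sigma> t \<^bold>= len \<sigma> u)"
      "\<And>x. pra_term x N \<Longrightarrow> T (lt x (len \<sigma> t)) \<Longrightarrow> T (eq \<sigma> (entry \<sigma> t x) (entry \<sigma> u x))"
      using Star.prems u tu by (simp_all add: T_eq_Star)
    then show ?thesis
      using Star.prems u IH lts entry[OF u] T_N_trans[OF len len len eqs(1)] by (simp add: T_eq_Star)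
  qed
  ultimately show ?case by blast
next
  case N
  then show ?case using T_N_sym[of s t] T_N_trans[of s t] by auto
qed

lemma T_eq_sym: "pra_term s \<sigma> \<Longrightarrow> pra_term t \<sigma> \<Longrightarrow> T (eq \<sigma> s t) \<Longrightarrow> T (eq \<sigma> t s)"
  and T_eq_trans: "pra_term s \<sigma> \<Longrightarrow> pra_term t \<sigma> \<Longrightarrow> pra_term u \<sigma> \<Longrightarrow>
    T (eq \<sigma> s t) \<Longrightarrow> T (eq \<sigma> t u) \<Longrightarrow> T (eq \<sigma> s u)"
  using T_eq_sym_trans[of s \<sigma> t] by simp_all

text \<open>Canonical representatives turn provable equality into identity of objects of the model.\<close>

definition rep :: "tm \<Rightarrow> tm" where
  "rep t = (SOME s. pra_term s (the (tyof t)) \<and> T (eq (the (tyof t)) s t))"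

lemma rep:
  assumes "pra_term t \<sigma>"
  shows "pra_term (rep t) \<sigma>" "T (eq \<sigma> (rep t) t)"
proof -
  have "tyof t = Some \<sigma>" using assms by (simp add: pra_term_def)
  then have "pra_term (rep t) \<sigma> \<and> T (eq \<sigma> (rep t) t)"
    unfolding rep_def
    using someI[of "\<lambda>s. pra_term s \<sigma> \<and> T (eq \<sigma> s t)" t] T_eq_refl[OF assms] assms by simp
  then show "pra_term (rep t) \<sigma>" "T (eq \<sigma> (rep t) t)" by auto
qed

lemma rep_eq_iff:
  assumes "pra_term s \<sigma>" "pra_term t \<sigma>"
  shows "rep s = rep t \<longleftrightarrow> T (eq \<sigma> s t)"
proof
  assume eq: "rep s = rep t"
  have "T (eq \<sigma> s (rep t))"
    using T_eq_sym[OF rep(1)[OF assms(1)] assms(1) rep(2)[OF assms(1)]] eq by simp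
  then show "T (eq \<sigma> s t)"
    using T_eq_trans[OF assms(1) rep(1)[OF assms(2)] assms(2) _ rep(2)[OF assms(2)]] by blast
next
  assume st: "T (eq \<sigma> s t)"
  have "T (eq \<sigma> u s) \<longleftrightarrow> T (eq \<sigma> u t)" if "pra_term u \<sigma>" for u
    using T_eq_trans[OF that assms(1,2) _ st]
      T_eq_trans[OF that assms(2,1) _ T_eq_sym[OF assms st]] by blast
  then have "(\<lambda>u. pra_term u \<sigma> \<and> T (eq \<sigma> u s)) = (\<lambda>u. pra_term u \<sigma> \<and> T (eq \<sigma> u t))"
    by blast
  moreover have "tyof s = Some \<sigma>" "tyof t = Some \<sigma>" using assms by (auto simp: pra_term_def)
  ultimately show "rep s = rep t"
    by (simp add: rep_def)
qed

definition tD :: "ty \<Rightarrow> tm set" where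
  "tD \<sigma> = rep ` {t. pra_term t \<sigma>}"

definition tap :: "tm \<Rightarrow> tm \<Rightarrow> tm" where
  "tap f x = rep (f \<cdot> x)"

definition tcv :: "cn \<Rightarrow> tm" where
  "tcv c = rep (C c)"

text \<open>The extensionality axiom replaces the argument, the definition of equality at arrow
  types replaces the function.\<close>

lemma tap_rep:
  assumes "pra_term s (\<sigma> \<Rrightarrow> \<tau>)" "pra_term t \<sigma>"
  shows "tap (rep s) (rep t) = rep (s \<cdot> t)"
proof -
  note rs = rep[OF assms(1)] and rt = rep[OF assms(2)]
  have "T (eq \<tau> (rep s \<cdot> rep t) (rep s \<cdot> t))"
    by (rule T_cong[OF rs(1) rt(1) assms(2) rt(2)])
  moreover have "T (eq \<tau> (rep s \<cdot> t) (s \<cdot> t))"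
    using T_eq_Arr[OF rs(1) assms(1)] rs(2) assms(2) by simp
  ultimately have "T (eq \<tau> (rep s \<cdot> rep t) (s \<cdot> t))"
    by (rule T_eq_trans[OF pra_App[OF rs(1) rt(1)] pra_App[OF rs(1) assms(2)] pra_App[OF assms]])
  then show ?thesis
    unfolding tap_def rep_eq_iff[OF pra_App[OF rs(1) rt(1)] pra_App[OF assms]] .
qed

interpretation I: interp tD tap tcv .

lemma ev_rep: "pra_term t \<tau> \<Longrightarrow> wt_subst \<rho> \<Longrightarrow> I.ev (\<lambda>v. rep (\<rho> v)) t = rep (tsubst \<rho> t)"
proof (induction t arbitrary: \<tau>)
  case (App s t)
  obtain \<sigma> where st: "pra_term s (\<sigma> \<Rrightarrow> \<tau>)" "pra_term t \<sigma>"
    using App.prems pra_AppE by blast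
  then show ?case
    using App.IH(1)[OF st(1)] App.IH(2)[OF st(2)] App.prems
      tap_rep[OF pra_term_tsubst[OF _ st(1)] pra_term_tsubst[OF _ st(2)]] by simp
qed (simp_all add: tcv_def)

text \<open>Environments of the term model are representatives of substitutions, so the quantifier
  case is \<open>T_All\<close> with the substitution \<open>ext \<sigma> t \<rho>\<close>.\<close>

lemma sat_rep: "wff \<phi> \<Longrightarrow> wt_subst \<rho> \<Longrightarrow> I.sat (\<lambda>v. rep (\<rho> v)) \<phi> \<longleftrightarrow> T (subst \<rho> \<phi>)"
proof (induction \<phi> arbitrary: \<rho>)
  case (Eq s t)
  then show ?case
    using rep_eq_iff[of "tsubst \<rho> s" N "tsubst \<rho> t"]
    by (simp add: ev_rep[of _ N] pra_term_tsubst)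
next
  case (Imp \<phi> \<psi>)
  then show ?case by (simp add: wff_subst)
next
  case (All \<sigma> \<phi>)
  have "ext \<sigma> (rep t) (\<lambda>v. rep (\<rho> v)) = (\<lambda>v. rep (ext \<sigma> t \<rho> v))" for t
    by (auto simp: ext_def fun_eq_iff split: nat.splits)
  moreover have "(\<forall>x \<in> tD \<sigma>. P x) \<longleftrightarrow> (\<forall>t. pra_term t \<sigma> \<longrightarrow> P (rep t))" for P
    by (auto simp: tD_def)
  ultimately show ?case
    using All by (simp add: T_All wff_subst)
qed simp

lemma wt_rep:
  assumes "I.wt \<rho>"
  obtains \<rho>' where "\<rho> = (\<lambda>v. rep (\<rho>' v))" "wt_subst \<rho>'"
proof -
  have "\<forall>v. \<exists>t. \<rho> v = rep t \<and> pra_term t (fst v)"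
    using assms by (auto simp: I.wt_def tD_def)
  then obtain \<rho>' where "\<forall>v. \<rho> v = rep (\<rho>' v) \<and> pra_term (\<rho>' v) (fst v)"
    by metis
  then have "\<rho> = (\<lambda>v. rep (\<rho>' v))" "wt_subst \<rho>'"
    by (auto simp: wt_subst_def)
  then show thesis by (rule that)
qed

text \<open>Axioms hold in every environment because an environment comes from a substitution and
  the set of axioms is closed under substitution.\<close>

lemma epra_model: "epra_model tD tap tcv"
proof
  fix f x \<sigma> \<tau>
  assume "f \<in> tD (\<sigma> \<Rrightarrow> \<tau>)" "x \<in> tD \<sigma>"
  then obtain s t where "f = rep s" "pra_term s (\<sigma> \<Rrightarrow> \<tau>)" "x = rep t" "pra_term t \<sigma>"
    by (auto simp: tD_def)
  then show "tap f x \<in> tD \<tau>"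
    by (auto simp: tD_def tap_rep intro: pra_App)
next
  fix c assume "only_R0 (C c)"
  then show "tcv c \<in> tD (cn_ty c)"
    by (auto simp: tD_def tcv_def pra_term_def)
next
  fix s \<sigma> t \<rho>
  assume st: "pra_term s \<sigma>" "pra_term t \<sigma>" and "I.wt \<rho>"
  then obtain \<rho>' where "\<rho> = (\<lambda>v. rep (\<rho>' v))" "wt_subst \<rho>'" by (auto elim: wt_rep)
  then show "I.sat \<rho> (eq \<sigma> s t) \<longleftrightarrow> I.ev \<rho> s = I.ev \<rho> t"
    using st by (simp add: sat_rep ev_rep[of _ \<sigma>] wff_eq rep_eq_iff[of _ \<sigma>] pra_term_tsubst)
next
  fix \<phi> \<rho>
  assume ax: "\<phi> \<in> E_PRA" and "I.wt \<rho>"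
  then obtain \<rho>' where "\<rho> = (\<lambda>v. rep (\<rho>' v))" "wt_subst \<rho>'" by (auto elim: wt_rep)
  then show "I.sat \<rho> \<phi>"
    using ax by (simp add: sat_rep E_PRA_wff T_axiom E_PRA_subst)
qed

lemma wt_rep_V: "I.wt (\<lambda>v. rep (V v))"
  by (auto simp: I.wt_def tD_def)

end

text \<open>The countermodel consists of terms, so models on the one carrier type \<open>tm\<close>
  suffice.\<close>

theorem completeness:
  assumes "wff \<phi>"
    and "\<And>(D :: ty \<Rightarrow> tm set) ap cv \<rho>.
      epra_model D ap cv \<Longrightarrow> interp.wt D \<rho> \<Longrightarrow> interp.sat D ap cv \<rho> \<phi>"
  shows "E_PRA \<turnstile> \<phi>"
proof (rule ccontr)
  assume "\<not> E_PRA \<turnstile> \<phi>"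
  then obtain T where "truth T" "\<not> T \<phi>"
    using assms(1) truth_refuting by blast
  interpret truth T by fact
  show False
    using assms(2)[OF epra_model wt_rep_V] sat_rep[OF assms(1), of V] \<open>\<not> T \<phi>\<close> by simp
qed

section \<open>Semantics of the derived notation\<close>

context interp
begin

lemma sat_connectives [simp]:
  "sat \<rho> (\<^bold>\<not> \<phi>) \<longleftrightarrow> \<not> sat \<rho> \<phi>"
  "sat \<rho> (\<phi> \<^bold>\<and> \<psi>) \<longleftrightarrow> sat \<rho> \<phi> \<and> sat \<rho> \<psi>"
  "sat \<rho> (\<phi> \<^bold>\<or> \<psi>) \<longleftrightarrow> sat \<rho> \<phi> \<or> sat \<rho> \<psi>"
  "sat \<rho> (\<phi> \<^bold>\<longleftrightarrow> \<psi>) \<longleftrightarrow> (sat \<rho> \<phi> \<longleftrightarrow> sat \<rho> \<psi>)"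
  "sat \<rho> (Ex \<sigma> \<phi>) \<longleftrightarrow> (\<exists>x \<in> D \<sigma>. sat (ext \<sigma> x \<rho>) \<phi>)"
  by (auto simp: Neg_def Conj_def Disj_def Iff_def Ex_def)

lemma ev_tsubst: "ev \<rho> (tsubst \<theta> t) = ev (\<lambda>v. ev \<rho> (\<theta> v)) t"
  by (induction t) auto

lemma ev_ext_shift: "ev (ext \<sigma> x \<rho>) (shift \<sigma> v) = \<rho> v"
  by (cases v) (auto simp: shift_def)

lemma ev_lift [simp]: "ev (ext \<sigma> x \<rho>) (lift \<sigma> t) = ev \<rho> t"
  by (simp add: lift_def ev_tsubst ev_ext_shift)

lemma sat_subst: "sat \<rho> (subst \<theta> \<phi>) \<longleftrightarrow> sat (\<lambda>v. ev \<rho> (\<theta> v)) \<phi>"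
proof (induction \<phi> arbitrary: \<rho> \<theta>)
  case (All \<sigma> \<phi>)
  have "(\<lambda>v. ev (ext \<sigma> x \<rho>) (under \<sigma> \<theta> v)) = ext \<sigma> x (\<lambda>v. ev \<rho> (\<theta> v))" for x
  proof
    fix v
    show "ev (ext \<sigma> x \<rho>) (under \<sigma> \<theta> v) = ext \<sigma> x (\<lambda>v. ev \<rho> (\<theta> v)) v"
      by (cases v; cases "snd v"; cases "fst v = \<sigma>") (auto simp: under_ext)
  qed
  then show ?case using All by simp
qed (simp_all add: ev_tsubst)

text \<open>Semantically the renumbering disappears: quantification over a named variable is an
  ordinary function update, and formulas written with names are evaluated without shifting
  indices.\<close>

lemma sat_bind: "sat (ext (fst v) x \<rho>) (bind v \<phi>) \<longleftrightarrow> sat (\<rho>(v := x)) \<phi>"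
proof -
  have "(\<lambda>w. ev (ext (fst v) x \<rho>) (if w = v then V (fst v, 0) else shift (fst v) w)) = \<rho>(v := x)"
    by (auto simp: ev_ext_shift)
  then show ?thesis by (simp add: bind_def sat_subst)
qed

lemma sat_quantifiers [simp]:
  "sat \<rho> (\<^bold>\<forall>v. \<phi>) \<longleftrightarrow> (\<forall>x \<in> D (fst v). sat (\<rho>(v := x)) \<phi>)"
  "sat \<rho> (\<^bold>\<exists>v. \<phi>) \<longleftrightarrow> (\<exists>x \<in> D (fst v). sat (\<rho>(v := x)) \<phi>)"
  by (simp_all add: all_v_def ex_v_def sat_bind)

lemma wt_D: "wt \<rho> \<Longrightarrow> \<rho> v \<in> D (fst v)"
  unfolding wt_def by blast

lemma ev_cong: "(\<And>v. v \<in> tvars t \<Longrightarrow> \<rho> v = \<rho>' v) \<Longrightarrow> ev \<rho> t = ev \<rho>' t"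
  by (induction t) auto

lemma wt_upd [simp]: "wt \<rho> \<Longrightarrow> x \<in> D (fst v) \<Longrightarrow> wt (\<rho>(v := x))"
  by (cases v) (auto simp: wt_def)

lemma wt_ext [simp]: "wt \<rho> \<Longrightarrow> x \<in> D \<sigma> \<Longrightarrow> wt (ext \<sigma> x \<rho>)"
  by (auto simp: wt_def ext_def split: nat.splits)

end

section \<open>Combinators, abstraction and induction in a model\<close>

context epra_model
begin

lemma ev_D: "pra_term t \<tau> \<Longrightarrow> wt \<rho> \<Longrightarrow> ev \<rho> t \<in> D \<tau>"
proof (induction t arbitrary: \<tau>)
  case (V v)
  then show ?case using wt_D[of \<rho> v] by simp
next
  case (C c)
  then show ?case using cv_D[of c] by (simp add: pra_term_def)
next
  case (App s t)
  then show ?case by (auto elim!: pra_AppE intro: ap_D)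
qed

text \<open>A well-typed default environment. Closed terms are evaluated in it, which gives their
  values one normal form.\<close>

definition env0 :: "var \<Rightarrow> 'a" where
  "env0 v = ev (\<lambda>_. undefined) (zero_of (fst v))"

lemma zero_of_D: "ev \<rho> (zero_of \<sigma>) \<in> D \<sigma>"
proof (induction \<sigma>)
  case N
  show ?case using cv_D[of Zero] by (simp add: zero_def)
next
  case (Arr \<sigma> \<tau>)
  have "cv (Pi \<tau> \<sigma>) \<in> D (\<tau> \<Rrightarrow> \<sigma> \<Rrightarrow> \<tau>)"
    using cv_D[of "Pi \<tau> \<sigma>"] by simp
  from ap_D[OF this Arr(2)] show ?case by simp
next
  case (Star \<sigma>)
  have "cv Zero \<in> D N" "cv (Tab \<sigma>) \<in> D (N \<Rrightarrow> (N \<Rrightarrow> \<sigma>) \<Rrightarrow> Star \<sigma>)"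
    "cv (Pi \<sigma> N) \<in> D (\<sigma> \<Rrightarrow> N \<Rrightarrow> \<sigma>)"
    using cv_D[of Zero] cv_D[of "Tab \<sigma>"] cv_D[of "Pi \<sigma> N"] by simp_all
  from ap_D[OF ap_D[OF this(2,1)] ap_D[OF this(3) Star]] show ?case by (simp add: zero_def)
qed

lemma wt_env0 [simp]: "wt env0"
  by (simp add: wt_def env0_def zero_of_D)

lemma ev_closed: "tvars t = {} \<Longrightarrow> ev \<rho> t = ev env0 t"
  by (rule ev_cong) simp

text \<open>Lets the simplifier see that binding a variable of type \<open>\<sigma>\<close> leaves
  the variables of type \<open>\<sigma> \<Rrightarrow> \<tau>\<close> untouched.\<close>

lemma ty_neq_Arr [simp]: "\<sigma> \<noteq> \<sigma> \<Rrightarrow> \<tau>"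
  by (induction \<sigma> arbitrary: \<tau>) auto

lemma extensional:
  assumes "f \<in> D (\<sigma> \<Rrightarrow> \<tau>)" "g \<in> D (\<sigma> \<Rrightarrow> \<tau>)" "\<And>x. x \<in> D \<sigma> \<Longrightarrow> f \<bullet> x = g \<bullet> x"
  shows "f = g"
proof -
  let ?f = "(\<sigma> \<Rrightarrow> \<tau>, 0) :: var" and ?g = "(\<sigma> \<Rrightarrow> \<tau>, 1) :: var"
  let ?\<rho> = "env0(?f := f, ?g := g)"
  have "sat ?\<rho> (eq (\<sigma> \<Rrightarrow> \<tau>) (V ?f) (V ?g))"
  proof -
    have "sat (ext \<sigma> x ?\<rho>) (eq \<tau> (lift \<sigma> (V ?f) \<cdot> V (\<sigma>, 0)) (lift \<sigma> (V ?g) \<cdot> V (\<sigma>, 0)))"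
      if "x \<in> D \<sigma>" for x
    proof -
      have "pra_term (lift \<sigma> (V ?f) \<cdot> V (\<sigma>, 0)) \<tau>" "pra_term (lift \<sigma> (V ?g) \<cdot> V (\<sigma>, 0)) \<tau>"
        by (rule pra_App[of _ \<sigma>]; simp add: pra_term_lift)+
      then show ?thesis
        using assms that by (simp add: sat_eq)
    qed
    then show ?thesis by (simp add: eq.simps(2))
  qed
  then show ?thesis using assms by (simp add: sat_eq)
qed

lemma Pi_ap: "x \<in> D \<sigma> \<Longrightarrow> y \<in> D \<tau> \<Longrightarrow> cv (Pi \<sigma> \<tau>) \<bullet> x \<bullet> y = x"
proof -
  assume xy: "x \<in> D \<sigma>" "y \<in> D \<tau>"
  \<comment> \<open>The numbers differ because \<open>\<sigma>\<close> and \<open>\<tau>\<close> may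
    be the same type.\<close>
  let ?x = "(\<sigma>, 0) :: var" and ?y = "(\<tau>, 1) :: var"
  let ?\<rho> = "env0(?x := x, ?y := y)"
  have "wt ?\<rho>" using xy by simp
  moreover have "pra_term (C (Pi \<sigma> \<tau>) \<cdot> V ?x \<cdot> V ?y) \<sigma>"
    by (simp add: pra_term_def)
  ultimately show ?thesis
    using sat_axiom[OF Pi[of "V ?x" \<sigma> "V ?y" \<tau>], of ?\<rho>] by (simp add: sat_eq)
qed

lemma Sigma_ap:
  assumes "x \<in> D (\<rho> \<Rrightarrow> \<sigma> \<Rrightarrow> \<tau>)" "y \<in> D (\<rho> \<Rrightarrow> \<sigma>)" "z \<in> D \<rho>"
  shows "cv (Sigma \<rho> \<sigma> \<tau>) \<bullet> x \<bullet> y \<bullet> z = x \<bullet> z \<bullet> (y \<bullet> z)"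
proof -
  let ?x = "(\<rho> \<Rrightarrow> \<sigma> \<Rrightarrow> \<tau>, 0) :: var" and ?y = "(\<rho> \<Rrightarrow> \<sigma>, 1) :: var" and ?z = "(\<rho>, 2) :: var"
  let ?\<rho> = "env0(?x := x, ?y := y, ?z := z)"
  have "wt ?\<rho>" using assms by simp
  moreover have "pra_term (C (Sigma \<rho> \<sigma> \<tau>) \<cdot> V ?x \<cdot> V ?y \<cdot> V ?z) \<tau>"
    "pra_term (V ?x \<cdot> V ?z \<cdot> (V ?y \<cdot> V ?z)) \<tau>"
    by (simp_all add: pra_term_def)
  ultimately show ?thesis
    using sat_axiom[OF Sigma[of "V ?x" \<rho> \<sigma> \<tau> "V ?y" "V ?z"], of ?\<rho>] by (simp add: sat_eq)
qed

text \<open>Beta conversion. Typing is essential here, since \<open>lam\<close> reads the types of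
  its combinators off the subterms.\<close>

lemma ev_lam:
  assumes "pra_term t \<tau>" "wt \<rho>" "x \<in> D (fst v)"
  shows "ev \<rho> (lam v t) \<bullet> x = ev (\<rho>(v := x)) t"
  using assms(1)
proof (induction t arbitrary: \<tau>)
  case (V w)
  let ?\<sigma> = "fst v"
  show ?case
  proof (cases "v = w")
    case True
    have "cv (Pi ?\<sigma> (?\<sigma> \<Rrightarrow> ?\<sigma>)) \<in> D (?\<sigma> \<Rrightarrow> (?\<sigma> \<Rrightarrow> ?\<sigma>) \<Rrightarrow> ?\<sigma>)" "cv (Pi ?\<sigma> ?\<sigma>) \<in> D (?\<sigma> \<Rrightarrow> ?\<sigma> \<Rrightarrow> ?\<sigma>)"
      using cv_D[of "Pi ?\<sigma> (?\<sigma> \<Rrightarrow> ?\<sigma>)"] cv_D[of "Pi ?\<sigma> ?\<sigma>"] by simp_all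
    then show ?thesis
      using True assms(3) ap_D by (simp add: lam.simps Sigma_ap Pi_ap)
  next
    case False
    have "\<rho> w \<in> D (fst w)" using assms(2) by (rule wt_D)
    then show ?thesis using False assms(3) by (simp add: lam.simps Pi_ap)
  qed
next
  case (C c)
  then show ?case using cv_D[of c] assms(3) by (simp add: lam.simps Pi_ap pra_term_def)
next
  case (App s t)
  obtain \<sigma> where st: "pra_term s (\<sigma> \<Rrightarrow> \<tau>)" "pra_term t \<sigma>"
    using App.prems pra_AppE by blast
  have ty: "tyof (s \<cdot> t) = Some \<tau>" "tyof t = Some \<sigma>" using App.prems st by (auto simp: pra_term_def)
  show ?case
  proof (cases "v \<in> tvars (s \<cdot> t)")
    case True
    have "pra_term (lam v s) (fst v \<Rrightarrow> \<sigma> \<Rrightarrow> \<tau>)" "pra_term (lam v t) (fst v \<Rrightarrow> \<sigma>)"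
      using st by (auto simp: pra_term_def)
    then have "ev \<rho> (lam v s) \<in> D (fst v \<Rrightarrow> \<sigma> \<Rrightarrow> \<tau>)" "ev \<rho> (lam v t) \<in> D (fst v \<Rrightarrow> \<sigma>)"
      using assms(2) ev_D by blast+
    then show ?thesis
      using True ty App.IH(1)[OF st(1)] App.IH(2)[OF st(2)] assms(3)
      by (simp add: lam.simps Sigma_ap del: tyof.simps)
  next
    case False
    then have "ev (\<rho>(v := x)) (s \<cdot> t) = ev \<rho> (s \<cdot> t)" by (intro ev_cong) auto
    moreover have "ev \<rho> (s \<cdot> t) \<in> D \<tau>" using App.prems assms(2) ev_D by blast
    moreover have "ev \<rho> (lam v (s \<cdot> t)) = cv (Pi \<tau> (fst v)) \<bullet> ev \<rho> (s \<cdot> t)"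
      using False ty(1) by (simp add: lam.simps del: tyof.simps)
    ultimately show ?thesis
      using Pi_ap assms(3) by metis
  qed
qed

text \<open>Induction for an HOL predicate \<open>P\<close> that a quantifier-free formula
  expresses; the parameters of the formula sit in \<open>\<rho>\<close>. In a nonstandard model
  there is no induction for arbitrary predicates.\<close>

lemma qf_induct:
  assumes "wff \<phi>" "qf \<phi>" "wt \<rho>" "\<And>n. n \<in> D N \<Longrightarrow> P n \<longleftrightarrow> sat (\<rho>((N, 0) := n)) \<phi>"
    and "P (cv Zero)" "\<And>n. n \<in> D N \<Longrightarrow> P n \<Longrightarrow> P (cv Succ \<bullet> n)"
    and n: "n \<in> D N"
  shows "P n"
proof -
  \<comment> \<open>The axiom binds number 0 and moves the other numeric variables up. Reading
    \<open>\<rho>\<close> one place higher compensates for this.\<close>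
  define \<rho>' where "\<rho>' = (\<lambda>v. \<rho> (if fst v = N then (N, Suc (snd v)) else v))"
  have wt: "wt \<rho>'" using assms(3) by (simp add: wt_def \<rho>'_def)
  have ext: "ext N x \<rho>' = \<rho>((N, 0) := x)" for x
    by (auto simp: ext_def \<rho>'_def fun_eq_iff split: nat.splits)
  have step: "(\<lambda>v. ev (\<rho>((N, 0) := x)) (if v = (N, 0) then suc (V v) else V v)) =
    \<rho>((N, 0) := cv Succ \<bullet> x)" for x
    by (auto simp: suc_def)
  have base: "(\<lambda>v. ev \<rho>' (ext N zero V v)) = \<rho>((N, 0) := cv Zero)"
    by (auto simp: ext_def \<rho>'_def zero_def fun_eq_iff split: nat.splits)
  have D: "cv Zero \<in> D N" "\<And>n. n \<in> D N \<Longrightarrow> cv Succ \<bullet> n \<in> D N"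
    using cv_D[of Zero] cv_D[of Succ] ap_D by auto
  have ind: "sat (\<rho>((N, 0) := cv Zero)) \<phi> \<Longrightarrow>
    \<forall>x \<in> D N. sat (\<rho>((N, 0) := x)) \<phi> \<longrightarrow> sat (\<rho>((N, 0) := cv Succ \<bullet> x)) \<phi> \<Longrightarrow>
    \<forall>x \<in> D N. sat (\<rho>((N, 0) := x)) \<phi>"
    using sat_axiom[OF qf_induction[OF assms(1,2)] wt]
    by (simp add: inst_ext sat_subst ext step base)
  have "sat (\<rho>((N, 0) := cv Zero)) \<phi>"
    using assms(4)[OF D(1)] assms(5) by blast
  moreover have "\<forall>x \<in> D N. sat (\<rho>((N, 0) := x)) \<phi> \<longrightarrow> sat (\<rho>((N, 0) := cv Succ \<bullet> x)) \<phi>"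
    using assms(4,6) D(2) by blast
  ultimately show ?thesis
    using ind assms(4)[OF n] n by blast
qed

end


section \<open>Arithmetic in a model\<close>

lemma tyof_funs [simp]:
  "tyof zero = Some N"
  "tyof unit = Some N"
  "tyof s = Some N \<Longrightarrow> tyof (suc s) = Some N"
  "tyof s = Some N \<Longrightarrow> tyof (pred s) = Some N"
  "tyof s = Some N \<Longrightarrow> tyof (tfst s) = Some N"
  "tyof s = Some N \<Longrightarrow> tyof (tsnd s) = Some N"
  "tyof s = Some N \<Longrightarrow> tyof t = Some N \<Longrightarrow> tyof (add s t) = Some N"
  "tyof s = Some N \<Longrightarrow> tyof t = Some N \<Longrightarrow> tyof (sub s t) = Some N"
  "tyof s = Some N \<Longrightarrow> tyof t = Some N \<Longrightarrow> tyof (diff s t) = Some N"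
  "tyof s = Some N \<Longrightarrow> tyof t = Some N \<Longrightarrow> tyof (pair s t) = Some N"
  "tyof s = Some N \<Longrightarrow> tyof t = Some N \<Longrightarrow> tyof (instr s t) = Some N"
  "tyof c = Some N \<Longrightarrow> tyof s = Some N \<Longrightarrow> tyof t = Some N \<Longrightarrow> tyof (ifz c s t) = Some N"
  "tyof s = Some N \<Longrightarrow> tyof h = Some one \<Longrightarrow> tyof (least s h) = Some N"
  "tyof n = Some N \<Longrightarrow> tyof y = Some N \<Longrightarrow> tyof z = Some (N \<Rrightarrow> N \<Rrightarrow> N) \<Longrightarrow>
    tyof (R0 n y z) = Some N"
  "tyof X = Some one \<Longrightarrow> tyof Y = Some one \<Longrightarrow> tyof s = Some N \<Longrightarrow> tyof (below X Y s) = Some one"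
  "tyof X = Some one \<Longrightarrow> tyof s = Some N \<Longrightarrow> tyof t = Some N \<Longrightarrow> tyof u = Some N \<Longrightarrow>
    tyof (run X s t u) = Some N"
  by (simp_all add: fun_defs)

lemma only_R0_funs [simp]:
  "only_R0 zero"
  "only_R0 unit"
  "only_R0 (suc s) = only_R0 s"
  "only_R0 (pred s) = only_R0 s"
  "only_R0 (tfst s) = only_R0 s"
  "only_R0 (tsnd s) = only_R0 s"
  "only_R0 (add s t) \<longleftrightarrow> only_R0 s \<and> only_R0 t"
  "only_R0 (sub s t) \<longleftrightarrow> only_R0 s \<and> only_R0 t"
  "only_R0 (diff s t) \<longleftrightarrow> only_R0 s \<and> only_R0 t"
  "only_R0 (pair s t) \<longleftrightarrow> only_R0 s \<and> only_R0 t"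
  "only_R0 (instr s t) \<longleftrightarrow> only_R0 s \<and> only_R0 t"
  "only_R0 (ifz c s t) \<longleftrightarrow> only_R0 c \<and> only_R0 s \<and> only_R0 t"
  "only_R0 (least s h) \<longleftrightarrow> only_R0 s \<and> only_R0 h"
  "only_R0 (R0 n y z) \<longleftrightarrow> only_R0 n \<and> only_R0 y \<and> only_R0 z"
  "only_R0 (below X Y s) \<longleftrightarrow> only_R0 X \<and> only_R0 Y \<and> only_R0 s"
  "only_R0 (run X s t u) \<longleftrightarrow> only_R0 X \<and> only_R0 s \<and> only_R0 t \<and> only_R0 u"
  by (auto simp: fun_defs)

lemma tvars_funs [simp]:
  "tvars zero = {}"
  "tvars unit = {}"
  "tvars (suc s) = tvars s"
  "tvars (pred s) = tvars s"
  "tvars (tfst s) = tvars s"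
  "tvars (tsnd s) = tvars s"
  "tvars (add s t) = tvars s \<union> tvars t"
  "tvars (sub s t) = tvars s \<union> tvars t"
  "tvars (least s h) = tvars s \<union> tvars h"
  "tvars (diff s t) = tvars s \<union> tvars t"
  "tvars (pair s t) = tvars s \<union> tvars t"
  "tvars (instr s t) = tvars s \<union> tvars t"
  "tvars (ifz c s t) = tvars c \<union> tvars s \<union> tvars t"
  "tvars (R0 n y z) = tvars n \<union> tvars y \<union> tvars z"
  "tvars (below X Y s) = tvars X \<union> tvars Y \<union> tvars s"
  "tvars (run X s t u) = tvars X \<union> tvars s \<union> tvars t \<union> tvars u"
  by (auto simp: fun_defs)

lemma qf_connectives [simp]:
  "qf (\<^bold>\<not> \<phi>) \<longleftrightarrow> qf \<phi>"
  "qf (\<phi> \<^bold>\<and> \<psi>) \<longleftrightarrow> qf \<phi> \<and> qf \<psi>"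
  "qf (\<phi> \<^bold>\<or> \<psi>) \<longleftrightarrow> qf \<phi> \<and> qf \<psi>"
  by (auto simp: Neg_def Conj_def Disj_def)

context epra_model
begin

lemma ev_lam_ap [simp]:
  "tyof t \<noteq> None \<Longrightarrow> only_R0 t \<Longrightarrow> wt \<rho> \<Longrightarrow> x \<in> D (fst v) \<Longrightarrow>
    ev \<rho> (lam v t) \<bullet> x = ev (\<rho>(v := x)) t"
  using ev_lam[of t _ \<rho> x v] by (auto simp: pra_term_def)

lemma ev_lam_D [simp]:
  "tyof t = Some \<tau> \<Longrightarrow> fst v = \<sigma> \<Longrightarrow> only_R0 t \<Longrightarrow> wt \<rho> \<Longrightarrow> ev \<rho> (lam v t) \<in> D (\<sigma> \<Rrightarrow> \<tau>)"
  by (rule ev_D) (auto simp: pra_term_def)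

lemma ev_upd [simp]:
  assumes "v \<notin> tvars t"
  shows "ev (\<rho>(v := x)) t = ev \<rho> t"
    and "ev (\<rho>(v := x, w := y)) t = ev (\<rho>(w := y)) t"
    and "ev (\<rho>(v := x, w := y, w' := y')) t = ev (\<rho>(w := y, w' := y')) t"
  using assms by (auto intro!: ev_cong)

lemma closed_D: "tyof t = Some \<tau> \<Longrightarrow> only_R0 t \<Longrightarrow> ev env0 t \<in> D \<tau>"
  by (rule ev_D) (auto simp: pra_term_def)

text \<open>The argument type does not occur in the conclusion of \<open>ap_D\<close>, so the
  simplifier needs one instance for each type in use.\<close>

lemmas ap_D_simps [simp] = ap_D[of _ N N] ap_D[of _ N one] ap_D[of _ one N] ap_D[of _ two N]
  ap_D[of _ two "Star one"]

abbreviation Z :: 'a where "Z \<equiv> cv Zero"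
abbreviation S :: "'a \<Rightarrow> 'a" where "S n \<equiv> cv Succ \<bullet> n"

definition rc :: "'a \<Rightarrow> 'a \<Rightarrow> 'a \<Rightarrow> 'a" where "rc n y z = cv (Rec N) \<bullet> n \<bullet> y \<bullet> z"
definition pd :: "'a \<Rightarrow> 'a" where "pd a = ev env0 pred_c \<bullet> a"
definition pl :: "'a \<Rightarrow> 'a \<Rightarrow> 'a" where "pl a b = ev env0 add_c \<bullet> a \<bullet> b"
definition sb :: "'a \<Rightarrow> 'a \<Rightarrow> 'a" where "sb a b = ev env0 sub_c \<bullet> a \<bullet> b"
definition df :: "'a \<Rightarrow> 'a \<Rightarrow> 'a" where "df a b = pl (sb a b) (sb b a)"
definition iz :: "'a \<Rightarrow> 'a \<Rightarrow> 'a \<Rightarrow> 'a" where "iz a b c = ev env0 ifz_c \<bullet> a \<bullet> b \<bullet> c"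
definition ls :: "'a \<Rightarrow> 'a \<Rightarrow> 'a" where "ls n h = ev env0 least_c \<bullet> n \<bullet> h"
definition tr :: "'a \<Rightarrow> 'a" where "tr a = ev env0 triangle_c \<bullet> a"
definition pr :: "'a \<Rightarrow> 'a \<Rightarrow> 'a" where "pr a b = ev env0 pair_c \<bullet> a \<bullet> b"
definition fs :: "'a \<Rightarrow> 'a" where "fs a = ev env0 fst_c \<bullet> a"
definition sn :: "'a \<Rightarrow> 'a" where "sn a = ev env0 snd_c \<bullet> a"

lemma ev_funs [simp]:
  "ev \<rho> zero = Z"
  "ev \<rho> (suc s) = S (ev \<rho> s)"
  "ev \<rho> unit = S Z"
  "ev \<rho> (R0 n y z) = rc (ev \<rho> n) (ev \<rho> y) (ev \<rho> z)"
  "ev \<rho> (pred s) = pd (ev \<rho> s)"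
  "ev \<rho> (add s t) = pl (ev \<rho> s) (ev \<rho> t)"
  "ev \<rho> (sub s t) = sb (ev \<rho> s) (ev \<rho> t)"
  "ev \<rho> (diff s t) = df (ev \<rho> s) (ev \<rho> t)"
  "ev \<rho> (ifz c s t) = iz (ev \<rho> c) (ev \<rho> s) (ev \<rho> t)"
  "ev \<rho> (least s h) = ls (ev \<rho> s) (ev \<rho> h)"
  "ev \<rho> (pair s t) = pr (ev \<rho> s) (ev \<rho> t)"
  "ev \<rho> (tfst s) = fs (ev \<rho> s)"
  "ev \<rho> (tsnd s) = sn (ev \<rho> s)"
  by (simp_all add: fun_defs rc_def pd_def pl_def sb_def df_def iz_def ls_def pr_def fs_def sn_def
      ev_closed[of pred_c \<rho>] ev_closed[of add_c \<rho>] ev_closed[of sub_c \<rho>] ev_closed[of ifz_c \<rho>]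
      ev_closed[of least_c \<rho>] ev_closed[of pair_c \<rho>] ev_closed[of fst_c \<rho>] ev_closed[of snd_c \<rho>])

lemma Z_D [simp]: "Z \<in> D N" and S_D [simp]: "n \<in> D N \<Longrightarrow> S n \<in> D N"
  using cv_D[of Zero] cv_D[of Succ] by simp_all

lemma rc_D [simp]: "n \<in> D N \<Longrightarrow> y \<in> D N \<Longrightarrow> z \<in> D (N \<Rrightarrow> N \<Rrightarrow> N) \<Longrightarrow> rc n y z \<in> D N"
  using ap_D[OF ap_D[OF ap_D[of "cv (Rec N)"]]] cv_D[of "Rec N"] by (simp add: rc_def)

lemma fun_D [simp]:
  "a \<in> D N \<Longrightarrow> pd a \<in> D N"
  "a \<in> D N \<Longrightarrow> b \<in> D N \<Longrightarrow> pl a b \<in> D N"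
  "a \<in> D N \<Longrightarrow> b \<in> D N \<Longrightarrow> sb a b \<in> D N"
  "a \<in> D N \<Longrightarrow> b \<in> D N \<Longrightarrow> df a b \<in> D N"
  "a \<in> D N \<Longrightarrow> b \<in> D N \<Longrightarrow> c \<in> D N \<Longrightarrow> iz a b c \<in> D N"
  "a \<in> D N \<Longrightarrow> h \<in> D one \<Longrightarrow> ls a h \<in> D N"
  "a \<in> D N \<Longrightarrow> tr a \<in> D N"
  "a \<in> D N \<Longrightarrow> b \<in> D N \<Longrightarrow> pr a b \<in> D N"
  "a \<in> D N \<Longrightarrow> fs a \<in> D N"
  "a \<in> D N \<Longrightarrow> sn a \<in> D N"
  using closed_D[of pred_c] closed_D[of add_c] closed_D[of sub_c] closed_D[of ifz_c]
    closed_D[of least_c] closed_D[of triangle_c] closed_D[of pair_c] closed_D[of fst_c]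
    closed_D[of snd_c]
  by (auto simp: pd_def pl_def sb_def df_def iz_def ls_def tr_def pr_def fs_def sn_def intro: ap_D)

lemma S_neq_Z [simp]: "n \<in> D N \<Longrightarrow> S n \<noteq> Z" "n \<in> D N \<Longrightarrow> Z \<noteq> S n"
  using sat_axiom[OF suc_not_zero[of "V (N, 0)"], of "env0((N, 0) := n)"] by (auto dest: sym)

lemma S_inject [simp]: "m \<in> D N \<Longrightarrow> n \<in> D N \<Longrightarrow> S m = S n \<longleftrightarrow> m = n"
  using sat_axiom[OF suc_inject[of "V (N, 0)" "V (N, 1)"], of "env0((N, 0) := m, (N, 1) := n)"]
  by auto

lemma rc_simps [simp]:
  assumes "y \<in> D N" "z \<in> D (N \<Rrightarrow> N \<Rrightarrow> N)"
  shows "rc Z y z = y" "n \<in> D N \<Longrightarrow> rc (S n) y z = z \<bullet> rc n y z \<bullet> n"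
  using sat_axiom[OF R0_zero[of "V (N, 1)" "V (N \<Rrightarrow> N \<Rrightarrow> N, 0)"],
      of "env0((N, 1) := y, (N \<Rrightarrow> N \<Rrightarrow> N, 0) := z)"]
    sat_axiom[OF R0_suc[of "V (N, 0)" "V (N, 1)" "V (N \<Rrightarrow> N \<Rrightarrow> N, 0)"],
      of "env0((N, 0) := n, (N, 1) := y, (N \<Rrightarrow> N \<Rrightarrow> N, 0) := z)"] assms
  by auto

lemma pd_simps [simp]: "pd Z = Z" "n \<in> D N \<Longrightarrow> pd (S n) = n"
  by (simp_all add: pd_def pred_c_def)

lemma pl_simps [simp]:
  "a \<in> D N \<Longrightarrow> pl a Z = a" "a \<in> D N \<Longrightarrow> b \<in> D N \<Longrightarrow> pl a (S b) = S (pl a b)"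
  by (simp_all add: pl_def add_c_def)

lemma sb_simps [simp]:
  "a \<in> D N \<Longrightarrow> sb a Z = a" "a \<in> D N \<Longrightarrow> b \<in> D N \<Longrightarrow> sb a (S b) = pd (sb a b)"
  by (simp_all add: sb_def sub_c_def)

lemma iz_simps [simp]:
  "a \<in> D N \<Longrightarrow> b \<in> D N \<Longrightarrow> iz Z a b = a"
  "a \<in> D N \<Longrightarrow> b \<in> D N \<Longrightarrow> n \<in> D N \<Longrightarrow> iz (S n) a b = b"
  by (simp_all add: iz_def ifz_c_def)

lemma ls_simps [simp]:
  assumes "h \<in> D one"
  shows "ls Z h = Z" "n \<in> D N \<Longrightarrow> ls (S n) h = iz (h \<bullet> ls n h) (ls n h) (S n)"
  using assms by (simp_all add: ls_def least_c_def)

lemma tr_simps [simp]: "tr Z = Z" "n \<in> D N \<Longrightarrow> tr (S n) = pl (tr n) (S n)"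
  by (simp_all add: tr_def triangle_c_def)

lemma pr_eq: "a \<in> D N \<Longrightarrow> b \<in> D N \<Longrightarrow> pr a b = pl (tr (pl a b)) a"
  by (simp add: pr_def pair_c_def) (simp add: tr_def)

lemma fs_eq:
  "z \<in> D N \<Longrightarrow> fs z = ls (S z) (ev (env0((N, 2) := z)) (\<^bold>\<lambda>v_a. diff (V v_c)
     (pair (V v_a) (least (suc (V v_c)) (\<^bold>\<lambda>v_b. diff (V v_c) (pair (V v_a) (V v_b)))))))"
  by (simp add: fs_def fst_c_def)

lemma sn_eq:
  "z \<in> D N \<Longrightarrow> sn z = ls (S z) (ev (env0((N, 2) := z)) (\<^bold>\<lambda>v_b. diff (V v_c) (pair (tfst (V v_c)) (V v_b))))"
  by (simp add: sn_def snd_c_def)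

section \<open>Addition, truncated subtraction and order\<close>

lemma pl_Z_left [simp]: "n \<in> D N \<Longrightarrow> pl Z n = n"
  by (rule qf_induct[where \<phi> = "add zero (V (N, 0)) \<^bold>= V (N, 0)" and \<rho> = env0])
    (simp_all add: pra_term_def)

lemma pl_S_left [simp]: "n \<in> D N \<Longrightarrow> m \<in> D N \<Longrightarrow> pl (S m) n = S (pl m n)"
  by (rule qf_induct[where P = "\<lambda>n. pl (S m) n = S (pl m n)" and \<rho> = "env0((N, 1) := m)" and
        \<phi> = "add (suc (V (N, 1))) (V (N, 0)) \<^bold>= suc (add (V (N, 1)) (V (N, 0)))"])
    (simp_all add: pra_term_def)

lemma pl_commute: "n \<in> D N \<Longrightarrow> m \<in> D N \<Longrightarrow> pl m n = pl n m"
  by (rule qf_induct[where P = "\<lambda>n. pl m n = pl n m" and \<rho> = "env0((N, 1) := m)" and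
        \<phi> = "add (V (N, 1)) (V (N, 0)) \<^bold>= add (V (N, 0)) (V (N, 1))"])
    (simp_all add: pra_term_def)

lemma pl_assoc: "n \<in> D N \<Longrightarrow> a \<in> D N \<Longrightarrow> b \<in> D N \<Longrightarrow> pl (pl a b) n = pl a (pl b n)"
  by (rule qf_induct[where P = "\<lambda>n. pl (pl a b) n = pl a (pl b n)" and
        \<rho> = "env0((N, 1) := a, (N, 2) := b)" and
        \<phi> = "add (add (V (N, 1)) (V (N, 2))) (V (N, 0)) \<^bold>=
          add (V (N, 1)) (add (V (N, 2)) (V (N, 0)))"])
    (simp_all add: pra_term_def)

lemma pl_left_commute: "n \<in> D N \<Longrightarrow> a \<in> D N \<Longrightarrow> b \<in> D N \<Longrightarrow> pl a (pl b n) = pl b (pl a n)"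
  by (metis pl_assoc pl_commute)

lemmas pl_ac = pl_assoc pl_commute pl_left_commute

lemma pl_cancel_right [simp]:
  assumes "n \<in> D N" "a \<in> D N" "b \<in> D N"
  shows "pl a n = pl b n \<longleftrightarrow> a = b"
  using assms
  by (rule_tac qf_induct[where P = "\<lambda>n. pl a n = pl b n \<longleftrightarrow> a = b" and
        \<rho> = "env0((N, 1) := a, (N, 2) := b)" and
        \<phi> = "(add (V (N, 1)) (V (N, 0)) \<^bold>= add (V (N, 2)) (V (N, 0)) \<^bold>\<longrightarrow> V (N, 1) \<^bold>= V (N, 2)) \<^bold>\<and>
          (V (N, 1) \<^bold>= V (N, 2) \<^bold>\<longrightarrow> add (V (N, 1)) (V (N, 0)) \<^bold>= add (V (N, 2)) (V (N, 0)))"])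
    (auto simp: pra_term_def)

lemma pl_cancel_left [simp]:
  "n \<in> D N \<Longrightarrow> a \<in> D N \<Longrightarrow> b \<in> D N \<Longrightarrow> pl n a = pl n b \<longleftrightarrow> a = b"
  using pl_cancel_right by (simp add: pl_commute[of _ n])

lemma pl_eq_self [simp]:
  "a \<in> D N \<Longrightarrow> k \<in> D N \<Longrightarrow> pl a k = a \<longleftrightarrow> k = Z"
  "a \<in> D N \<Longrightarrow> k \<in> D N \<Longrightarrow> a = pl a k \<longleftrightarrow> k = Z"
  using pl_cancel_left[of a k Z] pl_cancel_left[of a Z k] by auto

text \<open>Induction may not contain an existential quantifier; the predecessor is the explicit
  witness.\<close>

lemma N_cases:
  assumes "n \<in> D N"
  obtains "n = Z" | m where "m \<in> D N" "n = S m"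
proof -
  have "n = Z \<or> n = S (pd n)"
    using assms by (rule_tac qf_induct[where P = "\<lambda>n. n = Z \<or> n = S (pd n)" and \<rho> = env0 and
        \<phi> = "V (N, 0) \<^bold>= zero \<^bold>\<or> V (N, 0) \<^bold>= suc (pred (V (N, 0)))"])
      (auto simp: pra_term_def)
  then show thesis using that assms by (metis fun_D(1))
qed

lemma pl_eq_Z [simp]: "a \<in> D N \<Longrightarrow> b \<in> D N \<Longrightarrow> pl a b = Z \<longleftrightarrow> a = Z \<and> b = Z"
  by (erule N_cases[of b]) auto

lemma sb_S_S: "n \<in> D N \<Longrightarrow> a \<in> D N \<Longrightarrow> sb (S a) (S n) = sb a n"
  by (rule qf_induct[where P = "\<lambda>n. sb (S a) (S n) = sb a n" and \<rho> = "env0((N, 1) := a)" and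
        \<phi> = "sub (suc (V (N, 1))) (suc (V (N, 0))) \<^bold>= sub (V (N, 1)) (V (N, 0))"])
    (simp_all add: pra_term_def)

lemma sb_pl: "n \<in> D N \<Longrightarrow> k \<in> D N \<Longrightarrow> sb (pl n k) n = k"
  by (rule qf_induct[where P = "\<lambda>n. sb (pl n k) n = k" and \<rho> = "env0((N, 1) := k)" and
        \<phi> = "sub (add (V (N, 0)) (V (N, 1))) (V (N, 0)) \<^bold>= V (N, 1)"])
    (simp_all add: pra_term_def sb_S_S del: sb_simps(2))

lemma sb_pl': "n \<in> D N \<Longrightarrow> k \<in> D N \<Longrightarrow> sb n (pl n k) = Z"
proof (rule qf_induct[where P = "\<lambda>n. sb n (pl n k) = Z" and \<rho> = "env0((N, 1) := k)" and
        \<phi> = "sub (V (N, 0)) (add (V (N, 0)) (V (N, 1))) \<^bold>= zero"])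
  assume "k \<in> D N"
  then show "sb Z (pl Z k) = Z"
    by (rule_tac qf_induct[where P = "\<lambda>n. sb Z (pl Z n) = Z" and \<rho> = env0 and
        \<phi> = "sub zero (add zero (V (N, 0))) \<^bold>= zero"]) (simp_all add: pra_term_def)
qed (simp_all add: pra_term_def sb_S_S del: sb_simps(2))

lemma sb_self [simp]: "n \<in> D N \<Longrightarrow> sb n n = Z"
  using sb_pl'[of n Z] by simp

text \<open>Again the witness is a term: the truncated differences take the place of an existential
  quantifier and make comparability quantifier-free.\<close>

lemma linear:
  assumes "n \<in> D N" "a \<in> D N"
  obtains k where "k \<in> D N" "a = pl n k" | k where "k \<in> D N" "n = pl a k"
proof -
  have "a = pl n (sb a n) \<or> n = pl a (sb n a)"
    using assms(1)
  proof (rule qf_induct[where P = "\<lambda>n. a = pl n (sb a n) \<or> n = pl a (sb n a)" and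
        \<rho> = "env0((N, 1) := a)" and
        \<phi> = "V (N, 1) \<^bold>= add (V (N, 0)) (sub (V (N, 1)) (V (N, 0))) \<^bold>\<or>
          V (N, 0) \<^bold>= add (V (N, 1)) (sub (V (N, 0)) (V (N, 1)))", rotated -1])
    fix n assume n: "n \<in> D N" and IH: "a = pl n (sb a n) \<or> n = pl a (sb n a)"
    \<comment> \<open>Serves the case that \<open>n\<close> is already at least \<open>a\<close>,
      and also the case of difference zero.\<close>
    have up: "S n = pl a (sb (S n) a)" if "k \<in> D N" "n = pl a k" for k
      using that assms(2) sb_pl[of a "S k"] by simp
    show "a = pl (S n) (sb a (S n)) \<or> S n = pl a (sb (S n) a)"
    proof (cases "n = pl a (sb n a)")
      case True
      then show ?thesis using up[of "sb n a"] n assms(2) by simp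
    next
      case False
      then obtain k where k: "k \<in> D N" "a = pl n k"
        using IH n assms(2) fun_D(3) by blast
      from k(1) show ?thesis
      proof (cases rule: N_cases)
        case 1
        then show ?thesis using up[of Z] k n by simp
      next
        case (2 m)
        then have "a = pl (S n) m" using k n by simp
        then show ?thesis using sb_pl[of "S n" m] n 2 by simp
      qed
    qed
  qed (use assms(2) in \<open>simp_all add: pra_term_def\<close>)
  then show thesis using that assms fun_D(3) by blast
qed

lemma sb_eq_Z: "a \<in> D N \<Longrightarrow> b \<in> D N \<Longrightarrow> sb a b = Z \<longleftrightarrow> (\<exists>k \<in> D N. b = pl a k)"
  by (rule linear[of a b]) (auto simp: sb_pl sb_pl' pl_assoc intro: bexI[of _ Z])

lemma df_eq_Z [simp]:
  "a \<in> D N \<Longrightarrow> b \<in> D N \<Longrightarrow> df a b = Z \<longleftrightarrow> a = b"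
  by (rule linear[of a b]) (auto simp: df_def sb_pl sb_pl')

lemma iz_if: "c \<in> D N \<Longrightarrow> a \<in> D N \<Longrightarrow> b \<in> D N \<Longrightarrow> iz c a b = (if c = Z then a else b)"
  by (erule N_cases[of c]) auto

section \<open>Cantor pairing\<close>

lemma tr_mono:
  assumes "n \<in> D N" "k \<in> D N"
  obtains m where "m \<in> D N" "tr (pl n k) = pl (tr n) m"
proof -
  have "sb (tr n) (tr (pl n k)) = Z"
    using assms(2)
  proof (rule qf_induct[where P = "\<lambda>k. sb (tr n) (tr (pl n k)) = Z" and
        \<rho> = "env0((N, 1) := n)" and
        \<phi> = "sub (triangle_c \<cdot> V (N, 1)) (triangle_c \<cdot> add (V (N, 1)) (V (N, 0))) \<^bold>= zero",
        rotated -1])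
    fix k assume "k \<in> D N" "sb (tr n) (tr (pl n k)) = Z"
    then obtain m where "m \<in> D N" "tr (pl n k) = pl (tr n) m"
      using assms(1) by (auto simp: sb_eq_Z)
    then show "sb (tr n) (tr (pl n (S k))) = Z"
      using assms(1) \<open>k \<in> D N\<close> sb_pl'[of "tr n" "pl m (S (pl n k))"] by (simp add: pl_assoc)
  qed (use assms(1) fun_D(7)[OF assms(1)] in \<open>simp_all add: pra_term_def tr_def\<close>)
  then show thesis using that assms by (auto simp: sb_eq_Z)
qed

text \<open>Codes on a later diagonal are larger: passing from diagonal \<open>a + b\<close> to the
  next one adds \<open>a + b + 1\<close>, which exceeds the offset \<open>a\<close>.\<close>

lemma pr_fst_less:
  assumes "a \<in> D N" "b \<in> D N" "a' \<in> D N" "b' \<in> D N" "k \<in> D N" "pl a' b' = pl (pl a b) (S k)"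
  shows "pr a b \<noteq> pr a' b'"
proof
  assume eq: "pr a b = pr a' b'"
  have "pl a' b' = pl (S (pl a b)) k" using assms by simp
  then obtain m where m: "m \<in> D N" "tr (pl a' b') = pl (tr (S (pl a b))) m"
    using tr_mono[of "S (pl a b)" k] assms by auto
  have "pl (tr (pl a b)) a = pl (pl (pl (tr (pl a b)) (S (pl a b))) m) a'"
    using eq assms(1-5) m(2) by (simp only: pr_eq tr_simps fun_D)
  \<comment> \<open>Both sides now begin with the same triangular number and \<open>a\<close>;
    cancelling leaves zero equal to a successor.\<close>
  also have "\<dots> = pl (tr (pl a b)) (pl a (S (pl b (pl m a'))))"
    using assms(1-5) m(1) by (simp add: pl_assoc)
  finally have "pl a Z = pl a (S (pl b (pl m a')))"
    using assms(1-5) m(1) by (simp del: pl_simps(2) pl_eq_self)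
  then show False using assms(1-5) m(1) by (simp del: pl_simps pl_eq_self)
qed

lemma pr_inject [simp]:
  assumes "a \<in> D N" "b \<in> D N" "a' \<in> D N" "b' \<in> D N"
  shows "pr a b = pr a' b' \<longleftrightarrow> a = a' \<and> b = b'"
proof
  assume eq: "pr a b = pr a' b'"
  have "pl a b = pl a' b'"
  proof (rule linear[of "pl a b" "pl a' b'"])
    fix k assume k: "k \<in> D N" "pl a' b' = pl (pl a b) k"
    from k(1) show ?thesis
      by (cases rule: N_cases) (use k(2) pr_fst_less[OF assms] eq assms in auto)
  next
    fix k assume k: "k \<in> D N" "pl a b = pl (pl a' b') k"
    from k(1) show ?thesis
      by (cases rule: N_cases) (use k(2) pr_fst_less[OF assms(3,4,1,2)] eq assms in auto)
  qed (use assms in simp_all)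
  then show "a = a' \<and> b = b'" using eq assms by (auto simp: pr_eq)
qed simp

text \<open>Both components are at most the code, so the projections may search below
  \<open>suc z\<close>.\<close>

lemma pr_ge:
  assumes "a \<in> D N" "b \<in> D N"
  obtains k l where "k \<in> D N" "l \<in> D N" "pr a b = pl a k" "pr a b = pl b l"
proof -
  obtain m where m: "m \<in> D N" "tr (pl a b) = pl (pl a b) m"
  proof (rule N_cases[of "pl a b"])
    fix m assume "m \<in> D N" "pl a b = S m"
    then show thesis using that[of "tr m"] pl_commute[of "tr m" m] by simp
  next
    assume "pl a b = Z"
    then show thesis using that[of Z] tr_simps(1) pl_simps(1) Z_D by metis
  qed (use assms in simp)
  show thesis
    using that[of "tr (pl a b)" "pl a (pl m a)"] m(1) assms
    by (auto simp: pr_eq m(2) pl_ac)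
qed

text \<open>The searches in the projections have exactly one solution, which spares a general theory
  of least numbers. Once the bound has passed \<open>i\<close>, the result stays
  \<open>i\<close>.\<close>

lemma ls_unique:
  assumes "h \<in> D one" "i \<in> D N" "k \<in> D N" "h \<bullet> i = Z" "\<And>x. x \<in> D N \<Longrightarrow> h \<bullet> x = Z \<Longrightarrow> x = i"
  shows "ls (pl i k) h = i"
proof -
  have step: "ls (S n) h = (if ls n h = i then i else S n)" if "n \<in> D N" for n
  proof (cases "ls n h = i")
    case True
    then show ?thesis using assms(1,2,4) that by simp
  next
    case False
    then have "h \<bullet> ls n h \<noteq> Z" using assms(1,5) that by (meson fun_D(6))
    then show ?thesis using False assms(1) that by (simp add: iz_if)
  qed
  \<comment> \<open>A search that has not yet found \<open>i\<close> returns its bound; at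
    \<open>n = i\<close> both alternatives say the same.\<close>
  have "ls n h = n \<or> ls n h = i" if "n \<in> D N" for n
    by (rule qf_induct[where P = "\<lambda>n. ls n h = n \<or> ls n h = i" and
        \<rho> = "env0((N, 1) := i, (one, 0) := h)" and
        \<phi> = "least (V (N, 0)) (V (one, 0)) \<^bold>= V (N, 0) \<^bold>\<or> least (V (N, 0)) (V (one, 0)) \<^bold>= V (N, 1)"])
      (use assms(1,2) that in \<open>simp_all add: pra_term_def step del: ls_simps(2)\<close>)
  then have base: "ls i h = i" using assms(2) by blast
  show ?thesis
    by (rule qf_induct[where P = "\<lambda>k. ls (pl i k) h = i" and
        \<rho> = "env0((N, 1) := i, (one, 0) := h)" and
        \<phi> = "least (add (V (N, 1)) (V (N, 0))) (V (one, 0)) \<^bold>= V (N, 1)"])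
      (use assms(1-3) in \<open>simp_all add: pra_term_def step base del: ls_simps(2)\<close>)
qed

text \<open>At \<open>a\<close> the inner search finds \<open>b\<close>, so the outer condition
  holds; by injectivity it fails at every other first component, whatever the inner search returns
  there.\<close>

lemma fs_pr [simp]:
  assumes "a \<in> D N" "b \<in> D N"
  shows "fs (pr a b) = a"
proof -
  let ?z = "pr a b"
  let ?h = "ev (env0((N, 2) := ?z)) (\<^bold>\<lambda>v_a. diff (V v_c)
     (pair (V v_a) (least (suc (V v_c)) (\<^bold>\<lambda>v_b. diff (V v_c) (pair (V v_a) (V v_b))))))"
  let ?g = "ev (env0((N, 2) := ?z, (N, 0) := a)) (\<^bold>\<lambda>v_b. diff (V v_c) (pair (V v_a) (V v_b)))"
  obtain k l where kl: "k \<in> D N" "l \<in> D N" "?z = pl a k" "?z = pl b l"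
    using pr_ge assms by metis
  have "ls (pl b (S l)) ?g = b"
    by (rule ls_unique) (use assms kl(1,2) in auto)
  then have "ls (S ?z) ?g = b"
    using kl(2,4) assms by simp
  moreover have "ls (pl a (S k)) ?h = a"
  proof (rule ls_unique)
    show "?h \<bullet> a = Z" using calculation assms by (simp del: ls_simps)
    show "x = a" if "x \<in> D N" "?h \<bullet> x = Z" for x
      using that assms by (simp del: ls_simps)
  qed (use assms kl(1,2) in auto)
  moreover have "S ?z = pl a (S k)" using kl(1,3) assms by simp
  ultimately show ?thesis using assms fs_eq[of ?z] by simp
qed

lemma sn_pr [simp]:
  assumes "a \<in> D N" "b \<in> D N"
  shows "sn (pr a b) = b"
proof -
  let ?z = "pr a b"
  let ?h = "ev (env0((N, 2) := ?z)) (\<^bold>\<lambda>v_b. diff (V v_c) (pair (tfst (V v_c)) (V v_b)))"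
  obtain k l where kl: "k \<in> D N" "l \<in> D N" "?z = pl a k" "?z = pl b l"
    using pr_ge assms by metis
  have "ls (pl b (S l)) ?h = b"
    by (rule ls_unique) (use assms kl(1,2) in auto)
  moreover have "S ?z = pl b (S l)" using kl(2,4) assms by simp
  ultimately show ?thesis using assms sn_eq[of ?z] by simp
qed

end


section \<open>Minimal elements from Feferman's operator\<close>

abbreviation (input) "w_mu \<equiv> V (two, 0)"
abbreviation (input) "w_X \<equiv> V (one, 0)"
abbreviation (input) "w_f \<equiv> V (one, 1)"
abbreviation (input) "w_g \<equiv> V (one, 2)"
abbreviation (input) "w_b \<equiv> V (one, 3)"
abbreviation (input) "w_s \<equiv> V (Star one, 0)"
abbreviation (input) "w_fam \<equiv> V (N \<Rrightarrow> one, 0)"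

text \<open>Truth values are numbers, with 0 for true; so \<open>add\<close> is conjunction.\<close>

definition neg :: "tm \<Rightarrow> tm" where "neg t = ifz t unit zero"

text \<open>A number stands for a pair whose second component is its stage; only stages are
  compared.\<close>

definition less_c :: tm where
  "less_c = (\<^bold>\<lambda>v_h. \<^bold>\<lambda>v_a. \<^bold>\<lambda>v_b.
     ifz (diff (V v_h \<cdot> pair (tsnd (V v_a)) (tsnd (V v_b))) unit)
       (neg (diff (V v_h \<cdot> pair (tsnd (V v_b)) (tsnd (V v_a))) unit)) unit)"

text \<open>If \<open>h\<close> has a zero, \<open>\<mu>\<close> finds one; so this number decides
  an existential quantifier.\<close>

definition ex_c :: tm where
  "ex_c = (\<^bold>\<lambda>(two, 0). \<^bold>\<lambda>v_h. V v_h \<cdot> (w_mu \<cdot> V v_h))"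

definition cand_c :: tm where
  "cand_c = (\<^bold>\<lambda>(one, 0). \<^bold>\<lambda>(one, 3). \<^bold>\<lambda>v_a. \<^bold>\<lambda>v_b.
     add (w_b \<cdot> V v_b) (less_c \<cdot> w_X \<cdot> V v_b \<cdot> V v_a))"

definition min_c :: tm where
  "min_c = (\<^bold>\<lambda>(two, 0). \<^bold>\<lambda>(one, 0). \<^bold>\<lambda>(one, 3). \<^bold>\<lambda>v_a.
     add (w_b \<cdot> V v_a) (neg (ex_c \<cdot> w_mu \<cdot> (cand_c \<cdot> w_X \<cdot> w_b \<cdot> V v_a))))"

text \<open>Where nothing in the set lies below, the value is repeated. In a nonempty set the
  sequence thus fails to descend exactly on reaching a minimal element.\<close>

definition descent_c :: tm where
  "descent_c = (\<^bold>\<lambda>(two, 0). \<^bold>\<lambda>(one, 0). \<^bold>\<lambda>(one, 3). \<^bold>\<lambda>v_a. R0 (V v_a) (w_mu \<cdot> w_b)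
     (\<^bold>\<lambda>v_c. \<^bold>\<lambda>v_d. ifz (ex_c \<cdot> w_mu \<cdot> (cand_c \<cdot> w_X \<cdot> w_b \<cdot> V v_c))
        (w_mu \<cdot> (cand_c \<cdot> w_X \<cdot> w_b \<cdot> V v_c)) (V v_c)))"

definition stop_c :: tm where
  "stop_c = (\<^bold>\<lambda>(two, 0). \<^bold>\<lambda>(one, 0). \<^bold>\<lambda>(one, 3). \<^bold>\<lambda>v_a.
     neg (less_c \<cdot> w_X \<cdot> (descent_c \<cdot> w_mu \<cdot> w_X \<cdot> w_b \<cdot> suc (V v_a)) \<cdot>
       (descent_c \<cdot> w_mu \<cdot> w_X \<cdot> w_b \<cdot> V v_a)))"

definition infinite_c :: tm where
  "infinite_c = (\<^bold>\<lambda>(two, 0). \<^bold>\<lambda>(one, 0). \<^bold>\<lambda>(one, 3).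
     neg (ex_c \<cdot> w_mu \<cdot> (stop_c \<cdot> w_mu \<cdot> w_X \<cdot> w_b)))"

text \<open>A single sequence tests all members of a family: \<open>\<mu>\<close> selects a member with infinite descent,
  if there is one.\<close>

definition seq_c :: tm where
  "seq_c = (\<^bold>\<lambda>(two, 0). \<^bold>\<lambda>(one, 0). \<^bold>\<lambda>(N \<Rrightarrow> one, 0). \<^bold>\<lambda>v_a. tsnd (descent_c \<cdot> w_mu \<cdot> w_X \<cdot>
     (w_fam \<cdot> (w_mu \<cdot> (\<^bold>\<lambda>v_b. infinite_c \<cdot> w_mu \<cdot> w_X \<cdot> (w_fam \<cdot> V v_b)))) \<cdot> V v_a))"

section \<open>The hierarchy\<close>

definition halt_c :: tm where
  "halt_c = (\<^bold>\<lambda>v_h. \<^bold>\<lambda>v_a. \<^bold>\<lambda>v_b. tfst (instr (V v_a) (run (V v_h) (V v_a) (V v_a) (V v_b))))"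

text \<open>\<open>jump_c \<cdot> \<mu> \<cdot> X \<cdot> f\<close> is the right-hand side of the equation for the hierarchy along \<open>X\<close>, at the
  argument \<open>f\<close>.\<close>

definition jump_c :: tm where
  "jump_c = (\<^bold>\<lambda>(two, 0). \<^bold>\<lambda>(one, 0). \<^bold>\<lambda>(one, 1). \<^bold>\<lambda>v_a.
     ifz (diff (w_X \<cdot> pair (tsnd (V v_a)) (tsnd (V v_a))) unit)
       (ifz (ex_c \<cdot> w_mu \<cdot> (halt_c \<cdot> below w_X w_f (tsnd (V v_a)) \<cdot> tfst (V v_a))) unit zero)
       zero)"

definition bad_c :: tm where
  "bad_c = (\<^bold>\<lambda>(two, 0). \<^bold>\<lambda>(one, 0). \<^bold>\<lambda>(one, 1). \<^bold>\<lambda>v_a.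
     neg (diff (w_f \<cdot> V v_a) (jump_c \<cdot> w_mu \<cdot> w_X \<cdot> w_f \<cdot> V v_a)))"

definition differ_c :: tm where
  "differ_c = (\<^bold>\<lambda>(one, 0). \<^bold>\<lambda>(one, 1). \<^bold>\<lambda>(one, 2). \<^bold>\<lambda>v_a. \<^bold>\<lambda>v_b.
     add (neg (diff (w_f \<cdot> V v_b) (w_g \<cdot> V v_b))) (less_c \<cdot> w_X \<cdot> V v_b \<cdot> V v_a))"

text \<open>An initial segment of length \<open>p + 1\<close> has its last entry at
  \<open>p\<close>; hence the successor. For a function without bad numbers the value is arbitrary,
  which does no harm, since such a function is what is sought.\<close>

definition G_c :: tm where
  "G_c = (\<^bold>\<lambda>(two, 0). \<^bold>\<lambda>(one, 0). \<^bold>\<lambda>(one, 1).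
     suc (w_mu \<cdot> (min_c \<cdot> w_mu \<cdot> w_X \<cdot> (bad_c \<cdot> w_mu \<cdot> w_X \<cdot> w_f))))"

text \<open>The member \<open>(0, i)\<close> of the family is the set of bad numbers of the entry \<open>i\<close>, the member
  \<open>(1, i, k, p)\<close> is the set of all \<open>q\<close> below \<open>p\<close> at which the entries \<open>i\<close> and \<open>k\<close> differ.\<close>

definition fam_c :: tm where
  "fam_c = (\<^bold>\<lambda>(two, 0). \<^bold>\<lambda>(one, 0). \<^bold>\<lambda>(Star one, 0). \<^bold>\<lambda>v_a. \<^bold>\<lambda>v_b. ifz (tfst (V v_a))
     (bad_c \<cdot> w_mu \<cdot> w_X \<cdot> entry one w_s (tsnd (V v_a)) \<cdot> V v_b)
     (differ_c \<cdot> w_X \<cdot> entry one w_s (tfst (tsnd (V v_a))) \<cdot>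
        entry one w_s (tfst (tsnd (tsnd (V v_a)))) \<cdot> tsnd (tsnd (tsnd (V v_a))) \<cdot> V v_b))"

text \<open>The function that a cover induced by \<open>G_c\<close> would have to miss.\<close>

definition diag_c :: tm where
  "diag_c = (\<^bold>\<lambda>(two, 0). \<^bold>\<lambda>(one, 0). \<^bold>\<lambda>(Star one, 0). \<^bold>\<lambda>v_a. jump_c \<cdot> w_mu \<cdot> w_X \<cdot>
     entry one w_s (w_mu \<cdot> (\<^bold>\<lambda>v_b. min_c \<cdot> w_mu \<cdot> w_X \<cdot>
       (bad_c \<cdot> w_mu \<cdot> w_X \<cdot> entry one w_s (V v_b)) \<cdot> V v_a)) \<cdot> V v_a)"

definition out_c :: tm where
  "out_c = (\<^bold>\<lambda>(one, 0). \<^bold>\<lambda>(two, 0). \<^bold>\<lambda>v_Theta. V v_Theta \<cdot> (G_c \<cdot> w_mu \<cdot> w_X))"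

text \<open>A list with the single entry \<open>seq_c\<close>, applied to the family for the cover:
  the listing function is constant and the length is 1.\<close>

definition in_c :: tm where
  "in_c = (\<^bold>\<lambda>(one, 0). \<^bold>\<lambda>(two, 0). \<^bold>\<lambda>v_Theta. C (Tab one) \<cdot> unit \<cdot> (C (Pi one N) \<cdot>
     (seq_c \<cdot> w_mu \<cdot> w_X \<cdot> (fam_c \<cdot> w_mu \<cdot> w_X \<cdot> (V v_Theta \<cdot> (G_c \<cdot> w_mu \<cdot> w_X))))))"

section \<open>Typing of the search and hierarchy terms\<close>

lemma neg_term [simp]:
  "tyof t = Some N \<Longrightarrow> tyof (neg t) = Some N" "only_R0 (neg t) = only_R0 t" "tvars (neg t) = tvars t"
  by (auto simp: neg_def)

lemma less_c_term [simp]: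
  "tyof less_c = Some (one \<Rrightarrow> N \<Rrightarrow> N \<Rrightarrow> N)" "only_R0 less_c" "tvars less_c = {}"
  by (auto simp: less_c_def)

lemma ex_c_term [simp]:
  "tyof ex_c = Some (two \<Rrightarrow> one \<Rrightarrow> N)" "only_R0 ex_c" "tvars ex_c = {}"
  by (auto simp: ex_c_def)

lemma cand_c_term [simp]:
  "tyof cand_c = Some (one \<Rrightarrow> one \<Rrightarrow> N \<Rrightarrow> one)" "only_R0 cand_c" "tvars cand_c = {}"
  by (auto simp: cand_c_def)

lemma min_c_term [simp]:
  "tyof min_c = Some (two \<Rrightarrow> one \<Rrightarrow> one \<Rrightarrow> one)" "only_R0 min_c" "tvars min_c = {}"
  by (auto simp: min_c_def)

lemma descent_c_term [simp]:
  "tyof descent_c = Some (two \<Rrightarrow> one \<Rrightarrow> one \<Rrightarrow> one)" "only_R0 descent_c" "tvars descent_c = {}"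
  by (auto simp: descent_c_def)

lemma stop_c_term [simp]:
  "tyof stop_c = Some (two \<Rrightarrow> one \<Rrightarrow> one \<Rrightarrow> one)" "only_R0 stop_c" "tvars stop_c = {}"
  by (auto simp: stop_c_def)

lemma infinite_c_term [simp]:
  "tyof infinite_c = Some (two \<Rrightarrow> one \<Rrightarrow> one \<Rrightarrow> N)" "only_R0 infinite_c" "tvars infinite_c = {}"
  by (auto simp: infinite_c_def)

lemma seq_c_term [simp]:
  "tyof seq_c = Some (two \<Rrightarrow> one \<Rrightarrow> (N \<Rrightarrow> one) \<Rrightarrow> one)" "only_R0 seq_c" "tvars seq_c = {}"
  by (auto simp: seq_c_def)

lemma halt_c_term [simp]:
  "tyof halt_c = Some (one \<Rrightarrow> N \<Rrightarrow> N \<Rrightarrow> N)" "only_R0 halt_c" "tvars halt_c = {}"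
  by (auto simp: halt_c_def)

lemma jump_c_term [simp]:
  "tyof jump_c = Some (two \<Rrightarrow> one \<Rrightarrow> one \<Rrightarrow> one)" "only_R0 jump_c" "tvars jump_c = {}"
  by (auto simp: jump_c_def)

lemma bad_c_term [simp]:
  "tyof bad_c = Some (two \<Rrightarrow> one \<Rrightarrow> one \<Rrightarrow> one)" "only_R0 bad_c" "tvars bad_c = {}"
  by (auto simp: bad_c_def)

lemma differ_c_term [simp]:
  "tyof differ_c = Some (one \<Rrightarrow> one \<Rrightarrow> one \<Rrightarrow> N \<Rrightarrow> one)" "only_R0 differ_c" "tvars differ_c = {}"
  by (auto simp: differ_c_def)

lemma G_c_term [simp]:
  "tyof G_c = Some (two \<Rrightarrow> one \<Rrightarrow> two)" "only_R0 G_c" "tvars G_c = {}"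
  by (auto simp: G_c_def)

lemma fam_c_term [simp]:
  "tyof fam_c = Some (two \<Rrightarrow> one \<Rrightarrow> Star one \<Rrightarrow> N \<Rrightarrow> one)" "only_R0 fam_c" "tvars fam_c = {}"
  by (auto simp: fam_c_def)

lemma diag_c_term [simp]:
  "tyof diag_c = Some (two \<Rrightarrow> one \<Rrightarrow> Star one \<Rrightarrow> one)" "only_R0 diag_c" "tvars diag_c = {}"
  by (auto simp: diag_c_def)

lemma out_c_term [simp]:
  "tyof out_c = Some (one \<Rrightarrow> two \<Rrightarrow> SFF_ty \<Rrightarrow> Star one)" "only_R0 out_c" "tvars out_c = {}"
  by (auto simp: out_c_def)

lemma in_c_term [simp]:
  "tyof in_c = Some (one \<Rrightarrow> two \<Rrightarrow> SFF_ty \<Rrightarrow> Star one)" "only_R0 in_c" "tvars in_c = {}"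
  by (auto simp: in_c_def)

section \<open>Values of these terms in a model with a search operator\<close>

locale epra_mu = epra_model +
  fixes mu X :: 'a
  assumes mu_D [simp]: "mu \<in> D two"
    and X_D [simp]: "X \<in> D one"
    and mu: "f \<in> D one \<Longrightarrow> n \<in> D N \<Longrightarrow> f \<bullet> n = Z \<Longrightarrow> f \<bullet> (mu \<bullet> f) = Z"
begin

lemma ev_neg [simp]: "ev \<rho> (neg t) = iz (ev \<rho> t) (S Z) Z"
  by (simp add: neg_def)

lemma neg_eq_Z [simp]: "a \<in> D N \<Longrightarrow> iz a (S Z) Z = Z \<longleftrightarrow> a \<noteq> Z"
  by (simp add: iz_if)

abbreviation prec :: "'a \<Rightarrow> 'a \<Rightarrow> bool" where
  "prec a b \<equiv> X \<bullet> pr a b = S Z \<and> X \<bullet> pr b a \<noteq> S Z"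

lemmas closed_simps [simp] = closed_D[OF less_c_term(1,2)] closed_D[OF ex_c_term(1,2)]
  closed_D[OF cand_c_term(1,2)] closed_D[OF min_c_term(1,2)] closed_D[OF descent_c_term(1,2)]
  closed_D[OF stop_c_term(1,2)] closed_D[OF infinite_c_term(1,2)] closed_D[OF seq_c_term(1,2)]
  closed_D[OF halt_c_term(1,2)] closed_D[OF jump_c_term(1,2)] closed_D[OF bad_c_term(1,2)]
  closed_D[OF differ_c_term(1,2)] closed_D[OF G_c_term(1,2)] closed_D[OF fam_c_term(1,2)]
  closed_D[OF diag_c_term(1,2)] closed_D[OF below_c_term(1,2)]

lemmas more_ap_D [simp] = ap_D[of _ two one]
  ap_D[of _ one "N \<Rrightarrow> N \<Rrightarrow> N"] ap_D[of _ two "one \<Rrightarrow> N"] ap_D[of _ one "one \<Rrightarrow> N \<Rrightarrow> one"]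
  ap_D[of _ two "one \<Rrightarrow> one \<Rrightarrow> one"] ap_D[of _ one "one \<Rrightarrow> one"]
  ap_D[of _ one one] ap_D[of _ two "one \<Rrightarrow> one \<Rrightarrow> N"] ap_D[of _ two "one \<Rrightarrow> (N \<Rrightarrow> one) \<Rrightarrow> one"]
  ap_D[of _ one "(N \<Rrightarrow> one) \<Rrightarrow> one"] ap_D[of _ "N \<Rrightarrow> one" one]
  ap_D[of _ one "one \<Rrightarrow> one \<Rrightarrow> N \<Rrightarrow> one"] ap_D[of _ one two]
  ap_D[of _ two "one \<Rrightarrow> Star one \<Rrightarrow> N \<Rrightarrow> one"] ap_D[of _ one "Star one \<Rrightarrow> N \<Rrightarrow> one"]
  ap_D[of _ "Star one" "N \<Rrightarrow> one"] ap_D[of _ two "one \<Rrightarrow> Star one \<Rrightarrow> one"]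
  ap_D[of _ one "Star one \<Rrightarrow> one"] ap_D[of _ "Star one" one] ap_D[of _ "Star one" N]

lemma less_c [simp]:
  assumes "a \<in> D N" "b \<in> D N"
  shows "ev env0 less_c \<bullet> X \<bullet> a \<bullet> b = Z \<longleftrightarrow> prec (sn a) (sn b)"
  using assms by (simp add: less_c_def iz_if)

lemma ex_c [simp]:
  assumes "q \<in> D one"
  shows "ev env0 ex_c \<bullet> mu \<bullet> q = Z \<longleftrightarrow> (\<exists>n \<in> D N. q \<bullet> n = Z)"
  using assms mu[of q] by (auto simp: ex_c_def)

lemma cand_c [simp]:
  assumes "b \<in> D one" "a \<in> D N" "q \<in> D N"
  shows "ev env0 cand_c \<bullet> X \<bullet> b \<bullet> a \<bullet> q = Z \<longleftrightarrow> b \<bullet> q = Z \<and> prec (sn q) (sn a)"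
  using assms by (simp add: cand_c_def)

lemma min_c [simp]:
  assumes "b \<in> D one" "a \<in> D N"
  shows "ev env0 min_c \<bullet> mu \<bullet> X \<bullet> b \<bullet> a = Z \<longleftrightarrow>
    b \<bullet> a = Z \<and> (\<forall>q \<in> D N. b \<bullet> q = Z \<longrightarrow> \<not> prec (sn q) (sn a))"
  using assms by (auto simp: min_c_def)

lemma descent_c [simp]:
  assumes "b \<in> D one"
  defines "d \<equiv> ev env0 descent_c \<bullet> mu \<bullet> X \<bullet> b" and "c \<equiv> \<lambda>x. ev env0 cand_c \<bullet> X \<bullet> b \<bullet> x"
  shows "d \<bullet> Z = mu \<bullet> b"
    and "n \<in> D N \<Longrightarrow> d \<bullet> S n = (if \<exists>q \<in> D N. c (d \<bullet> n) \<bullet> q = Z then mu \<bullet> c (d \<bullet> n) else d \<bullet> n)"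
  using assms(1) by (simp_all add: d_def c_def descent_c_def iz_if del: cand_c)

lemma stop_c [simp]:
  assumes "b \<in> D one" "n \<in> D N"
  defines "d \<equiv> ev env0 descent_c \<bullet> mu \<bullet> X \<bullet> b"
  shows "ev env0 stop_c \<bullet> mu \<bullet> X \<bullet> b \<bullet> n = Z \<longleftrightarrow> \<not> prec (sn (d \<bullet> S n)) (sn (d \<bullet> n))"
  using assms(1,2) by (simp add: stop_c_def d_def)

lemma infinite_c [simp]:
  assumes "b \<in> D one"
  defines "d \<equiv> ev env0 descent_c \<bullet> mu \<bullet> X \<bullet> b"
  shows "ev env0 infinite_c \<bullet> mu \<bullet> X \<bullet> b = Z \<longleftrightarrow>
    (\<forall>n \<in> D N. prec (sn (d \<bullet> S n)) (sn (d \<bullet> n)))"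
  using assms(1) by (simp add: infinite_c_def d_def)


lemma seq_c:
  assumes "F \<in> D (N \<Rrightarrow> one)" "c \<in> D N"
    and "\<And>n. n \<in> D N \<Longrightarrow> prec (sn (ev env0 descent_c \<bullet> mu \<bullet> X \<bullet> (F \<bullet> c) \<bullet> S n))
      (sn (ev env0 descent_c \<bullet> mu \<bullet> X \<bullet> (F \<bullet> c) \<bullet> n))"
    and "n \<in> D N"
  defines "g \<equiv> ev env0 seq_c \<bullet> mu \<bullet> X \<bullet> F"
  shows "prec (g \<bullet> S n) (g \<bullet> n)"
proof -
  let ?I = "ev (env0((two, 0) := mu, (one, 0) := X, (N \<Rrightarrow> one, 0) := F))
    (\<^bold>\<lambda>v_b. infinite_c \<cdot> w_mu \<cdot> w_X \<cdot> (w_fam \<cdot> V v_b))"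
  have I: "?I \<in> D one" "?I \<bullet> x = Z \<longleftrightarrow> ev env0 infinite_c \<bullet> mu \<bullet> X \<bullet> (F \<bullet> x) = Z" if "x \<in> D N" for x
    using assms(1) that by (simp_all del: infinite_c)
  \<comment> \<open>The selected member need not be \<open>c\<close>, but it descends infinitely as
    well, and \<open>seq_c\<close> lists the stages of its descent.\<close>
  have "?I \<bullet> (mu \<bullet> ?I) = Z"
    using assms(1-3) by (intro mu[of _ c]) (simp_all add: I)
  then have "prec (sn (ev env0 descent_c \<bullet> mu \<bullet> X \<bullet> (F \<bullet> (mu \<bullet> ?I)) \<bullet> S n))
      (sn (ev env0 descent_c \<bullet> mu \<bullet> X \<bullet> (F \<bullet> (mu \<bullet> ?I)) \<bullet> n))"
    using assms(1,4) I[OF Z_D] I(2)[of "mu \<bullet> ?I"] by simp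
  then show ?thesis
    using assms(1,4) by (simp add: g_def seq_c_def del: descent_c)
qed

text \<open>Membership is an equation between terms, so quantifier-free induction applies although
  the descent is defined with \<open>\<mu>\<close>.\<close>

lemma descent_mem:
  assumes "b \<in> D one" "q \<in> D N" "b \<bullet> q = Z" "n \<in> D N"
  shows "b \<bullet> (ev env0 descent_c \<bullet> mu \<bullet> X \<bullet> b \<bullet> n) = Z"
  using assms(4)
proof (rule qf_induct[where P = "\<lambda>n. b \<bullet> (ev env0 descent_c \<bullet> mu \<bullet> X \<bullet> b \<bullet> n) = Z" and
      \<rho> = "env0((two, 0) := mu, (one, 0) := X, (one, 3) := b)" and
      \<phi> = "w_b \<cdot> (descent_c \<cdot> w_mu \<cdot> w_X \<cdot> w_b \<cdot> V (N, 0)) \<^bold>= zero", rotated -1])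
  fix n assume n: "n \<in> D N" "b \<bullet> (ev env0 descent_c \<bullet> mu \<bullet> X \<bullet> b \<bullet> n) = Z"
  let ?d = "ev env0 descent_c \<bullet> mu \<bullet> X \<bullet> b \<bullet> n"
  let ?c = "ev env0 cand_c \<bullet> X \<bullet> b \<bullet> ?d"
  have "b \<bullet> (mu \<bullet> ?c) = Z" if "\<exists>q \<in> D N. ?c \<bullet> q = Z"
  proof -
    have "?c \<bullet> (mu \<bullet> ?c) = Z" using that assms(1) n(1) by (auto intro: mu simp del: cand_c)
    then show ?thesis using assms(1) n(1) by simp
  qed
  then show "b \<bullet> (ev env0 descent_c \<bullet> mu \<bullet> X \<bullet> b \<bullet> S n) = Z"
    using n assms(1) by (simp del: cand_c)
qed (use assms(1-3) mu[of b q] in \<open>simp_all add: pra_term_def\<close>)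

text \<open>By \<open>seq_c\<close> an infinite descent in any member would make the tested sequence
  descend. So the descent in member \<open>c\<close> fails to go down at some \<open>n\<close>; a
  candidate below its value there would have been taken, hence that value is minimal.\<close>

lemma minimal_exists:
  assumes "F \<in> D (N \<Rrightarrow> one)" "\<exists>n \<in> D N. \<not> prec (ev env0 seq_c \<bullet> mu \<bullet> X \<bullet> F \<bullet> S n) (ev env0 seq_c \<bullet> mu \<bullet> X \<bullet> F \<bullet> n)"
    and "c \<in> D N" "q \<in> D N" "F \<bullet> c \<bullet> q = Z"
  shows "\<exists>p \<in> D N. ev env0 min_c \<bullet> mu \<bullet> X \<bullet> (F \<bullet> c) \<bullet> p = Z"
proof -
  let ?d = "\<lambda>n. ev env0 descent_c \<bullet> mu \<bullet> X \<bullet> (F \<bullet> c) \<bullet> n"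
  have b: "F \<bullet> c \<in> D one" using assms(1,3) by simp
  obtain n where n: "n \<in> D N" "\<not> prec (sn (?d (S n))) (sn (?d n))"
    using assms(1-3) seq_c by blast
  have D: "?d n \<in> D N" using b n(1) by simp
  let ?c = "ev env0 cand_c \<bullet> X \<bullet> (F \<bullet> c) \<bullet> ?d n"
  have "\<not> (\<exists>q \<in> D N. ?c \<bullet> q = Z)"
  proof
    assume ex: "\<exists>q \<in> D N. ?c \<bullet> q = Z"
    then have "?d (S n) = mu \<bullet> ?c"
      using b n(1) by (simp del: cand_c)
    moreover have "?c \<bullet> (mu \<bullet> ?c) = Z"
      using ex b D by (auto intro: mu simp del: cand_c)
    ultimately show False
      using b D n(2) by simp
  qed
  then have "ev env0 min_c \<bullet> mu \<bullet> X \<bullet> (F \<bullet> c) \<bullet> ?d n = Z"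
    using b D descent_mem[OF b assms(4,5) n(1)] by auto
  then show ?thesis using D by blast
qed

section \<open>The hierarchy equation and its bad numbers\<close>

lemma ev_machine [simp]:
  "ev \<rho> (below x y j) = ev env0 below_c \<bullet> ev \<rho> x \<bullet> ev \<rho> y \<bullet> ev \<rho> j"
  "ev \<rho> (instr e c) = ev env0 nth_c \<bullet> ev \<rho> e \<bullet> fs (ev \<rho> c)"
  "ev \<rho> (run x e n t) = ev env0 run_c \<bullet> ev \<rho> x \<bullet> ev \<rho> e \<bullet> ev \<rho> n \<bullet> ev \<rho> t"
  by (simp_all add: below_def instr_def tnth_def run_def ev_closed[of below_c \<rho>]
      ev_closed[of nth_c \<rho>] ev_closed[of run_c \<rho>])

lemma below_c [simp]:
  assumes "f \<in> D one" "j \<in> D N" "a \<in> D N"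
  shows "ev env0 below_c \<bullet> X \<bullet> f \<bullet> j \<bullet> a = (if f \<bullet> a = S Z \<and> prec (sn a) j then S Z else Z)"
  using assms by (simp add: below_c_def iz_if)

text \<open>Here the extensionality of the model enters: oracles with the same values are the same
  object.\<close>

lemma below_cong:
  assumes "f \<in> D one" "g \<in> D one" "j \<in> D N"
    and "\<And>a. a \<in> D N \<Longrightarrow> prec (sn a) j \<Longrightarrow> f \<bullet> a = g \<bullet> a"
  shows "ev env0 below_c \<bullet> X \<bullet> f \<bullet> j = ev env0 below_c \<bullet> X \<bullet> g \<bullet> j"
  by (rule extensional[of _ N N]) (use assms in auto)

lemma halt_c:
  assumes "y \<in> D one" "n \<in> D N" "t \<in> D N"
  shows "ev env0 halt_c \<bullet> y \<bullet> n \<bullet> t =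
    fs (ev env0 nth_c \<bullet> n \<bullet> fs (ev env0 run_c \<bullet> y \<bullet> n \<bullet> n \<bullet> t))"
  using assms by (simp add: halt_c_def)

abbreviation jump :: "'a \<Rightarrow> 'a \<Rightarrow> 'a" where
  "jump f p \<equiv> ev env0 jump_c \<bullet> mu \<bullet> X \<bullet> f \<bullet> p"

lemma jump_eq:
  assumes "f \<in> D one" "p \<in> D N"
  shows "jump f p = (if X \<bullet> pr (sn p) (sn p) = S Z \<and>
    (\<exists>t \<in> D N. ev env0 halt_c \<bullet> (ev env0 below_c \<bullet> X \<bullet> f \<bullet> sn p) \<bullet> fs p \<bullet> t = Z) then S Z else Z)"
  using assms by (simp add: jump_c_def iz_if)

text \<open>The demanded value depends on the function only through the oracle \<open>below\<close>,
  so \<open>run_c\<close> and \<open>nth_c\<close> remain opaque.\<close>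

lemma jump_cong:
  assumes "f \<in> D one" "g \<in> D one" "p \<in> D N"
    and "\<And>a. a \<in> D N \<Longrightarrow> prec (sn a) (sn p) \<Longrightarrow> f \<bullet> a = g \<bullet> a"
  shows "jump f p = jump g p"
proof -
  have "ev env0 below_c \<bullet> X \<bullet> f \<bullet> sn p = ev env0 below_c \<bullet> X \<bullet> g \<bullet> sn p"
    by (rule below_cong) (use assms in simp_all)
  then show ?thesis using assms(1-3) by (simp only: jump_eq)
qed

lemma bad_c [simp]:
  assumes "f \<in> D one" "p \<in> D N"
  shows "ev env0 bad_c \<bullet> mu \<bullet> X \<bullet> f \<bullet> p = Z \<longleftrightarrow> f \<bullet> p \<noteq> jump f p"
  using assms by (simp add: bad_c_def)

lemma differ_c [simp]:
  assumes "f \<in> D one" "g \<in> D one" "p \<in> D N" "q \<in> D N"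
  shows "ev env0 differ_c \<bullet> X \<bullet> f \<bullet> g \<bullet> p \<bullet> q = Z \<longleftrightarrow> f \<bullet> q \<noteq> g \<bullet> q \<and> prec (sn q) (sn p)"
  using assms by (simp add: differ_c_def)

lemma G_c [simp]:
  "f \<in> D one \<Longrightarrow>
    ev env0 G_c \<bullet> mu \<bullet> X \<bullet> f = S (mu \<bullet> (ev env0 min_c \<bullet> mu \<bullet> X \<bullet> (ev env0 bad_c \<bullet> mu \<bullet> X \<bullet> f)))"
  by (simp add: G_c_def)

lemma At_D [simp]: "cv (At one) \<in> D (Star one \<Rrightarrow> N \<Rrightarrow> one)"
  using cv_D[of "At one"] by simp

abbreviation en :: "'a \<Rightarrow> 'a \<Rightarrow> 'a" where "en w i \<equiv> cv (At one) \<bullet> w \<bullet> i"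

lemma fam_c [simp]:
  assumes "w \<in> D (Star one)"
  shows "i \<in> D N \<Longrightarrow> ev env0 fam_c \<bullet> mu \<bullet> X \<bullet> w \<bullet> pr Z i = ev env0 bad_c \<bullet> mu \<bullet> X \<bullet> en w i"
    and "i \<in> D N \<Longrightarrow> k \<in> D N \<Longrightarrow> p \<in> D N \<Longrightarrow>
      ev env0 fam_c \<bullet> mu \<bullet> X \<bullet> w \<bullet> pr (S Z) (pr i (pr k p)) =
        ev env0 differ_c \<bullet> X \<bullet> en w i \<bullet> en w k \<bullet> p"
  by (rule extensional[of _ N N]; use assms in \<open>simp add: fam_c_def del: bad_c differ_c\<close>)+

definition minimal_bad :: "'a \<Rightarrow> 'a \<Rightarrow> bool" where
  "minimal_bad f p \<longleftrightarrow> p \<in> D N \<and> f \<bullet> p \<noteq> jump f p \<and>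
     (\<forall>q \<in> D N. prec (sn q) (sn p) \<longrightarrow> f \<bullet> q = jump f q)"

lemma min_bad_c:
  "f \<in> D one \<Longrightarrow> p \<in> D N \<Longrightarrow>
    ev env0 min_c \<bullet> mu \<bullet> X \<bullet> (ev env0 bad_c \<bullet> mu \<bullet> X \<bullet> f) \<bullet> p = Z \<longleftrightarrow> minimal_bad f p"
  by (auto simp: minimal_bad_def)

lemma diag_c:
  assumes "w \<in> D (Star one)" "p \<in> D N"
  obtains i where "i \<in> D N" "ev env0 diag_c \<bullet> mu \<bullet> X \<bullet> w \<bullet> p = jump (en w i) p"
    "\<And>k. k \<in> D N \<Longrightarrow> minimal_bad (en w k) p \<Longrightarrow> minimal_bad (en w i) p"
proof
  let ?I = "ev (env0((two, 0) := mu, (one, 0) := X, (Star one, 0) := w, (N, 0) := p))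
    (\<^bold>\<lambda>v_b. min_c \<cdot> w_mu \<cdot> w_X \<cdot> (bad_c \<cdot> w_mu \<cdot> w_X \<cdot> entry one w_s (V v_b)) \<cdot> V v_a)"
  have I: "?I \<in> D one" using assms by simp
  have val: "?I \<bullet> k = Z \<longleftrightarrow> minimal_bad (en w k) p" if "k \<in> D N" for k
    using assms that by (simp add: min_bad_c del: min_c)
  show "mu \<bullet> ?I \<in> D N" using I by simp
  then show "minimal_bad (en w k) p \<Longrightarrow> minimal_bad (en w (mu \<bullet> ?I)) p" if "k \<in> D N" for k
    using mu[OF I that] val that by blast
  show "ev env0 diag_c \<bullet> mu \<bullet> X \<bullet> w \<bullet> p = jump (en w (mu \<bullet> ?I)) p"
    using assms by (simp add: diag_c_def)
qed

text \<open>At a common minimal bad place two functions agree with each other below, where both satisfy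
  the equation for the hierarchy, so they predict the same value there.\<close>

lemma jump_unique:
  assumes f: "f \<in> D one" "minimal_bad f p" and g: "g \<in> D one" "minimal_bad g p"
    and trans: "\<And>i j k. i \<in> D N \<Longrightarrow> j \<in> D N \<Longrightarrow> k \<in> D N \<Longrightarrow> prec i j \<Longrightarrow> prec j k \<Longrightarrow> prec i k"
    and min: "\<And>q. q \<in> D N \<Longrightarrow> ev env0 differ_c \<bullet> X \<bullet> f \<bullet> g \<bullet> p \<bullet> q = Z \<Longrightarrow>
      \<exists>q \<in> D N. ev env0 min_c \<bullet> mu \<bullet> X \<bullet> (ev env0 differ_c \<bullet> X \<bullet> f \<bullet> g \<bullet> p) \<bullet> q = Z"
  shows "jump f p = jump g p"
proof (rule ccontr)
  assume "jump f p \<noteq> jump g p"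
  have p: "p \<in> D N" using f(2) by (simp add: minimal_bad_def)
  obtain a where "a \<in> D N" "prec (sn a) (sn p)" "f \<bullet> a \<noteq> g \<bullet> a"
    using jump_cong[OF f(1) g(1) p] \<open>jump f p \<noteq> jump g p\<close> by blast
  then have "ev env0 differ_c \<bullet> X \<bullet> f \<bullet> g \<bullet> p \<bullet> a = Z"
    using f(1) g(1) p by simp
  from min[OF \<open>a \<in> D N\<close> this] obtain q where q: "q \<in> D N" "f \<bullet> q \<noteq> g \<bullet> q" "prec (sn q) (sn p)"
    "\<And>r. r \<in> D N \<Longrightarrow> f \<bullet> r \<noteq> g \<bullet> r \<Longrightarrow> prec (sn r) (sn p) \<Longrightarrow> \<not> prec (sn r) (sn q)"
    using f(1) g(1) p by auto
  \<comment> \<open>By transitivity \<open>r\<close> is also below \<open>p\<close>, so a difference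
    at \<open>r\<close> would contradict the minimality of \<open>q\<close>. Both functions then
    satisfy at \<open>q\<close> the same instance of the equation.\<close>
  have "f \<bullet> r = g \<bullet> r" if "r \<in> D N" "prec (sn r) (sn q)" for r
    using q(4)[OF that(1)] that trans[of "sn r" "sn q" "sn p"] q(1,3) p by auto
  then have "jump f q = jump g q"
    by (rule jump_cong[OF f(1) g(1) q(1)])
  moreover have "f \<bullet> q = jump f q" "g \<bullet> q = jump g q"
    using f(2) g(2) q(1,3) by (auto simp: minimal_bad_def)
  ultimately show False using q(2) by simp
qed

end


section \<open>The covering argument\<close>

lemma tyof_lift [simp]: "tyof (lift \<sigma> t) = tyof t"
  by (simp add: lift_def tyof_tsubst)

lemma only_R0_lift [simp]: "only_R0 t \<Longrightarrow> only_R0 (lift \<sigma> t)"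
  by (simp add: lift_def only_R0_tsubst)

lemma wff_mem_seq: "pra_term x \<sigma> \<Longrightarrow> pra_term w (Star \<sigma>) \<Longrightarrow> wff (mem_seq \<sigma> x w)"
  unfolding mem_seq_def by (auto intro!: wff_lt wff_eq simp: pra_term_def)

section \<open>Sequences and the fan functional in a model\<close>

context epra_model
begin

lemma sat_lt [simp]: "sat \<rho> (lt s t) \<longleftrightarrow> sb (S (ev \<rho> s)) (ev \<rho> t) = Z"
  by (simp add: lt_def le_def)

lemma sat_mem_seq:
  assumes "wt \<rho>" "pra_term x \<sigma>" "pra_term w (Star \<sigma>)"
  shows "sat \<rho> (mem_seq \<sigma> x w) \<longleftrightarrow>
    (\<exists>i \<in> D N. sb (S i) (cv (Len \<sigma>) \<bullet> ev \<rho> w) = Z \<and> ev \<rho> x = cv (At \<sigma>) \<bullet> ev \<rho> w \<bullet> i)"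
proof -
  have "pra_term (lift N x) \<sigma>" "pra_term (entry \<sigma> (lift N w) (V (N, 0))) \<sigma>"
    using assms by (simp_all add: pra_term_def)
  then show ?thesis
    using assms(1) by (simp add: mem_seq_def sat_eq)
qed

lemma
  assumes "n \<in> D N" "f \<in> D (N \<Rrightarrow> \<sigma>)"
  shows Len_Tab: "cv (Len \<sigma>) \<bullet> (cv (Tab \<sigma>) \<bullet> n \<bullet> f) = n"
    and At_Tab: "i \<in> D N \<Longrightarrow> sb (S i) n = Z \<Longrightarrow> cv (At \<sigma>) \<bullet> (cv (Tab \<sigma>) \<bullet> n \<bullet> f) \<bullet> i = f \<bullet> i"
proof -
  let ?n = "(N, 0) :: var" and ?i = "(N, 1) :: var" and ?f = "(N \<Rrightarrow> \<sigma>, 0) :: var"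
  have wt: "wt (env0(?n := n, ?i := i, ?f := f))" if "i \<in> D N" for i using assms that by simp
  show "cv (Len \<sigma>) \<bullet> (cv (Tab \<sigma>) \<bullet> n \<bullet> f) = n"
    using sat_axiom[OF E_PRA.Len_Tab[of "V ?n" "V ?f" \<sigma>] wt[OF Z_D]] by simp
  have "pra_term (entry \<sigma> (C (Tab \<sigma>) \<cdot> V ?n \<cdot> V ?f) (V ?i)) \<sigma>" "pra_term (V ?f \<cdot> V ?i) \<sigma>"
    by (simp_all add: pra_term_def)
  then show "cv (At \<sigma>) \<bullet> (cv (Tab \<sigma>) \<bullet> n \<bullet> f) \<bullet> i = f \<bullet> i" if "i \<in> D N" "sb (S i) n = Z"
    using sat_axiom[OF E_PRA.At_Tab[of "V ?n" "V ?f" \<sigma> "V ?i"] wt[OF that(1)]] wt[OF that(1)] that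
    by (simp add: sat_eq del: sb_simps)
qed

lemma sat_MU:
  "sat \<rho> (MU (V v_mu)) \<longleftrightarrow>
    (\<forall>f \<in> D one. (\<exists>n \<in> D N. f \<bullet> n = Z) \<longrightarrow> f \<bullet> (\<rho> v_mu \<bullet> f) = Z)"
  by (simp add: MU_def)

text \<open>The entry is returned by its index, because \<open>fam_c\<close> and
  \<open>diag_c\<close> address entries by number.\<close>

lemma sat_SFF:
  assumes "sat \<rho> (SFF (V v_Theta))" "wt \<rho>" "G \<in> D two" "f \<in> D one"
    and "\<And>n. n \<in> D N \<Longrightarrow> sb (f \<bullet> n) (S Z) = Z"
  obtains i where "i \<in> D N" "sb (S i) (cv (Len one) \<bullet> (\<rho> v_Theta \<bullet> G)) = Z"
    "\<And>n. n \<in> D N \<Longrightarrow> sb (S n) (G \<bullet> (cv (At one) \<bullet> (\<rho> v_Theta \<bullet> G) \<bullet> i)) = Z \<Longrightarrow>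
      f \<bullet> n = cv (At one) \<bullet> (\<rho> v_Theta \<bullet> G) \<bullet> i \<bullet> n"
proof -
  let ?\<rho> = "\<rho>(v_G := G, v_f := f)"
  have "sat ?\<rho> (binary (V v_f))"
    using assms(5) by (simp add: binary_def le_def)
  then have "sat ?\<rho> (\<^bold>\<exists>v_g. mem_seq one (V v_g) (V v_Theta \<cdot> V v_G) \<^bold>\<and>
        extends (V v_f) (initseg (V v_g) (V v_G \<cdot> V v_g)))"
    using assms(1,3,4) by (simp add: SFF_def)
  then obtain g where g: "g \<in> D one" "sat (?\<rho>(v_g := g)) (mem_seq one (V v_g) (V v_Theta \<cdot> V v_G))"
    "sat (?\<rho>(v_g := g)) (extends (V v_f) (initseg (V v_g) (V v_G \<cdot> V v_g)))"
    by auto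
  have "wt (?\<rho>(v_g := g))" using assms g(1) by simp
  then obtain i where i: "i \<in> D N" "sb (S i) (cv (Len one) \<bullet> (\<rho> v_Theta \<bullet> G)) = Z"
    "g = cv (At one) \<bullet> (\<rho> v_Theta \<bullet> G) \<bullet> i"
    using g(2) by (auto simp: sat_mem_seq pra_term_def)
  have "f \<bullet> n = g \<bullet> n" if "n \<in> D N" "sb (S n) (G \<bullet> g) = Z" for n
    using g(1,3) assms(3) that by (simp add: extends_def initseg_def Len_Tab At_Tab del: sb_simps)
  then show thesis using that i by simp
qed

end

context epra_mu
begin

text \<open>The entry whose neighbourhood captures the diagonal function is the hierarchy: at a
  selected bad number the two would differ inside that neighbourhood. \<open>P\<close> stands for
  the bound of the index by the length of \<open>w\<close>.\<close>

lemma hierarchy_in_cover: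
  assumes w: "w \<in> D (Star one)"
    and seq: "\<exists>n \<in> D N. \<not> prec (ev env0 seq_c \<bullet> mu \<bullet> X \<bullet> (ev env0 fam_c \<bullet> mu \<bullet> X \<bullet> w) \<bullet> S n)
      (ev env0 seq_c \<bullet> mu \<bullet> X \<bullet> (ev env0 fam_c \<bullet> mu \<bullet> X \<bullet> w) \<bullet> n)"
    and trans: "\<And>i j k. i \<in> D N \<Longrightarrow> j \<in> D N \<Longrightarrow> k \<in> D N \<Longrightarrow> prec i j \<Longrightarrow> prec j k \<Longrightarrow> prec i k"
    and cover: "\<And>f. f \<in> D one \<Longrightarrow> (\<And>n. n \<in> D N \<Longrightarrow> sb (f \<bullet> n) (S Z) = Z) \<Longrightarrow>
      \<exists>i \<in> D N. P i \<and> (\<forall>n \<in> D N. sb (S n) (ev env0 G_c \<bullet> mu \<bullet> X \<bullet> en w i) = Z \<longrightarrow>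
        f \<bullet> n = en w i \<bullet> n)"
  obtains i where "i \<in> D N" "P i" "\<And>p. p \<in> D N \<Longrightarrow> en w i \<bullet> p = jump (en w i) p"
proof -
  have F: "ev env0 fam_c \<bullet> mu \<bullet> X \<bullet> w \<in> D (N \<Rrightarrow> one)" using w by simp
  let ?f = "ev env0 diag_c \<bullet> mu \<bullet> X \<bullet> w"
  have f: "?f \<in> D one" using w by simp
  \<comment> \<open>The diagonal function takes values of \<open>jump\<close> only, which are 0 or
    1, so it lies in Cantor space.\<close>
  have "sb (?f \<bullet> n) (S Z) = Z" if n: "n \<in> D N" for n
  proof -
    obtain i where i: "i \<in> D N" "?f \<bullet> n = jump (en w i) n" using diag_c[OF w n] by blast
    then show ?thesis using w n by (simp add: jump_eq)
  qed
  then obtain i where i: "i \<in> D N" "P i"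
    "\<And>n. n \<in> D N \<Longrightarrow> sb (S n) (ev env0 G_c \<bullet> mu \<bullet> X \<bullet> en w i) = Z \<Longrightarrow> ?f \<bullet> n = en w i \<bullet> n"
    using cover[OF f] by blast
  have g: "en w k \<in> D one" if "k \<in> D N" for k using w that by simp
  have "en w i \<bullet> q = jump (en w i) q" if q: "q \<in> D N" for q
  proof (rule ccontr)
    assume "en w i \<bullet> q \<noteq> jump (en w i) q"
    let ?m = "ev env0 min_c \<bullet> mu \<bullet> X \<bullet> (ev env0 bad_c \<bullet> mu \<bullet> X \<bullet> en w i)"
    define p where "p = mu \<bullet> ?m"
    have m: "?m \<in> D one" using g i(1) by simp
    then have p: "p \<in> D N" by (simp add: p_def)
    have "\<exists>p \<in> D N. ?m \<bullet> p = Z"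
      using minimal_exists[OF F seq, of "pr Z i" q] q i(1) w \<open>en w i \<bullet> q \<noteq> jump (en w i) q\<close> by simp
    then have "?m \<bullet> p = Z" using mu[OF m] by (auto simp: p_def)
    then have bad: "minimal_bad (en w i) p"
      using min_bad_c[OF g[OF i(1)] p] by blast
    obtain k where k: "k \<in> D N" "?f \<bullet> p = jump (en w k) p" "minimal_bad (en w k) p"
      using diag_c[OF w p] bad i(1) by blast
    have "jump (en w k) p = jump (en w i) p"
    proof (rule jump_unique[OF g[OF k(1)] k(3) g[OF i(1)] bad trans])
      fix q assume "q \<in> D N" "ev env0 differ_c \<bullet> X \<bullet> en w k \<bullet> en w i \<bullet> p \<bullet> q = Z"
      then show "\<exists>q \<in> D N. ev env0 min_c \<bullet> mu \<bullet> X \<bullet>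
          (ev env0 differ_c \<bullet> X \<bullet> en w k \<bullet> en w i \<bullet> p) \<bullet> q = Z"
        using minimal_exists[OF F seq, of "pr (S Z) (pr k (pr i p))" q] k(1) i(1) p w
        by (simp del: differ_c min_c)
    qed
    moreover have "?f \<bullet> p = en w i \<bullet> p"
    proof (rule i(3)[OF p])
      \<comment> \<open>\<open>p\<close> is the last position that the neighbourhood of the entry
        fixes.\<close>
      have "ev env0 G_c \<bullet> mu \<bullet> X \<bullet> en w i = S p" using g[OF i(1)] by (simp add: p_def)
      then show "sb (S p) (ev env0 G_c \<bullet> mu \<bullet> X \<bullet> en w i) = Z"
        using p sb_self[of "S p"] by (simp del: sb_simps)
    qed
    \<comment> \<open>The diagonal value at \<open>p\<close> is the one demanded by entry
      \<open>k\<close>, hence by entry \<open>i\<close>; it is also the actual value of entry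
      \<open>i\<close>, for which \<open>p\<close> is bad.\<close>
    ultimately show False using bad k(2) by (simp add: minimal_bad_def)
  qed
  then show thesis using that i by blast
qed

text \<open>\<open>jump\<close> has values 0 and 1, which gives the binary part; at a pair the
  projections recover \<open>n\<close> and \<open>j\<close>, and the equation becomes the
  equivalence in \<open>H\<close>.\<close>

lemma sat_H:
  assumes "Y \<in> D one" "\<And>p. p \<in> D N \<Longrightarrow> Y \<bullet> p = jump Y p" "\<rho> v_X = X" "\<rho> v_Y = Y"
  shows "sat \<rho> (H theta0 (V v_X) (V v_Y))"
proof -
  have "sb (Y \<bullet> p) (S Z) = Z" if "p \<in> D N" for p
    using assms(1,2) that by (simp add: jump_eq)
  moreover have "Y \<bullet> pr n j = S Z \<longleftrightarrow> X \<bullet> pr j j = S Z \<and>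
      (\<exists>t \<in> D N. fs (ev env0 nth_c \<bullet> n \<bullet>
        fs (ev env0 run_c \<bullet> (ev env0 below_c \<bullet> X \<bullet> Y \<bullet> j) \<bullet> n \<bullet> n \<bullet> t)) = Z)"
    if "n \<in> D N" "j \<in> D N" for n j
  proof -
    have B: "ev env0 below_c \<bullet> X \<bullet> Y \<bullet> j \<in> D one" using assms(1) that by simp
    show ?thesis
      using assms(2)[of "pr n j"] assms(1) that by (simp add: jump_eq halt_c[OF B])
  qed
  ultimately show ?thesis
    using assms(3,4) by (simp add: H_def binary_def le_def mem_def field_in_def le_in_def theta0_def)
qed

end

lemma (in epra_model) sat_WO:
  assumes "sat \<rho> (WO (V v_g) (V v_X))" "wt \<rho>"
  defines "prec \<equiv> \<lambda>a b. \<rho> v_X \<bullet> pr a b = S Z \<and> \<rho> v_X \<bullet> pr b a \<noteq> S Z"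
  shows "i \<in> D N \<Longrightarrow> j \<in> D N \<Longrightarrow> k \<in> D N \<Longrightarrow> prec i j \<Longrightarrow> prec j k \<Longrightarrow> prec i k"
    and "\<exists>n \<in> D N. \<not> prec (\<rho> v_g \<bullet> S n) (\<rho> v_g \<bullet> n)"
proof -
  have "sat \<rho> (LO (V v_X))"
    using assms(1) unfolding WO_def sat_connectives by blast
  then have "sat \<rho> (\<^bold>\<forall>(N, 1). \<^bold>\<forall>(N, 2). \<^bold>\<forall>(N, 3). le_in (V v_X) (V (N, 1)) (V (N, 2)) \<^bold>\<and>
      le_in (V v_X) (V (N, 2)) (V (N, 3)) \<^bold>\<longrightarrow> le_in (V v_X) (V (N, 1)) (V (N, 3)))"
    unfolding LO_def sat_connectives(2) by blast
  moreover have "sat \<rho> \<dots> \<longleftrightarrow> (\<forall>i \<in> D N. \<forall>j \<in> D N. \<forall>k \<in> D N.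
      \<rho> v_X \<bullet> pr i j = S Z \<and> \<rho> v_X \<bullet> pr j k = S Z \<longrightarrow> \<rho> v_X \<bullet> pr i k = S Z)"
    by (simp add: le_in_def mem_def)
  ultimately have tr: "\<rho> v_X \<bullet> pr i k = S Z"
    if "i \<in> D N" "j \<in> D N" "k \<in> D N" "\<rho> v_X \<bullet> pr i j = S Z" "\<rho> v_X \<bullet> pr j k = S Z" for i j k
    using that by blast
  \<comment> \<open>Strictness takes a second use of transitivity: from \<open>k\<close> below or
    equal to \<open>i\<close> and \<open>i\<close> to \<open>j\<close> one gets \<open>k\<close> to
    \<open>j\<close>, against \<open>prec j k\<close>.\<close>
  show "prec i k" if "i \<in> D N" "j \<in> D N" "k \<in> D N" "prec i j" "prec j k"
    using that tr[of i j k] tr[of k i j] unfolding prec_def by blast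
  have "\<not> sat \<rho> (\<^bold>\<forall>(N, 0). less_in (V v_X) (V v_g \<cdot> suc (V (N, 0))) (V v_g \<cdot> V (N, 0)))"
    using assms(1) unfolding WO_def sat_connectives by blast
  then show "\<exists>n \<in> D N. \<not> prec (\<rho> v_g \<bullet> S n) (\<rho> v_g \<bullet> n)"
    by (auto simp: less_in_def le_in_def mem_def prec_def)
qed

text \<open>Two environments occur because the assumptions on \<open>\<mu>\<close> and
  \<open>\<Theta>\<close> stand outside the quantifier over \<open>X\<close>.\<close>

lemma (in epra_model) sat_main:
  assumes "wt \<rho>" "sat \<rho>' (MU (V v_mu))" "sat \<rho>' (SFF (V v_Theta))"
    and \<rho>': "wt \<rho>'" "\<rho>' v_mu = \<rho> v_mu" "\<rho>' v_Theta = \<rho> v_Theta"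
    and WO: "sat \<rho> (\<^bold>\<forall>v_g. mem_seq one (V v_g) (in_c \<cdot> V v_X \<cdot> V v_mu \<cdot> V v_Theta) \<^bold>\<longrightarrow>
      WO (V v_g) (V v_X))"
  shows "sat \<rho> (\<^bold>\<exists>v_Y. mem_seq one (V v_Y) (out_c \<cdot> V v_X \<cdot> V v_mu \<cdot> V v_Theta) \<^bold>\<and>
    H theta0 (V v_X) (V v_Y))"
proof -
  have \<rho>: "\<rho> v_mu \<in> D two" "\<rho> v_X \<in> D one" "\<rho> v_Theta \<in> D SFF_ty"
    using wt_D[OF assms(1)] by (metis fst_conv)+
  interpret epra_mu D ap cv "\<rho> v_mu" "\<rho> v_X"
    by unfold_locales (use \<rho> assms(2) \<rho>'(2) in \<open>auto simp: sat_MU\<close>)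
  let ?mu = "\<rho> v_mu" and ?X = "\<rho> v_X"
  define G where "G = ev env0 G_c \<bullet> ?mu \<bullet> ?X"
  define w where "w = \<rho> v_Theta \<bullet> G"
  define F where "F = ev env0 fam_c \<bullet> ?mu \<bullet> ?X \<bullet> w"
  define g where "g = ev env0 seq_c \<bullet> ?mu \<bullet> ?X \<bullet> F"
  have G: "G \<in> D two" by (simp add: G_def)
  have w: "w \<in> D (Star one)" using \<rho>(3) G ap_D by (simp add: w_def)
  have F: "F \<in> D (N \<Rrightarrow> one)" using w by (simp add: F_def)
  have g: "g \<in> D one" using F by (simp add: g_def)
  have inp: "ev \<rho>' (in_c \<cdot> V v_X \<cdot> V v_mu \<cdot> V v_Theta) =
      cv (Tab one) \<bullet> S Z \<bullet> (cv (Pi one N) \<bullet> g)"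
    and out: "ev \<rho>' (out_c \<cdot> V v_X \<cdot> V v_mu \<cdot> V v_Theta) = w"
    if "\<rho>' v_X = ?X" "\<rho>' v_mu = ?mu" "\<rho>' v_Theta = \<rho> v_Theta" for \<rho>'
  proof -
    have "ev env0 in_c \<bullet> ?X \<bullet> ?mu \<bullet> \<rho> v_Theta = cv (Tab one) \<bullet> S Z \<bullet> (cv (Pi one N) \<bullet> g)"
      "ev env0 out_c \<bullet> ?X \<bullet> ?mu \<bullet> \<rho> v_Theta = w"
      using \<rho> by (simp_all add: in_c_def out_c_def g_def F_def w_def G_def)
    then show "ev \<rho>' (in_c \<cdot> V v_X \<cdot> V v_mu \<cdot> V v_Theta) =
        cv (Tab one) \<bullet> S Z \<bullet> (cv (Pi one N) \<bullet> g)"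
      "ev \<rho>' (out_c \<cdot> V v_X \<cdot> V v_mu \<cdot> V v_Theta) = w"
      using that by (simp_all add: ev_closed[of in_c \<rho>'] ev_closed[of out_c \<rho>'])
  qed
  have K: "cv (Pi one N) \<bullet> g \<in> D (N \<Rrightarrow> one)"
    using cv_D[of "Pi one N"] g ap_D by simp
  have "g = cv (At one) \<bullet> (cv (Tab one) \<bullet> S Z \<bullet> (cv (Pi one N) \<bullet> g)) \<bullet> Z"
    using K g Pi_ap by (simp add: At_Tab)
  then have "sat (\<rho>(v_g := g)) (mem_seq one (V v_g) (in_c \<cdot> V v_X \<cdot> V v_mu \<cdot> V v_Theta))"
    using assms(1) g K inp by (subst sat_mem_seq) (auto simp: pra_term_def Len_Tab intro!: bexI[of _ Z])
  then have wo: "sat (\<rho>(v_g := g)) (WO (V v_g) (V v_X))"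
    using WO g by simp
  have wt': "wt (\<rho>(v_g := g))" using assms(1) g by simp
  obtain i where i: "i \<in> D N" "sb (S i) (cv (Len one) \<bullet> w) = Z"
    "\<And>p. p \<in> D N \<Longrightarrow> en w i \<bullet> p = jump (en w i) p"
  proof (rule hierarchy_in_cover[OF w, where P = "\<lambda>i. sb (S i) (cv (Len one) \<bullet> w) = Z"])
    show "\<exists>n \<in> D N. \<not> prec (ev env0 seq_c \<bullet> ?mu \<bullet> ?X \<bullet> (ev env0 fam_c \<bullet> ?mu \<bullet> ?X \<bullet> w) \<bullet> S n)
      (ev env0 seq_c \<bullet> ?mu \<bullet> ?X \<bullet> (ev env0 fam_c \<bullet> ?mu \<bullet> ?X \<bullet> w) \<bullet> n)"
      using sat_WO(2)[OF wo wt'] by (simp add: g_def F_def)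
    show "prec i k" if "i \<in> D N" "j \<in> D N" "k \<in> D N" "prec i j" "prec j k" for i j k
      using sat_WO(1)[OF wo wt' that(1-3)] that(4,5) by simp
    show "\<exists>i \<in> D N. sb (S i) (cv (Len one) \<bullet> w) = Z \<and>
        (\<forall>n \<in> D N. sb (S n) (ev env0 G_c \<bullet> ?mu \<bullet> ?X \<bullet> en w i) = Z \<longrightarrow> f \<bullet> n = en w i \<bullet> n)"
      if "f \<in> D one" "\<And>n. n \<in> D N \<Longrightarrow> sb (f \<bullet> n) (S Z) = Z" for f
      using sat_SFF[OF assms(3) \<rho>'(1) G that] unfolding w_def G_def \<rho>'(3) by metis
  qed (rule that)
  let ?Y = "en w i"
  have Y: "?Y \<in> D one" using w i(1) by simp
  have "sat (\<rho>(v_Y := ?Y)) (mem_seq one (V v_Y) (out_c \<cdot> V v_X \<cdot> V v_mu \<cdot> V v_Theta))"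
    using assms(1) Y i(1,2) out by (subst sat_mem_seq) (auto simp: pra_term_def intro!: bexI[of _ i])
  moreover have "sat (\<rho>(v_Y := ?Y)) (H theta0 (V v_X) (V v_Y))"
    by (rule sat_H[OF Y i(3)]) simp_all
  ultimately show ?thesis using Y by auto
qed

lemma wff_main:
  "wff (\<^bold>\<forall>v_mu. \<^bold>\<forall>v_Theta. MU (V v_mu) \<^bold>\<and> SFF (V v_Theta) \<^bold>\<longrightarrow>
    (\<^bold>\<forall>v_X.
      (\<^bold>\<forall>v_g. mem_seq one (V v_g) (in_c \<cdot> V v_X \<cdot> V v_mu \<cdot> V v_Theta) \<^bold>\<longrightarrow> WO (V v_g) (V v_X)) \<^bold>\<longrightarrow>
      (\<^bold>\<exists>v_Y. mem_seq one (V v_Y) (out_c \<cdot> V v_X \<cdot> V v_mu \<cdot> V v_Theta) \<^bold>\<and>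
         H theta0 (V v_X) (V v_Y))))"
proof -
  have "wff (MU (V v_mu))"
    by (simp add: MU_def pra_term_def)
  moreover have "wff (SFF (V v_Theta))"
    by (simp add: SFF_def binary_def le_def extends_def initseg_def pra_term_def
        wff_mem_seq wff_lt)
  moreover have "wff (WO (V v_g) (V v_X))"
    unfolding WO_def LO_def less_in_def le_in_def field_in_def mem_def
    by (simp add: pra_term_def)
  moreover have "wff (H theta0 (V v_X) (V v_Y))"
    unfolding H_def binary_def field_in_def le_in_def mem_def theta0_def le_def
    by (simp add: pra_term_def)
  ultimately show ?thesis
    by (simp add: wff_mem_seq pra_term_def)
qed

theorem corollary6p6:
  shows "\<exists>ti to.
    godel_T_term ti (one \<Rrightarrow> two \<Rrightarrow> SFF_ty \<Rrightarrow> Star one) \<and>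
    godel_T_term to (one \<Rrightarrow> two \<Rrightarrow> SFF_ty \<Rrightarrow> Star one) \<and>
    E_PRA \<turnstile>
      (\<^bold>\<forall>v_mu. \<^bold>\<forall>v_Theta. MU (V v_mu) \<^bold>\<and> SFF (V v_Theta) \<^bold>\<longrightarrow>
        (\<^bold>\<forall>v_X.
          (\<^bold>\<forall>v_g. mem_seq one (V v_g) (ti \<cdot> V v_X \<cdot> V v_mu \<cdot> V v_Theta) \<^bold>\<longrightarrow> WO (V v_g) (V v_X)) \<^bold>\<longrightarrow>
          (\<^bold>\<exists>v_Y. mem_seq one (V v_Y) (to \<cdot> V v_X \<cdot> V v_mu \<cdot> V v_Theta) \<^bold>\<and>
             H theta0 (V v_X) (V v_Y))))"
proof (intro exI conjI)
  show "godel_T_term in_c (one \<Rrightarrow> two \<Rrightarrow> SFF_ty \<Rrightarrow> Star one)"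
    "godel_T_term out_c (one \<Rrightarrow> two \<Rrightarrow> SFF_ty \<Rrightarrow> Star one)"
    by (simp_all add: godel_T_term_def)
  show "E_PRA \<turnstile>
      (\<^bold>\<forall>v_mu. \<^bold>\<forall>v_Theta. MU (V v_mu) \<^bold>\<and> SFF (V v_Theta) \<^bold>\<longrightarrow>
        (\<^bold>\<forall>v_X.
          (\<^bold>\<forall>v_g. mem_seq one (V v_g) (in_c \<cdot> V v_X \<cdot> V v_mu \<cdot> V v_Theta) \<^bold>\<longrightarrow> WO (V v_g) (V v_X)) \<^bold>\<longrightarrow>
          (\<^bold>\<exists>v_Y. mem_seq one (V v_Y) (out_c \<cdot> V v_X \<cdot> V v_mu \<cdot> V v_Theta) \<^bold>\<and>
             H theta0 (V v_X) (V v_Y))))"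
  proof (rule completeness[OF wff_main])
    fix D :: "ty \<Rightarrow> tm set" and ap cv \<rho>
    assume "epra_model D ap cv" and wt: "interp.wt D \<rho>"
    then interpret epra_model D ap cv by simp
    show "sat \<rho> (\<^bold>\<forall>v_mu. \<^bold>\<forall>v_Theta. MU (V v_mu) \<^bold>\<and> SFF (V v_Theta) \<^bold>\<longrightarrow>
        (\<^bold>\<forall>v_X.
          (\<^bold>\<forall>v_g. mem_seq one (V v_g) (in_c \<cdot> V v_X \<cdot> V v_mu \<cdot> V v_Theta) \<^bold>\<longrightarrow> WO (V v_g) (V v_X)) \<^bold>\<longrightarrow>
          (\<^bold>\<exists>v_Y. mem_seq one (V v_Y) (out_c \<cdot> V v_X \<cdot> V v_mu \<cdot> V v_Theta) \<^bold>\<and>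
             H theta0 (V v_X) (V v_Y))))"
      \<comment> \<open>Only the outer quantifiers are opened, so that the inner formulas keep the
        shape that \<open>sat_main\<close> expects.\<close>
      unfolding sat_quantifiers(1)[of \<rho>] sat_quantifiers(1)[of "\<rho>(_ := _)"]
        sat_quantifiers(1)[of "\<rho>(_ := _, _ := _)" v_X] sat.simps(3) sat_connectives(2)
    proof (intro ballI impI, elim conjE)
      fix mu Theta X
      let ?\<rho> = "\<rho>(v_mu := mu, v_Theta := Theta)"
      assume D: "mu \<in> D (fst v_mu)" "Theta \<in> D (fst v_Theta)" "X \<in> D (fst v_X)"
        and sat: "sat ?\<rho> (MU (V v_mu))" "sat ?\<rho> (SFF (V v_Theta))"
        and WO: "sat (?\<rho>(v_X := X)) (\<^bold>\<forall>v_g. mem_seq one (V v_g) (in_c \<cdot> V v_X \<cdot> V v_mu \<cdot> V v_Theta) \<^bold>\<longrightarrow>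
          WO (V v_g) (V v_X))"
      have "wt ?\<rho>" "wt (?\<rho>(v_X := X))" using wt D by simp_all
      then show "sat (?\<rho>(v_X := X))
        (\<^bold>\<exists>v_Y. mem_seq one (V v_Y) (out_c \<cdot> V v_X \<cdot> V v_mu \<cdot> V v_Theta) \<^bold>\<and> H theta0 (V v_X) (V v_Y))"
        using sat by (intro sat_main[OF _ sat _ _ _ WO]) simp_all
    qed
  qed
qed

end
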